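(* If $S\subseteq \mathbb Z$ is Bohr dense, then there is a Bohr dense set $S'\subseteq S$ such that for all $m\in \mathbb Z$, the set $(S'-m)\setminus \{0\}$ is not a set of measurable recurrence.
   Context: $\mathbb T=\mathbb R/\mathbb Z$ with the quotient topology. The Bohr topology of $\mathbb Z$ is the weakest topology on $\mathbb Z$ making all homomorphisms from $\mathbb Z$ into $\mathbb T$ continuous; a set $S\subseteq\mathbb Z$ is Bohr dense if it is dense in this topology. For $m\in\mathbb Z$, $S-m:=\{s-m:s\in S\}$. A measure preserving system is a triple $(X,\mu,T)$ where $(X,\mu)$ is a probability measure space and $T:X\to X$ is an invertible transformation preserving $\mu$: for every measurable $D\subseteq X$, $T^{-1}D$ is measurable and $\mu(T^{-1}D)=\mu(D)$. A set $S\subseteq\mathbb Z$ is a set of measurable recurrence if for every measure preserving system $(X,\mu,T)$ and every measurable $D\subseteq X$ with $\mu(D)>0$ there is an $n\in S$ such that $D\cap T^nD\neq\varnothing$. *)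

theory Defs
  imports "HOL-Probability.Probability"
begin

quotient_type circle = real / "\<lambda>x y. x - y \<in> \<int>"
proof (rule equivpI)
  show "reflp (\<lambda>x y::real. x - y \<in> \<int>)"
    by (simp add: reflp_def)
  show "symp (\<lambda>x y::real. x - y \<in> \<int>)"
    by (metis (no_types, lifting) Ints_minus minus_diff_eq sympI)
  show "transp (\<lambda>x y::real. x - y \<in> \<int>)"
  proof (rule transpI)
    fix x y z :: real
    assume "x - y \<in> \<int>" "y - z \<in> \<int>"
    from Ints_add[OF this] show "x - z \<in> \<int>" by simp
  qed
qed

instantiation circle :: ab_group_add
begin

lift_definition zero_circle :: circle is "0 :: real" .

lift_definition plus_circle :: "circle \<Rightarrow> circle \<Rightarrow> circle" is "(+) :: real \<Rightarrow> real \<Rightarrow> real"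
  by (metis Ints_add add_diff_add)

lift_definition uminus_circle :: "circle \<Rightarrow> circle" is "uminus :: real \<Rightarrow> real"
  by (metis Ints_minus minus_diff_minus)

lift_definition minus_circle :: "circle \<Rightarrow> circle \<Rightarrow> circle" is "(-) :: real \<Rightarrow> real \<Rightarrow> real"
proof -
  fix a b c d :: real
  assume "a - b \<in> \<int>" "c - d \<in> \<int>"
  from Ints_diff[OF this] show "(a - c) - (b - d) \<in> \<int>" by (simp add: algebra_simps)
qed

instance
  by standard (transfer; simp add: algebra_simps)+

end

text \<open>The quotient topology; \<open>abs_circle\<close> is the canonical projection \<open>\<real> \<rightarrow> \<real>/\<int>\<close>.\<close>

instantiation circle :: topological_space
begin

definition open_circle :: "circle set \<Rightarrow> bool" where
  "open U \<longleftrightarrow> open (abs_circle -` U)"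

instance
proof
  show "open (UNIV :: circle set)"
    by (simp add: open_circle_def)
  show "open (U \<inter> V)" if "open U" "open V" for U V :: "circle set"
    using that by (auto simp: open_circle_def)
  show "open (\<Union>K)" if "\<forall>U\<in>K. open U" for K :: "circle set set"
    using that by (auto simp: open_circle_def vimage_Union)
qed

end

definition bohr_topology :: "int topology" where
  "bohr_topology = topology_generated_by
     {\<phi> -` U | (\<phi> :: int \<Rightarrow> circle) U. Modules.additive \<phi> \<and> open U}"

definition bohr_dense :: "int set \<Rightarrow> bool" where
  "bohr_dense S \<longleftrightarrow> bohr_topology closure_of S = topspace bohr_topology"

lemma topspace_bohr_topology [simp]: "topspace bohr_topology = UNIV"
proof -
  have "Modules.additive (\<lambda>_::int. 0::circle)"
    by (simp add: Modules.additive_def)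
  then have "UNIV \<in> {\<phi> -` U | (\<phi> :: int \<Rightarrow> circle) U. Modules.additive \<phi> \<and> open U}"
    by (smt (verit) mem_Collect_eq open_UNIV vimage_UNIV)
  then show ?thesis
    unfolding bohr_topology_def topology_generated_by_topspace by blast
qed

lemma continuous_map_bohr_topology:
  fixes \<phi> :: "int \<Rightarrow> circle"
  assumes "Modules.additive \<phi>"
  shows "continuous_map bohr_topology euclidean \<phi>"
proof -
  have "openin bohr_topology (\<phi> -` U)" if "open U" for U
    unfolding bohr_topology_def using assms that
    by (intro topology_generated_by_Basis) blast
  then show ?thesis
    by (simp add: continuous_map_def vimage_def)
qed

lemma bohr_topology_weakest:
  assumes "topspace X = (UNIV :: int set)"
    and "\<And>\<phi> :: int \<Rightarrow> circle. Modules.additive \<phi> \<Longrightarrow> continuous_map X euclidean \<phi>"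
    and "openin bohr_topology W"
  shows "openin X W"
proof -
  have *: "openin X (\<phi> -` U)" if "Modules.additive \<phi>" "open U" for \<phi> :: "int \<Rightarrow> circle" and U
    using assms(2)[OF that(1)] that(2) by (simp add: continuous_map_def vimage_def assms(1))
  have "generate_topology_on {\<phi> -` U | (\<phi> :: int \<Rightarrow> circle) U. Modules.additive \<phi> \<and> open U} W"
    using assms(3) by (simp add: bohr_topology_def openin_topology_generated_by_iff)
  then show ?thesis
    by induction (auto intro: *)
qed

text \<open>Invertible means bijective on the space; measurability of the inverse is not demanded.\<close>

definition measure_preserving_system :: "'a measure \<Rightarrow> ('a \<Rightarrow> 'a) \<Rightarrow> bool" where
  "measure_preserving_system M T \<longleftrightarrow>
     prob_space M \<and> bij_betw T (space M) (space M) \<and>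
     (\<forall>D\<in>sets M. T -` D \<inter> space M \<in> sets M \<and> measure M (T -` D \<inter> space M) = measure M D)"

text \<open>\<open>int_iterate X T n\<close> is \<open>T\<^sup>n\<close> for a bijection \<open>T\<close> of \<open>X\<close>; it is meaningful on \<open>X\<close> only.\<close>

definition int_iterate :: "'a set \<Rightarrow> ('a \<Rightarrow> 'a) \<Rightarrow> int \<Rightarrow> 'a \<Rightarrow> 'a" where
  "int_iterate X T n = (if n \<ge> 0 then T ^^ nat n else inv_into X T ^^ nat (- n))"

definition recurrent_for :: "'a measure \<Rightarrow> ('a \<Rightarrow> 'a) \<Rightarrow> int set \<Rightarrow> bool" where
  "recurrent_for M T S \<longleftrightarrow>
     (\<forall>D\<in>sets M. measure M D > 0 \<longrightarrow> (\<exists>n\<in>S. D \<inter> int_iterate (space M) T n ` D \<noteq> {}))"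

text \<open>
  A definition cannot quantify over all types, so the systems below have points in the fixed type
  \<open>int \<Rightarrow> bool\<close> (with arbitrary space, sigma-algebra, measure and transformation).
  Nothing is lost: lemma \<open>measurable_recurrence_all_types\<close> shows that the condition then holds
  for systems over every type.
\<close>

definition measurable_recurrence :: "int set \<Rightarrow> bool" where
  "measurable_recurrence S \<longleftrightarrow>
     (\<forall>(M :: (int \<Rightarrow> bool) measure) T. measure_preserving_system M T \<longrightarrow> recurrent_for M T S)"

lemma int_iterate_add_1:
  assumes "bij_betw T X X" "x \<in> X"
  shows "int_iterate X T n x \<in> X \<and> int_iterate X T (n + 1) x = int_iterate X T n (T x)
    \<and> int_iterate X T (n + 1) x = T (int_iterate X T n x)"
proof -
  let ?V = "inv_into X T"
  have T: "T y \<in> X" if "y \<in> X" for y using assms(1) that by (auto simp: bij_betw_def)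
  have V: "?V y \<in> X" "T (?V y) = y" "?V (T y) = y" if "y \<in> X" for y
    using assms(1) that
    by (auto simp: bij_betw_def inv_into_into f_inv_into_f)
  have TX: "(T ^^ k) y \<in> X" if "y \<in> X" for k y using that T by (induction k) auto
  have VX: "(?V ^^ k) y \<in> X" if "y \<in> X" for k y using that V by (induction k) auto
  show ?thesis
  proof (cases "n \<ge> 0")
    case True
    then have "nat (n + 1) = Suc (nat n)" by simp
    then show ?thesis using True assms(2) TX
      unfolding int_iterate_def by (simp add: funpow_swap1)
  next
    case False
    then obtain k where k: "n = - int (Suc k)"
      by (metis int_cases2 linorder_not_le negD of_nat_0_le_iff)
    have n: "int_iterate X T n = ?V ^^ Suc k" by (simp add: int_iterate_def k nat_add_distrib)
    have n1: "int_iterate X T (n + 1) = ?V ^^ k"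
      by (cases "k = 0") (auto simp: int_iterate_def k)
    have "(?V ^^ Suc k) (T x) = (?V ^^ k) x"
      using V(3)[OF assms(2)] by (simp add: funpow_swap1)
    moreover have "T ((?V ^^ Suc k) x) = (?V ^^ k) x" using V(2) VX assms(2) by simp
    ultimately show ?thesis using n n1 VX[OF assms(2)] by metis
  qed
qed

lemma int_iterate_add:
  assumes "bij_betw T X X" "x \<in> X"
  shows "int_iterate X T (m + n) x = int_iterate X T m (int_iterate X T n x)"
proof (induction m rule: int_induct[where k = 0])
  case base
  show ?case by (simp add: int_iterate_def)
next
  case (step1 i)
  have *: "int_iterate X T n x \<in> X" using int_iterate_add_1[OF assms] by simp
  have "i + 1 + n = (i + n) + 1" by simp
  then show ?case using step1 int_iterate_add_1[OF assms] int_iterate_add_1[OF assms(1) *]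
    by metis
next
  case (step2 i)
  have *: "int_iterate X T n x \<in> X" using int_iterate_add_1[OF assms] by simp
  have "T (int_iterate X T (i - 1 + n) x) = int_iterate X T (i + n) x"
    using int_iterate_add_1[OF assms, of "i - 1 + n"] by (metis add.commute add.left_commute diff_add_cancel)
  moreover have "T (int_iterate X T (i - 1) (int_iterate X T n x)) = int_iterate X T i (int_iterate X T n x)"
    using int_iterate_add_1[OF assms(1) *, of "i - 1"] by (metis diff_add_cancel)
  moreover have "int_iterate X T (i - 1 + n) x \<in> X" "int_iterate X T (i - 1) (int_iterate X T n x) \<in> X"
    using int_iterate_add_1[OF assms] int_iterate_add_1[OF assms(1) *] by auto
  ultimately show ?case using step2 assms(1)
    by (metis bij_betw_def inj_onD)
qed

text \<open>
  Proof idea: code a point by its itinerary through \<open>D\<close>, and give the sequence space the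
  sigma-algebra generated by the nonnegative coordinates only, since the inverse of \<open>T\<close> is
  not required to be measurable.
\<close>

lemma measurable_recurrence_all_types:
  fixes M :: "'a measure"
  assumes rec: "measurable_recurrence S" and sys: "measure_preserving_system M T"
  shows "recurrent_for M T S"
  unfolding recurrent_for_def
proof (intro ballI impI, rule ccontr)
  fix D
  assume D: "D \<in> sets M" "measure M D > 0"
    and "\<not> (\<exists>n\<in>S. D \<inter> int_iterate (space M) T n ` D \<noteq> {})"
  then have disj: "D \<inter> int_iterate (space M) T n ` D = {}" if "n \<in> S" for n
    using that by blast
  interpret prob_space M using sys by (simp add: measure_preserving_system_def)
  let ?X = "space M" and ?P = "int_iterate (space M) T"
  have bij: "bij_betw T ?X ?X"
    and pres: "\<And>A. A \<in> sets M \<Longrightarrow> T -` A \<inter> ?X \<in> sets M \<and> measure M (T -` A \<inter> ?X) = measure M A"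
    using sys by (auto simp: measure_preserving_system_def)
  have T: "T x \<in> ?X" if "x \<in> ?X" for x using bij that by (auto simp: bij_betw_def)
  have DX: "D \<subseteq> ?X" using D sets.sets_into_space by blast
  have Tm: "T \<in> M \<rightarrow>\<^sub>M M" using pres T by (auto intro: measurableI)
  have P0: "?P 0 x = x" for x by (simp add: int_iterate_def)
  define \<Phi> where "\<Phi> x = (\<lambda>n. ?P n x \<in> D)" for x
  define \<sigma> where "\<sigma> \<omega> = (\<lambda>n. \<omega> (n + 1))" for \<omega> :: "int \<Rightarrow> bool"
  define B where "B = {{\<omega> :: int \<Rightarrow> bool. \<omega> k} | k. k \<ge> 0}"
  define N where "N = distr M (sigma UNIV B) \<Phi>"
  have spN: "space N = UNIV" and seN: "sets N = sigma_sets UNIV B"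
    by (simp_all add: N_def)
  have \<Phi>m: "\<Phi> \<in> M \<rightarrow>\<^sub>M sigma UNIV B"
  proof (rule measurable_measure_of)
    fix A assume "A \<in> B"
    then obtain k where k: "k \<ge> 0" "A = {\<omega>. \<omega> k}" by (auto simp: B_def)
    have "\<Phi> -` A \<inter> ?X = (T ^^ nat k) -` D \<inter> ?X"
      using k by (auto simp: \<Phi>_def int_iterate_def)
    moreover have "(T ^^ nat k) \<in> M \<rightarrow>\<^sub>M M"
      using Tm by (induction "nat k" arbitrary: k) (auto intro: measurable_compose_countable simp: measurable_ident id_def[symmetric])
    ultimately show "\<Phi> -` A \<inter> ?X \<in> sets M" using D(1) measurable_sets by metis
  qed auto
  have \<sigma>inv: "\<sigma> (\<lambda>n. \<omega> (n - 1)) = \<omega>" "(\<lambda>n. \<sigma> \<omega> (n - 1)) = \<omega>" for \<omega>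
    by (auto simp: \<sigma>_def)
  have bij\<sigma>: "bij \<sigma>"
    by (rule o_bij[where g = "\<lambda>\<omega> n. \<omega> (n - 1)"]) (auto simp: \<sigma>_def fun_eq_iff)
  have \<sigma>m: "\<sigma> \<in> N \<rightarrow>\<^sub>M N"
  proof (rule measurable_sigma_sets[OF seN])
    fix A assume "A \<in> B"
    then obtain k where "k \<ge> 0" "A = {\<omega>. \<omega> k}" by (auto simp: B_def)
    then have "\<sigma> -` A \<inter> space N = {\<omega>. \<omega> (k + 1)}" "k + 1 \<ge> 0" by (auto simp: \<sigma>_def spN)
    then have "\<sigma> -` A \<inter> space N \<in> B" unfolding B_def by blast
    then show "\<sigma> -` A \<inter> space N \<in> sets N" by (simp add: seN)
  qed (auto simp: spN)
  have equiv: "\<Phi> (T x) = \<sigma> (\<Phi> x)" if "x \<in> ?X" for x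
    using int_iterate_add_1[OF bij that] by (auto simp: \<Phi>_def \<sigma>_def)
  have mN: "measure N A = measure M (\<Phi> -` A \<inter> ?X)" if "A \<in> sets N" for A
    using that \<Phi>m by (simp add: N_def measure_distr)
  have \<Phi>s: "\<Phi> -` A \<inter> ?X \<in> sets M" if "A \<in> sets N" for A
    using that \<Phi>m by (auto simp: N_def measurable_sets)
  have sysN: "measure_preserving_system N \<sigma>"
    unfolding measure_preserving_system_def
  proof (intro conjI ballI)
    show "prob_space N" unfolding N_def by (rule prob_space_distr[OF \<Phi>m])
    show "bij_betw \<sigma> (space N) (space N)" using bij\<sigma> by (simp add: spN)
    fix A assume A: "A \<in> sets N"
    show sA: "\<sigma> -` A \<inter> space N \<in> sets N" using \<sigma>m A measurable_sets by blast
    have "\<Phi> -` (\<sigma> -` A \<inter> space N) \<inter> ?X = T -` (\<Phi> -` A \<inter> ?X) \<inter> ?X"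
      using equiv T by (auto simp: spN)
    then show "measure N (\<sigma> -` A \<inter> space N) = measure N A"
      using mN[OF A] mN[OF sA] pres[OF \<Phi>s[OF A]] by simp
  qed
  define E where "E = {\<omega> :: int \<Rightarrow> bool. \<omega> 0} \<inter> (\<Inter>k\<in>{k. k \<ge> 0 \<and> (k \<in> S \<or> - k \<in> S)}. - {\<omega>. \<omega> k})"
  have "{\<omega> :: int \<Rightarrow> bool. \<omega> k} \<in> sets N" if "k \<ge> 0" for k
    unfolding seN using that by (auto simp: B_def)
  then have EN: "E \<in> sets N"
    unfolding E_def using sets.compl_sets[of _ N] sets.top[of N]
    by (intro sets.Int sets.countable_INT'') (auto simp: spN Compl_eq_Diff_UNIV)
  have iterinv: "?P (- k) (?P k x) = x" if "x \<in> ?X" for k x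
    using int_iterate_add[OF bij that, of "- k" k] P0 by simp
  have "?P k x \<notin> D" if "x \<in> D" "k \<in> S \<or> - k \<in> S" for k x
    using disj[of k] disj[of "- k"] iterinv[of x k] that DX by (metis IntI emptyE image_eqI subsetD)
  then have "\<Phi> -` E \<inter> ?X = D"
    using DX by (auto simp: E_def \<Phi>_def P0)
  then have "measure N E > 0" using mN[OF EN] D by simp
  moreover have "\<exists>n\<in>S. E \<inter> int_iterate UNIV \<sigma> n ` E \<noteq> {}" if "measure N E > 0"
  proof -
    have "recurrent_for N \<sigma> S" using rec sysN by (auto simp: measurable_recurrence_def)
    then show ?thesis using that EN spN by (auto simp: recurrent_for_def)
  qed
  ultimately obtain n \<omega> where n: "n \<in> S" and \<omega>: "\<omega> \<in> E" and \<omega>': "int_iterate UNIV \<sigma> n \<omega> \<in> E"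
    by blast
  have iter\<sigma>: "int_iterate UNIV \<sigma> j \<omega> i = \<omega> (i + j)" for j i
  proof -
    have a: "(\<sigma> ^^ l) \<omega> i = \<omega> (i + int l)" for l i
      by (induction l arbitrary: i) (auto simp: \<sigma>_def algebra_simps)
    have "inv \<sigma> = (\<lambda>\<omega> n. \<omega> (n - 1))"
      by (rule inv_equality) (auto simp: \<sigma>_def)
    then have b: "(inv \<sigma> ^^ l) \<omega> i = \<omega> (i - int l)" for l i
      by (induction l arbitrary: i) (auto simp: algebra_simps)
    show ?thesis by (simp add: int_iterate_def a b)
  qed
  show False
  proof (cases "n \<ge> 0")
    case True
    then show ?thesis using \<omega> \<omega>' n iter\<sigma>[of n 0] by (auto simp: E_def)
  next
    case False
    then show ?thesis using \<omega> \<omega>' n iter\<sigma>[of n "- n"] by (auto simp: E_def)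
  qed
qed

end

theory Submission
  imports Defs
begin

text \<open>
  Nonrecurrence is witnessed by periodic functions \<open>h\<close> with values in \<open>{-1, 0, 1}\<close> such that
  \<open>h n * h (n + e) \<noteq> 1\<close> for every \<open>e\<close> to be excluded: a level set \<open>h = \<plusminus>1\<close> of positive density has no
  two points at distance \<open>e\<close>, and a limit of such sets is a measure preserving system.

  Witnesses survive the addition of suitable finite sets \<open>F\<close>, at an arbitrarily small relative loss
  of density. Take many tiny, rationally independent \<open>\<beta>\<^sub>i\<close> and let \<open>F\<close> consist of \<open>f \<in> S\<close> near \<open>m\<close> (modulo the
  period of \<open>h\<close>) such that \<open>f \<beta>\<^sub>i\<close> is close to \<open>1 / N\<close> for all but \<open>k\<close> of the \<open>i\<close>. Such a Hamming-type
  condition is invisible to \<open>k\<close> characters (Kronecker), so that \<open>F\<close> can still meet every Bohr neighbourhood of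
  \<open>m\<close> defined by \<open>k\<close> characters. On the other hand, majority votes among the coordinates of
  \<open>Y + n \<beta>\<close>, which for most \<open>Y\<close> no \<open>k\<close> coordinates can overturn, define a counter \<open>y(n) \<in> \<int>/N\<close> that almost always
  advances by one when \<open>n\<close> is shifted by an element of \<open>F\<close> and is unaffected by small shifts. Then
  \<open>(-1)\<^bsup>y(n)\<^esup> h (n - y(n) m)\<close> is the new witness: a shift by \<open>f \<in> F\<close> changes the sign through the
  parity of the counter, while the translation by multiples of \<open>m\<close> cancels the action of \<open>f\<close> on \<open>h\<close>. Since the
  \<open>\<beta>\<^sub>i\<close> are tiny, the same works for all \<open>f - c\<close> with \<open>c\<close> bounded, which handles the translates of \<open>S'\<close>.
\<close>

section \<open>Bohr neighbourhoods\<close>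

definition near_int :: "real \<Rightarrow> real \<Rightarrow> bool" where
  "near_int d x \<longleftrightarrow> (\<exists>z::int. \<bar>x - of_int z\<bar> < d)"

lemma near_int_mono: "near_int d x \<Longrightarrow> d \<le> e \<Longrightarrow> near_int e x"
  unfolding near_int_def by (meson order_less_le_trans)

lemma near_int_0: "d > 0 \<Longrightarrow> near_int d 0"
  unfolding near_int_def by (auto intro: exI[of _ 0])

lemma near_int_add:
  assumes "near_int d x" "near_int e y"
  shows "near_int (d + e) (x + y)"
proof -
  obtain z w :: int where "\<bar>x - of_int z\<bar> < d" "\<bar>y - of_int w\<bar> < e"
    using assms unfolding near_int_def by blast
  then have "\<bar>x + y - of_int (z + w)\<bar> < d + e" by simp
  then show ?thesis unfolding near_int_def by blast
qed

lemma near_int_add_Ints: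
  assumes "y \<in> \<int>"
  shows "near_int d (x + y) \<longleftrightarrow> near_int d x"
proof -
  obtain w :: int where w: "y = of_int w" using assms by (auto elim: Ints_cases)
  have "\<bar>x + y - of_int (z + w)\<bar> = \<bar>x - of_int z\<bar>" "\<bar>x - of_int (z - w)\<bar> = \<bar>x + y - of_int z\<bar>" for z
    by (simp_all add: w)
  then show ?thesis unfolding near_int_def by metis
qed

text \<open>Only the class of \<open>a\<close> modulo one matters, so the coefficients of a Bohr
  neighbourhood may be taken from a compact cube.\<close>

lemma near_int_frac: "near_int d (of_int s * frac a) \<longleftrightarrow> near_int d (of_int s * a)"
proof -
  have "of_int s * a = of_int s * frac a + of_int (s * \<lfloor>a\<rfloor>)" by (simp add: frac_def algebra_simps)
  then show ?thesis by (metis Ints_of_int near_int_add_Ints)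
qed

lemma near_int_mult:
  assumes "near_int d x" "c \<noteq> 0"
  shows "near_int (\<bar>of_int c\<bar> * d) (of_int c * x)"
proof -
  obtain z where "\<bar>x - of_int z\<bar> < d" using assms unfolding near_int_def by blast
  then have "\<bar>of_int c\<bar> * \<bar>x - of_int z\<bar> < \<bar>of_int c\<bar> * d"
    using assms(2) by (intro mult_strict_left_mono) auto
  then have "\<bar>of_int c * x - of_int (c * z)\<bar> < \<bar>of_int c\<bar> * d"
    by (simp add: abs_mult[symmetric] right_diff_distrib)
  then show ?thesis unfolding near_int_def by blast
qed

text \<open>Congruences are Bohr conditions: closeness to an integer for the single character
  \<open>1 / Q\<close> already forces divisibility.\<close>

lemma near_int_dvd:
  assumes "near_int (1 / of_int Q) (of_int n / of_int Q)" "Q > 0"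
  shows "Q dvd n"
proof -
  obtain z where "\<bar>of_int n / of_int Q - of_int z\<bar> < 1 / (of_int Q :: real)"
    using assms unfolding near_int_def by blast
  then have "\<bar>of_int n / of_int Q - of_int z\<bar> * of_int Q < (1 :: real)"
    using assms(2) by (simp add: field_simps)
  moreover have "\<bar>of_int n / of_int Q - of_int z\<bar> * of_int Q = \<bar>of_int (n - z * Q) :: real\<bar>"
    using assms(2) by (simp add: abs_mult_pos field_simps)
  ultimately have "n - z * Q = 0" by linarith
  then show ?thesis by simp
qed

lemma abs_circle_eq_iff: "abs_circle x = abs_circle y \<longleftrightarrow> x - y \<in> \<int>"
  using circle.abs_eq_iff by blast

lemma abs_circle_add: "abs_circle (x + y) = abs_circle x + abs_circle y"
  by (simp add: plus_circle.abs_eq)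

lemma additive_abs_circle: "Modules.additive (\<lambda>n::int. abs_circle (of_int n * a))"
  by (simp add: Modules.additive_def distrib_right plus_circle.abs_eq)

text \<open>A homomorphism on the integers is determined by its value at one; \<open>a\<close> is a
  real lift of that value.\<close>

lemma additive_int_circle:
  fixes \<phi> :: "int \<Rightarrow> circle"
  assumes "Modules.additive \<phi>"
  obtains a where "\<And>n. \<phi> n = abs_circle (of_int n * a)"
proof -
  interpret Modules.additive \<phi> by fact
  obtain a where a: "\<phi> 1 = abs_circle a" by (metis Quotient_abs_rep Quotient_circle)
  have "\<phi> n = abs_circle (of_int n * a)" for n
  proof (induction n rule: int_induct[where k = 0])
    case base
    show ?case by (simp add: zero zero_circle_def)
  next
    case (step1 i)
    then show ?case by (simp add: add a distrib_right abs_circle_add)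
  next
    case (step2 i)
    have "\<phi> i = \<phi> (i - 1) + \<phi> 1" using add[of "i - 1" 1] by simp
    moreover have "abs_circle (of_int i * a) = abs_circle (of_int (i - 1) * a) + abs_circle a"
      by (simp flip: abs_circle_add add: algebra_simps)
    ultimately show ?case using step2 a by simp
  qed
  then show ?thesis using that by blast
qed

text \<open>The number \<open>k\<close> of characters is kept explicit because the Hamming
  conditions used later are compatible only with a bounded number of prescribed characters.\<close>

definition bohr_nbhd :: "nat \<Rightarrow> (nat \<Rightarrow> real) \<Rightarrow> real \<Rightarrow> int \<Rightarrow> int set" where
  "bohr_nbhd k a d m = {n. \<forall>i<k. near_int d (of_int (n - m) * a i)}"

lemma self_in_bohr_nbhd: "d > 0 \<Longrightarrow> m \<in> bohr_nbhd k a d m"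
  by (simp add: bohr_nbhd_def near_int_0)

lemma openin_bohr_nbhd: "openin bohr_topology (bohr_nbhd k a d m)"
proof -
  have "openin bohr_topology {n. near_int d (of_int (n - m) * a i)}" for i
  proof -
    define U where "U = abs_circle ` {x. \<bar>x - of_int m * a i\<bar> < d}"
    \<comment> \<open>Openness in the quotient is tested on the preimage, here a union of integer
      translates of an open interval.\<close>
    have vim: "abs_circle -` U = (\<Union>z::int. {x. \<bar>x - of_int z - of_int m * a i\<bar> < d})"
    proof (intro equalityI subsetI)
      fix x assume "x \<in> abs_circle -` U"
      then obtain y where y: "\<bar>y - of_int m * a i\<bar> < d" "x - y \<in> \<int>"
        by (auto simp: U_def abs_circle_eq_iff)
      then obtain z where "x - y = of_int z" by (auto elim: Ints_cases)
      then have "y = x - of_int z" by simp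
      then show "x \<in> (\<Union>z::int. {x. \<bar>x - of_int z - of_int m * a i\<bar> < d})" using y by auto
    next
      fix x assume "x \<in> (\<Union>z::int. {x. \<bar>x - of_int z - of_int m * a i\<bar> < d})"
      then obtain z :: int where z: "\<bar>x - of_int z - of_int m * a i\<bar> < d" by auto
      have "abs_circle x = abs_circle (x - of_int z)" by (simp add: abs_circle_eq_iff)
      then show "x \<in> abs_circle -` U" using z by (auto simp: U_def)
    qed
    have "open {x. \<bar>x - of_int z - of_int m * a i\<bar> < d}" for z :: int
      by (intro open_Collect_less continuous_intros)
    then have "open U" unfolding open_circle_def vim by blast
    then have "openin bohr_topology ((\<lambda>n. abs_circle (of_int n * a i)) -` U)"
      unfolding bohr_topology_def
      by (intro topology_generated_by_Basis) (use additive_abs_circle in blast)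
    moreover have "(\<lambda>n. abs_circle (of_int n * a i)) -` U = {n. near_int d (of_int (n - m) * a i)}"
    proof -
      have "(\<lambda>n. abs_circle (of_int n * a i)) -` U = (\<lambda>n. of_int n * a i) -` (abs_circle -` U)"
        by auto
      then show ?thesis unfolding vim near_int_def by (auto simp: algebra_simps)
    qed
    ultimately show ?thesis by simp
  qed
  then have "openin bohr_topology ((\<Inter>i\<in>{..<k}. {n. near_int d (of_int (n - m) * a i)}) \<inter> topspace bohr_topology)"
    by (intro openin_INT) auto
  moreover have "(\<Inter>i\<in>{..<k}. {n. near_int d (of_int (n - m) * a i)}) \<inter> topspace bohr_topology = bohr_nbhd k a d m"
    by (auto simp: bohr_nbhd_def)
  ultimately show ?thesis by simp
qed

text \<open>Induction over the generation of the topology. A subbasic set needs one character; for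
  an intersection the two lists of characters are concatenated and the smaller radius is
  taken.\<close>

lemma bohr_nbhd_basis:
  assumes "openin bohr_topology W" "m \<in> W"
  shows "\<exists>k a d. d > 0 \<and> bohr_nbhd k a d m \<subseteq> W"
proof -
  have "generate_topology_on {\<phi> -` U | (\<phi> :: int \<Rightarrow> circle) U. Modules.additive \<phi> \<and> open U} W"
    using assms(1) by (simp add: bohr_topology_def openin_topology_generated_by_iff)
  then show ?thesis using assms(2)
  proof induction
    case Empty
    then show ?case by simp
  next
    case (Int V W)
    then obtain k a d l b e where V: "d > 0" "bohr_nbhd k a d m \<subseteq> V"
      and W: "e > 0" "bohr_nbhd l b e m \<subseteq> W" by auto
    define c where "c i = (if i < k then a i else b (i - k))" for i :: nat
    have "bohr_nbhd (k + l) c (min d e) m \<subseteq> bohr_nbhd k a d m"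
    proof
      fix n assume n: "n \<in> bohr_nbhd (k + l) c (min d e) m"
      have "near_int (min d e) (of_int (n - m) * a i)" if "i < k" for i
        using n that unfolding bohr_nbhd_def c_def by (auto dest!: spec[of _ i])
      then show "n \<in> bohr_nbhd k a d m"
        by (auto simp: bohr_nbhd_def intro: near_int_mono[of "min d e"])
    qed
    moreover have "bohr_nbhd (k + l) c (min d e) m \<subseteq> bohr_nbhd l b e m"
    proof
      fix n assume n: "n \<in> bohr_nbhd (k + l) c (min d e) m"
      have "near_int (min d e) (of_int (n - m) * b i)" if "i < l" for i
        using n that unfolding bohr_nbhd_def c_def by (auto dest!: spec[of _ "k + i"])
      then show "n \<in> bohr_nbhd l b e m"
        by (auto simp: bohr_nbhd_def intro: near_int_mono[of "min d e"])
    qed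
    ultimately have "bohr_nbhd (k + l) c (min d e) m \<subseteq> V \<inter> W" using V W by blast
    moreover have "min d e > 0" using V W by simp
    ultimately show ?case by blast
  next
    case (UN K)
    then show ?case by (meson Union_iff Union_upper order_trans)
  next
    case (Basis W)
    then obtain \<phi> :: "int \<Rightarrow> circle" and U where W: "W = \<phi> -` U" and add: "Modules.additive \<phi>" and U: "open U" by blast
    obtain a where a: "\<And>n. \<phi> n = abs_circle (of_int n * a)" using additive_int_circle[OF add] by blast
    have "open (abs_circle -` U)" using U by (simp add: open_circle_def)
    moreover have "of_int m * a \<in> abs_circle -` U" using Basis W a by simp
    ultimately obtain d where d: "d > 0" "\<And>y. \<bar>y - of_int m * a\<bar> < d \<Longrightarrow> y \<in> abs_circle -` U"
      unfolding open_dist dist_real_def by blast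
    have "n \<in> W" if "n \<in> bohr_nbhd 1 (\<lambda>_. a) d m" for n
    proof -
      have "near_int d (of_int (n - m) * a)" using that by (simp add: bohr_nbhd_def)
      then obtain z :: int where "\<bar>of_int (n - m) * a - of_int z\<bar> < d"
        unfolding near_int_def by blast
      then have "of_int n * a - of_int z \<in> abs_circle -` U"
        by (intro d(2)) (simp add: algebra_simps)
      moreover have "abs_circle (of_int n * a - of_int z) = \<phi> n"
        by (simp add: a abs_circle_eq_iff)
      ultimately show ?thesis by (simp add: W)
    qed
    then show ?case using d(1) by blast
  qed
qed

lemma bohr_dense_iff: "bohr_dense S \<longleftrightarrow> (\<forall>k a d m. d > 0 \<longrightarrow> S \<inter> bohr_nbhd k a d m \<noteq> {})"
  unfolding bohr_dense_def dense_intersects_open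
proof safe
  fix k a and d :: real and m
  assume S: "\<forall>T. openin bohr_topology T \<and> T \<noteq> {} \<longrightarrow> S \<inter> T \<noteq> {}"
    and d: "0 < d" and "S \<inter> bohr_nbhd k a d m = {}"
  then have "bohr_nbhd k a d m = {}" using S[rule_format, of "bohr_nbhd k a d m"] openin_bohr_nbhd by metis
  then show False using self_in_bohr_nbhd[OF d, of m k a] by simp
next
  fix W m assume *: "\<forall>k a d m. d > 0 \<longrightarrow> S \<inter> bohr_nbhd k a d m \<noteq> {}"
    and W: "openin bohr_topology W" "m \<in> W" "S \<inter> W = {}"
  obtain k a d where "d > 0" "bohr_nbhd k a d m \<subseteq> W" using bohr_nbhd_basis[OF W(1,2)] by auto
  then show "m \<in> {}" using *[rule_format, of d k a m] W(3) by auto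
qed

section \<open>Kronecker approximation avoiding few characters\<close>

text \<open>Kronecker's theorem requires rational independence of the frequencies together with
  one.\<close>

interpretation rat_real: vector_space "\<lambda>(r::rat) (x::real). of_rat r * x"
  by unfold_locales (simp_all add: algebra_simps of_rat_add of_rat_mult)

text \<open>Kronecker's theorem in set form. The element one comes last in the enumeration \<theta>,
  and only the other coordinates are steered. Rational independence gives the integral one.\<close>

lemma Kronecker_set:
  fixes D :: "real set" and t :: "real \<Rightarrow> real"
  assumes "finite D" and ind: "rat_real.independent D" and "1 \<in> D" and "\<epsilon> > 0"
  obtains n :: int where "\<And>v. v \<in> D - {1} \<Longrightarrow> near_int \<epsilon> (of_int n * v - t v)"
proof -
  define l where "l = card (D - {1})"
  obtain g where g: "bij_betw g {..<l} (D - {1})"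
    using ex_bij_betw_nat_finite[of "D - {1}"] assms(1) by (auto simp: l_def atLeast0LessThan)
  define \<theta> where "\<theta> i = (if i < l then g i else 1)" for i
  have img: "\<theta> ` {..l} = D"
  proof -
    have "\<theta> ` {..l} = insert 1 (g ` {..<l})"
      by (auto simp: \<theta>_def image_iff le_less)
    then show ?thesis using g \<open>1 \<in> D\<close> by (auto simp: bij_betw_def)
  qed
  have inj: "inj_on \<theta> {..l}"
  proof -
    have "g i \<noteq> 1" if "i < l" for i using g that by (auto simp: bij_betw_def)
    moreover have "inj_on g {..<l}" using g by (simp add: bij_betw_def)
    ultimately show ?thesis by (auto simp: inj_on_def \<theta>_def dest: sym)
  qed
  have "module.independent (\<lambda>r x. of_int r * x) (\<theta> ` {..l})"
  proof -
    interpret int: Modules.module "\<lambda>(r::int) (x::real). of_int r * x"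
      by unfold_locales (simp_all add: algebra_simps)
    have "u v = 0" if "finite T" "T \<subseteq> D" "(\<Sum>v\<in>T. of_int (u v) * v) = 0" "v \<in> T" for T u v
      using rat_real.independentD[OF ind that(1,2), of "\<lambda>v. of_int (u v)"] that(3,4) by simp
    then show ?thesis unfolding int.independent_explicit_module img by blast
  qed
  then obtain n h where n: "\<And>i. i < l \<Longrightarrow> \<bar>of_int n * \<theta> i - of_int (h i) - t (\<theta> i)\<bar> < \<epsilon>"
    using Kronecker_thm_2[of \<theta> l \<epsilon> "\<lambda>i. t (\<theta> i)"] inj \<open>\<epsilon> > 0\<close> by (auto simp: \<theta>_def)
  have "near_int \<epsilon> (of_int n * v - t v)" if "v \<in> D - {1}" for v
  proof -
    have "v \<in> g ` {..<l}" using that bij_betw_imp_surj_on[OF g] by simp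
    then obtain i where "i < l" "v = g i" by auto
    then have i: "i < l" "v = \<theta> i" by (simp_all add: \<theta>_def)
    show ?thesis unfolding near_int_def
      by (rule exI[of _ "h i"]) (use n[OF i(1)] i(2) in \<open>simp add: algebra_simps\<close>)
  qed
  then show ?thesis using that by blast
qed

lemma rat_common_denominator:
  assumes "finite R"
  obtains N :: int where "N > 0" "\<And>r. r \<in> R \<Longrightarrow> (of_int N * r :: rat) \<in> \<int>"
proof -
  have "\<exists>N::int. N > 0 \<and> (\<forall>r\<in>R. (of_int N * r :: rat) \<in> \<int>)"
    using assms
  proof (induction R)
    case empty
    show ?case by (auto intro: exI[of _ 1])
  next
    case (insert r R)
    then obtain N where N: "N > 0" "\<And>r. r \<in> R \<Longrightarrow> (of_int N * r :: rat) \<in> \<int>" by blast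
    obtain a b where ab: "r = of_int a / of_int b" "b > 0"
      by (metis Fract_of_int_quotient Rat_cases)
    have "(of_int (N * b) * r :: rat) = of_int (N * a)" using ab by simp
    moreover have "(of_int (N * b) * x :: rat) = of_int b * (of_int N * x)" for x by simp
    ultimately have "\<forall>x\<in>insert r R. (of_int (N * b) * x :: rat) \<in> \<int>"
      using N(2) by (metis Ints_mult Ints_of_int insert_iff)
    then show ?case using N(1) ab(2) by (intro exI[of _ "N * b"]) auto
  qed
  then show ?thesis using that by blast
qed

text \<open>The rational span of \<open>1\<close> and the \<open>a i\<close> has dimension at most \<open>k + 1\<close>, so all but \<open>k\<close> of the \<open>b \<in> B\<close>
  can be chosen independent modulo it; these can be steered freely.\<close>

lemma Kronecker_all_but_k:
  fixes B :: "real set" and a :: "nat \<Rightarrow> real" and t :: "real \<Rightarrow> real" and Q :: int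
  assumes "finite B" and ind: "rat_real.independent (insert 1 B)" and "1 \<notin> B" "Q > 0" "\<epsilon> > 0"
  obtains x :: int where "Q dvd x" "\<And>i. i < k \<Longrightarrow> near_int \<epsilon> (of_int x * a i)"
    "card {b\<in>B. \<not> near_int \<epsilon> (of_int x * b - t b)} \<le> k"
proof -
  define A where "A = insert 1 (a ` {..<k})"
  have "rat_real.independent {1}" by (rule rat_real.independent_mono[OF ind]) simp
  then obtain C where C: "{1} \<subseteq> C" "C \<subseteq> A" "rat_real.independent C" "A \<subseteq> rat_real.span C"
    using rat_real.maximal_independent_subset_extend[of "{1}" A] by (auto simp: A_def)
  have finC: "finite C" using C(2) finite_subset by (auto simp: A_def)
  have "card A \<le> Suc k"
    unfolding A_def using card_image_le[of "{..<k}" a]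
    by (intro order_trans[OF card_insert_le_m1[where n = "Suc k"]]) auto
  then have cardC: "card C \<le> Suc k"
    using card_mono[OF _ C(2)] by (simp add: A_def)
  obtain D where D: "C \<subseteq> D" "D \<subseteq> C \<union> B" "rat_real.independent D" "C \<union> B \<subseteq> rat_real.span D"
    using rat_real.maximal_independent_subset_extend[of C "C \<union> B"] C(3) by auto
  have finD: "finite D" using D(2) finC assms(1) finite_subset by blast
  have "insert 1 B \<subseteq> rat_real.span D" using D(4) C(1) by auto
  \<comment> \<open>Dimension count: the independent set \<open>insert 1 B\<close> lies in the span
    of \<open>D\<close>, while \<open>C\<close> has at most \<open>k + 1\<close> elements. So
    \<open>D - C\<close>, which is part of \<open>B\<close>, omits at most \<open>k\<close> elements
    of \<open>B\<close>.\<close>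
  then have "Suc (card B) \<le> card D"
    using rat_real.independent_span_bound[OF finD ind] assms(1,3) by simp
  moreover have "card D = card C + card (D - C)"
    using D(1) finD by (metis card_Diff_subset card_mono finC le_add_diff_inverse)
  ultimately have big: "card B \<le> k + card (D - C)" using cardC by linarith
  have "\<forall>i<k. \<exists>u. a i = (\<Sum>v\<in>C. of_rat (u v) * v)"
    using C(4) rat_real.span_finite[OF finC] by (fastforce simp: A_def)
  then obtain u where u: "\<And>i. i < k \<Longrightarrow> a i = (\<Sum>v\<in>C. of_rat (u i v) * v)" by metis
  have "finite ((\<lambda>(i,v). u i v) ` ({..<k} \<times> C))" using finC by simp
  then obtain N where "N > 0" and N': "\<And>r. r \<in> (\<lambda>(i,v). u i v) ` ({..<k} \<times> C) \<Longrightarrow> of_int N * r \<in> \<int>"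
    using rat_common_denominator by blast
  have N: "N > 0" "\<And>i v. i < k \<Longrightarrow> v \<in> C \<Longrightarrow> of_int N * u i v \<in> \<int>"
    using \<open>N > 0\<close> by (auto intro!: N')
  have "\<forall>i v. \<exists>w::int. i < k \<longrightarrow> v \<in> C \<longrightarrow> of_int N * u i v = of_int w"
    using N(2) by (meson Ints_cases)
  then obtain w where w: "\<And>i v. i < k \<Longrightarrow> v \<in> C \<Longrightarrow> of_int N * u i v = of_int (w i v)" by metis
  have w': "of_int N * of_rat (u i v) = (of_int (w i v) :: real)" if "i < k" "v \<in> C" for i v
    using w[OF that] by (metis of_rat_mult of_rat_of_int_eq)
  define G where "G = (\<Sum>i<k. \<Sum>v\<in>C. \<bar>of_int (w i v) :: real\<bar>)"
  have G0: "G \<ge> 0" unfolding G_def by (intro sum_nonneg) auto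
  \<comment> \<open>\<open>N\<close> clears the denominators of the coefficients \<open>u\<close>,
    and \<open>G\<close> bounds the resulting integers \<open>w\<close>. So \<epsilon>' is small
    enough to survive multiplication by \<open>Q * N\<close> as well as the combination with
    coefficients \<open>w\<close> followed by multiplication by \<open>Q\<close>.\<close>
  define \<epsilon>' where "\<epsilon>' = \<epsilon> / (of_int Q * (of_int N + G))"
  have pos: "0 < of_int Q * (of_int N + G)" using N(1) G0 assms(4) by (intro mult_pos_pos) auto
  then have \<epsilon>': "\<epsilon>' > 0" using assms(5) by (simp add: \<epsilon>'_def)
  have \<epsilon>'_eq: "of_int Q * ((of_int N + G) * \<epsilon>') = \<epsilon>"
    unfolding \<epsilon>'_def by (metis less_irrefl mult.assoc nonzero_mult_div_cancel_left times_divide_eq_right pos)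
  have "1 \<in> D" using C(1) D(1) by auto
  \<comment> \<open>On \<open>C\<close> the target is zero, which will make all \<open>a i\<close>
    nearly integral. On the free elements the target is divided by \<open>Q * N\<close> in advance,
    because \<open>x\<close> will be the multiple \<open>Q * N * n\<close>.\<close>
  from Kronecker_set[OF finD D(3) this \<epsilon>', of "\<lambda>v. if v \<in> C then 0 else t v / of_int (Q * N)"]
  obtain n where n: "\<And>v. v \<in> D - {1} \<Longrightarrow> near_int \<epsilon>' (of_int n * v - (if v \<in> C then 0 else t v / of_int (Q * N)))"
    by blast
  define x where "x = Q * N * n"
  show ?thesis
  proof
    show "Q dvd x" by (simp add: x_def)
    show "near_int \<epsilon> (of_int x * a i)" if i: "i < k" for i
    proof -
      have "\<exists>z::int. v \<in> C \<longrightarrow> \<bar>of_int n * v - of_int z\<bar> < \<epsilon>'" for v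
      proof (cases "v = 1")
        case True
        then show ?thesis using \<epsilon>' by (auto intro: exI[of _ n])
      next
        case False
        then show ?thesis using n[of v] D(1) unfolding near_int_def by force
      qed
      then obtain z where z: "\<And>v. v \<in> C \<Longrightarrow> \<bar>of_int n * v - of_int (z v)\<bar> < \<epsilon>'" by metis
      have "of_int x * a i = of_int Q * (\<Sum>v\<in>C. (of_int N * of_rat (u i v)) * (of_int n * v))"
        by (simp add: x_def u[OF i] sum_distrib_left mult_ac)
      also have "\<dots> = of_int Q * (\<Sum>v\<in>C. of_int (w i v) * (of_int n * v))"
        by (simp add: w'[OF i])
      finally have "of_int x * a i - of_int (Q * (\<Sum>v\<in>C. w i v * z v))
          = of_int Q * (\<Sum>v\<in>C. of_int (w i v) * (of_int n * v - of_int (z v)))"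
        by (simp add: right_diff_distrib sum_subtractf)
      moreover have "\<bar>\<Sum>v\<in>C. of_int (w i v) * (of_int n * v - of_int (z v))\<bar> \<le> (\<Sum>v\<in>C. \<bar>of_int (w i v)\<bar> * \<epsilon>')"
        by (intro order_trans[OF sum_abs] sum_mono) (use z in \<open>fastforce simp: abs_mult intro: mult_left_mono less_imp_le\<close>)
      moreover have "(\<Sum>v\<in>C. \<bar>of_int (w i v)\<bar> * \<epsilon>') \<le> G * \<epsilon>'"
        unfolding sum_distrib_right[symmetric] G_def using i \<epsilon>'
        by (intro mult_right_mono member_le_sum[of i "{..<k}" "\<lambda>i. \<Sum>v\<in>C. \<bar>of_int (w i v) :: real\<bar>"]) (auto intro: sum_nonneg)
      ultimately have "\<bar>of_int x * a i - of_int (Q * (\<Sum>v\<in>C. w i v * z v))\<bar> \<le> \<bar>of_int Q\<bar> * (G * \<epsilon>')"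
        by (simp only: abs_mult) (intro mult_left_mono, linarith+)
      also have "\<bar>of_int Q\<bar> * (G * \<epsilon>') < of_int Q * ((of_int N + G) * \<epsilon>')"
        using assms(4) N(1) \<epsilon>' by (simp add: mult_strict_right_mono)
      also have "\<dots> = \<epsilon>" by (rule \<epsilon>'_eq)
      finally show ?thesis unfolding near_int_def by blast
    qed
    have "near_int \<epsilon> (of_int x * b - t b)" if b: "b \<in> D - C" for b
    proof -
      have "near_int \<epsilon>' (of_int n * b - t b / of_int (Q * N))"
        using n[of b] b C(1) by auto
      moreover have QN: "Q * N \<noteq> 0" using assms(4) N(1) by simp
      ultimately have "near_int (\<bar>of_int (Q * N)\<bar> * \<epsilon>') (of_int (Q * N) * (of_int n * b - t b / of_int (Q * N)))"
        by (rule near_int_mult)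
      moreover have "of_int (Q * N) * (of_int n * b - t b / of_int (Q * N)) = of_int x * b - t b"
        using QN by (simp add: x_def right_diff_distrib)
      moreover have "\<bar>of_int (Q * N)\<bar> * \<epsilon>' \<le> \<epsilon>"
      proof -
        have "\<bar>of_int (Q * N)\<bar> * \<epsilon>' = of_int Q * (of_int N * \<epsilon>')"
          using assms(4) N(1) by (simp add: abs_mult)
        also have "\<dots> \<le> of_int Q * ((of_int N + G) * \<epsilon>')"
          using assms(4) G0 \<epsilon>' by (intro mult_left_mono mult_right_mono) auto
        also have "\<dots> = \<epsilon>" by (rule \<epsilon>'_eq)
        finally show ?thesis .
      qed
      ultimately show ?thesis using near_int_mono by metis
    qed
    then have "{b\<in>B. \<not> near_int \<epsilon> (of_int x * b - t b)} \<subseteq> B - (D - C)" by auto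
    then have "card {b\<in>B. \<not> near_int \<epsilon> (of_int x * b - t b)} \<le> card (B - (D - C))"
      using assms(1) by (intro card_mono) auto
    also have "\<dots> = card B - card (D - C)"
      using D(2) assms(1) finD by (intro card_Diff_subset) auto
    also have "\<dots> \<le> k" using big by simp
    finally show "card {b\<in>B. \<not> near_int \<epsilon> (of_int x * b - t b)} \<le> k" .
  qed
qed

text \<open>Induction: the rational span of a finite set is countable and therefore misses a point
  of the interval \<open>{0<..<\<epsilon>}\<close>.\<close>

lemma small_independent_reals:
  assumes "\<epsilon> > 0" "\<epsilon> \<le> 1"
  obtains B :: "real set" where "finite B" "card B = d" "B \<subseteq> {0<..<\<epsilon>}"
    "rat_real.independent (insert 1 B)"
proof -
  have "\<exists>B :: real set. finite B \<and> card B = d \<and> B \<subseteq> {0<..<\<epsilon>} \<and> rat_real.independent (insert 1 B)"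
  proof (induction d)
    case 0
    have "rat_real.independent {1}"
      using rat_real.independent_insertI[of 1 "{}"] by simp
    then show ?case by auto
  next
    case (Suc d)
    then obtain B where B: "finite B" "card B = d" "B \<subseteq> {0<..<\<epsilon>}" "rat_real.independent (insert 1 B)" by blast
    have "rat_real.span (insert 1 B) = range (\<lambda>u. \<Sum>v\<in>insert 1 B. of_rat (u v) * v)"
      using B(1) by (intro rat_real.span_finite) auto
    also have "\<dots> \<subseteq> (\<lambda>u. \<Sum>v\<in>insert 1 B. of_rat (u v) * v) ` (insert 1 B \<rightarrow>\<^sub>E UNIV)"
    proof
      fix x assume "x \<in> range (\<lambda>u. \<Sum>v\<in>insert 1 B. of_rat (u v) * v)"
      then obtain u where "x = (\<Sum>v\<in>insert 1 B. of_rat (u v) * v)" by auto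
      then have "x = (\<Sum>v\<in>insert 1 B. of_rat (restrict u (insert 1 B) v) * v)"
        by (auto intro!: sum.cong)
      then show "x \<in> (\<lambda>u. \<Sum>v\<in>insert 1 B. of_rat (u v) * v) ` (insert 1 B \<rightarrow>\<^sub>E UNIV)"
        by (intro image_eqI[where x = "restrict u (insert 1 B)"]) (assumption, simp)
    qed
    finally have "countable (rat_real.span (insert 1 B))"
      using B(1) by (elim countable_subset) (intro countable_image countable_PiE, auto)
    moreover have "uncountable {0<..<\<epsilon>}" using assms by (simp add: uncountable_open_interval)
    ultimately obtain b where b: "b \<in> {0<..<\<epsilon>}" "b \<notin> rat_real.span (insert 1 B)"
      by (meson countable_subset subsetI)
    have "rat_real.independent (insert b (insert 1 B))"
      using rat_real.independent_insertI[OF b(2) B(4)] .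
    moreover have "b \<notin> B" using b(2) rat_real.span_base by blast
    ultimately show ?case using B b(1)
      by (intro exI[of _ "insert b B"]) (auto simp: insert_commute)
  qed
  then show ?thesis using that by blast
qed

text \<open>Kronecker approximation yields an integer \<open>m + x\<close> with the wanted
  properties, but perhaps outside \<open>S\<close>. Bohr density then moves it into
  \<open>S\<close>. The new neighbourhood controls all of \<open>B\<close>, so no further coordinate
  is spoiled.\<close>

lemma bohr_dense_Hamming:
  fixes B :: "real set" and t :: "real \<Rightarrow> real" and Q m :: int
  assumes S: "bohr_dense S" and B: "finite B" "rat_real.independent (insert 1 B)" "1 \<notin> B"
    and "Q > 0" "d > 0" "\<epsilon> > 0"
  shows "\<exists>s\<in>S. s \<in> bohr_nbhd k a d m \<and> Q dvd s - m \<and> card {b\<in>B. \<not> near_int \<epsilon> (of_int s * b - t b)} \<le> k"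
proof -
  define \<delta> where "\<delta> = min (1 / of_int Q) (min (d/2) (\<epsilon>/2))"
  have \<delta>: "\<delta> > 0" "\<delta> \<le> 1 / of_int Q" "\<delta> \<le> d/2" "\<delta> \<le> \<epsilon>/2" using assms(5-7) by (auto simp: \<delta>_def)
  obtain x where x: "Q dvd x" "\<And>i. i < k \<Longrightarrow> near_int \<delta> (of_int x * a i)"
    "card {b\<in>B. \<not> near_int \<delta> (of_int x * b - (t b - of_int m * b))} \<le> k"
    using Kronecker_all_but_k[OF B \<open>Q > 0\<close> \<delta>(1), where a = a and k = k and t = "\<lambda>b. t b - of_int m * b"] by blast
  obtain g where g: "bij_betw g {..<card B} B"
    using ex_bij_betw_nat_finite[OF B(1)] by (auto simp: atLeast0LessThan)
  \<comment> \<open>The neighbourhood of \<open>m + x\<close> is cut out by the characters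
    \<open>a\<close>, by \<open>1 / Q\<close> for the congruence, and by all elements of
    \<open>B\<close>.\<close>
  define c where "c i = (if i < k then a i else if i = k then 1 / of_int Q else g (i - k - 1))" for i
  have "S \<inter> bohr_nbhd (k + 1 + card B) c \<delta> (m + x) \<noteq> {}"
    using S \<delta>(1) unfolding bohr_dense_iff by blast
  then obtain s where s: "s \<in> S" and "s \<in> bohr_nbhd (k + 1 + card B) c \<delta> (m + x)" by auto
  then have near: "near_int \<delta> (of_int (s - (m + x)) * c i)" if "i < k + 1 + card B" for i
    using that unfolding bohr_nbhd_def by blast
  have 1: "near_int \<delta> (of_int (s - (m + x)) * a i)" if "i < k" for i
    using near[of i] that by (simp add: c_def)
  have "near_int \<delta> (of_int (s - (m + x)) / of_int Q)" using near[of k] by (simp add: c_def)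
  then have "Q dvd s - (m + x)" using near_int_dvd near_int_mono \<delta>(2) \<open>Q > 0\<close> by blast
  then have 2: "Q dvd s - m" using x(1) by (metis add_diff_cancel_left' diff_diff_eq dvd_diff_commute
        dvd_add_right_iff diff_add_cancel)
  have 3: "near_int \<delta> (of_int (s - (m + x)) * b)" if b: "b \<in> B" for b
  proof -
    have "b \<in> g ` {..<card B}" using b bij_betw_imp_surj_on[OF g] by simp
    then obtain i where "i < card B" "b = g i" by auto
    then show ?thesis using near[of "k + 1 + i"] by (simp add: c_def)
  qed
  show ?thesis
  proof (intro bexI[OF _ s] conjI 2)
    show "s \<in> bohr_nbhd k a d m"
      unfolding bohr_nbhd_def
    proof safe
      fix i assume "i < k"
      from near_int_add[OF 1[OF this] x(2)[OF this]]
      have "near_int (\<delta> + \<delta>) (of_int (s - m) * a i)" by (simp add: algebra_simps)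
      then show "near_int d (of_int (s - m) * a i)" by (rule near_int_mono) (use \<delta> in simp)
    qed
    have "{b\<in>B. \<not> near_int \<epsilon> (of_int s * b - t b)} \<subseteq> {b\<in>B. \<not> near_int \<delta> (of_int x * b - (t b - of_int m * b))}"
    proof safe
      fix b assume b: "b \<in> B" and no: "\<not> near_int \<epsilon> (of_int s * b - t b)"
        and "near_int \<delta> (of_int x * b - (t b - of_int m * b))"
      from near_int_add[OF 3[OF b] this(3)]
      have "near_int (\<delta> + \<delta>) (of_int s * b - t b)" by (simp add: algebra_simps)
      then have "near_int \<epsilon> (of_int s * b - t b)" by (rule near_int_mono) (use \<delta> in simp)
      then show False using no by simp
    qed
    then have "card {b\<in>B. \<not> near_int \<epsilon> (of_int s * b - t b)} \<le> card {b\<in>B. \<not> near_int \<delta> (of_int x * b - (t b - of_int m * b))}"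
      using B(1) by (intro card_mono) auto
    then show "card {b\<in>B. \<not> near_int \<epsilon> (of_int s * b - t b)} \<le> k" using x(3) by linarith
  qed
qed

text \<open>Compactness of the cube of coefficients: each \<open>s\<close> works for an open set of
  parameters \<open>a\<close>, so finitely many elements of \<open>S\<close> serve all
  \<open>a\<close> at once.\<close>

lemma finite_bohr_Hamming:
  fixes B :: "real set" and t :: "real \<Rightarrow> real" and Q m :: int
  assumes "bohr_dense S" "finite B" "rat_real.independent (insert 1 B)" "1 \<notin> B" "Q > 0" "d > 0" "\<epsilon> > 0"
  obtains F where "finite F" "F \<subseteq> S" "\<And>a. F \<inter> bohr_nbhd k a d m \<noteq> {}"
    "\<And>f. f \<in> F \<Longrightarrow> Q dvd f - m" "\<And>f. f \<in> F \<Longrightarrow> card {b\<in>B. \<not> near_int \<epsilon> (of_int f * b - t b)} \<le> k"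
proof -
  define S' where "S' = {s\<in>S. Q dvd s - m \<and> card {b\<in>B. \<not> near_int \<epsilon> (of_int s * b - t b)} \<le> k}"
  define U where "U s = {a. s \<in> bohr_nbhd k a d m}" for s
  define K where "K = PiE (UNIV :: nat set) (\<lambda>_. {0..1::real})"
  have "compactin (product_topology (\<lambda>_. euclidean) (UNIV :: nat set)) K"
    unfolding K_def compactin_PiE by simp
  then have cK: "compact K" by (simp add: euclidean_product_topology)
  have oU: "open (U s)" for s
  proof -
    have "open {a :: nat \<Rightarrow> real. \<bar>of_int (s - m) * a i - of_int z\<bar> < d}" for i and z :: int
      by (intro open_Collect_less continuous_intros continuous_on_product_coordinates)
    then have "open (\<Inter>i\<in>{..<k}. \<Union>z. {a :: nat \<Rightarrow> real. \<bar>of_int (s - m) * a i - of_int z\<bar> < d})"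
      by (intro open_INT open_UN) auto
    moreover have "U s = (\<Inter>i\<in>{..<k}. \<Union>z. {a. \<bar>of_int (s - m) * a i - of_int z\<bar> < d})"
      by (auto simp: U_def bohr_nbhd_def near_int_def)
    ultimately show ?thesis by simp
  qed
  have cov: "K \<subseteq> (\<Union>s\<in>S'. U s)"
  proof
    fix a assume "a \<in> K"
    obtain s where "s \<in> S" "s \<in> bohr_nbhd k a d m" "Q dvd s - m" "card {b\<in>B. \<not> near_int \<epsilon> (of_int s * b - t b)} \<le> k"
      using bohr_dense_Hamming[OF assms, of k a m t] by blast
    then show "a \<in> (\<Union>s\<in>S'. U s)" by (intro UN_I[of s]) (simp_all add: S'_def U_def)
  qed
  obtain F where F: "F \<subseteq> S'" "finite F" "K \<subseteq> (\<Union>s\<in>F. U s)"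
  proof (rule compactE_image[of K S' U, OF cK _ cov])
    show "open (U s)" for s by (rule oU)
  qed (rule that)
  have "F \<inter> bohr_nbhd k a d m \<noteq> {}" for a
  proof -
    have "(\<lambda>i. frac (a i)) \<in> K" by (auto simp: K_def frac_lt_1 less_imp_le)
    then obtain s where "s \<in> F" "s \<in> bohr_nbhd k (\<lambda>i. frac (a i)) d m" using F(3) by (auto simp: U_def)
    then have "s \<in> F \<inter> bohr_nbhd k a d m" unfolding bohr_nbhd_def near_int_frac by simp
    then show ?thesis by blast
  qed
  moreover have "F \<subseteq> S" using F(1) by (auto simp: S'_def)
  ultimately show ?thesis using F(1,2) by (intro that[of F]) (auto simp: S'_def)
qed

section \<open>Antiperiodic patterns and balanced sets\<close>

lemma antiperiodic_mod:
  fixes v :: "int \<Rightarrow> bool" and M :: int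
  assumes "\<And>c. v (c + M) = (\<not> v c)"
  shows "v (c + j * (2 * M)) = v c" "v (c - t mod (2 * M)) = v (c - t)"
proof -
  have step: "v (c + 2 * M) = v c" for c
    using assms[of "c + M"] assms[of c] by (simp add: algebra_simps)
  show *: "v (c + j * (2 * M)) = v c" for c j
  proof (induction j rule: int_induct[where k = 0])
    case (step1 i)
    then show ?case using step[of "c + i * (2 * M)"] by (simp add: algebra_simps)
  next
    case (step2 i)
    then show ?case using step[of "c + (i - 1) * (2 * M)"] by (simp add: algebra_simps)
  qed simp
  have "c - t mod (2 * M) = (c - t) + (t div (2 * M)) * (2 * M)"
    by (simp add: minus_div_mult_eq_mod[symmetric])
  then show "v (c - t mod (2 * M)) = v (c - t)" using * by metis
qed

text \<open>The gcd of \<open>t\<close> and \<open>2 ^ Suc a\<close> is a power of two dividing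
  \<open>2 ^ a\<close>, because \<open>t\<close> is not a multiple of \<open>2 ^ Suc a\<close>. By
  Bezout, a period \<open>t\<close> would make the antiperiod \<open>2 ^ a\<close> a period.\<close>

lemma antiperiodic_no_period:
  fixes v :: "int \<Rightarrow> bool"
  assumes v: "\<And>c. v (c + 2 ^ a) = (\<not> v c)" and t: "0 < t" "t < 2 ^ Suc a" and per: "\<And>c. v (c - t) = v c"
  shows False
proof -
  have mult: "v (c + j * t) = v c" for c j
  proof (induction j rule: int_induct[where k = 0])
    case (step1 i)
    then show ?case using per[of "c + (i + 1) * t"] by (simp add: algebra_simps)
  next
    case (step2 i)
    then show ?case using per[of "c + i * t"] by (simp add: algebra_simps)
  qed simp
  have "gcd (nat t) (2 ^ Suc a) dvd 2 ^ Suc a" by simp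
  then obtain j where j: "j \<le> Suc a" "gcd (nat t) (2 ^ Suc a) = 2 ^ j"
    using divides_primepow_nat[of 2 "gcd (nat t) (2 ^ Suc a)" "Suc a"] two_is_prime_nat by blast
  have "j \<noteq> Suc a"
  proof
    assume "j = Suc a"
    then have "2 ^ Suc a dvd nat t" using j(2) by (metis gcd_dvd1)
    then have "2 ^ Suc a \<le> nat t" using t by (intro dvd_imp_le) auto
    then have "int (2 ^ Suc a) \<le> int (nat t)" by (simp only: of_nat_le_iff)
    then show False using t by simp
  qed
  then have "j \<le> a" using j(1) by simp
  have "gcd t (2 ^ Suc a) = 2 ^ j"
  proof -
    have "gcd t (2 ^ Suc a) = int (gcd (nat t) (2 ^ Suc a))"
      using t by (metis gcd_int_int_eq int_nat_eq less_imp_le of_nat_numeral of_nat_power)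
    then show ?thesis using j(2) by simp
  qed
  then obtain x z where "x * t + z * 2 ^ Suc a = 2 ^ j" using bezout_int[of t "2 ^ Suc a"] by metis
  moreover have "(2 ^ a :: int) = 2 ^ (a - j) * 2 ^ j" using \<open>j \<le> a\<close> by (simp add: power_add[symmetric])
  ultimately have "(2 ^ a :: int) = 2 ^ (a - j) * (x * t + z * 2 ^ Suc a)" by simp
  also have "\<dots> = (2 ^ (a - j) * x) * t + (2 ^ (a - j) * z) * (2 * 2 ^ a)"
    by (simp add: algebra_simps)
  finally have "v (0 + 2 ^ a) = v (0 + (2 ^ (a - j) * x) * t + (2 ^ (a - j) * z) * (2 * 2 ^ a))" by simp
  also have "\<dots> = v 0" unfolding antiperiodic_mod(1)[where v = v and M = "2 ^ a", OF v] mult ..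
  finally show False using v[of 0] by simp
qed

text \<open>An antiperiodic pattern of antiperiod a power of two has trivial stabilizer in the cyclic
  group of its shifts, so its orbit is a copy of that group.\<close>

lemma orbit_position:
  obtains \<tau> :: "(int \<Rightarrow> bool) \<Rightarrow> nat" where
    "\<And>v. (\<And>c. v (c + 2 ^ a) = (\<not> v c)) \<Longrightarrow> \<tau> v < 2 ^ Suc a"
    "\<And>v. (\<And>c. v (c + 2 ^ a) = (\<not> v c)) \<Longrightarrow> \<tau> (\<lambda>c. v (c - 1)) = (\<tau> v + 1) mod 2 ^ Suc a"
proof -
  define anti where "anti v \<longleftrightarrow> (\<forall>c. v (c + 2 ^ a) = (\<not> v c))" for v :: "int \<Rightarrow> bool"
  \<comment> \<open>A base point is chosen in each shift orbit; the choice depends on the orbit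
    only. Then \<tau> measures the position of \<open>v\<close> relative to the base point.\<close>
  define rep where "rep v = (SOME w. \<exists>y. w = (\<lambda>c. v (c - y)))" for v :: "int \<Rightarrow> bool"
  have rep_ex: "\<exists>y. rep v = (\<lambda>c. v (c - y))" for v
    using someI_ex[of "\<lambda>w. \<exists>y. w = (\<lambda>c. v (c - y))"] unfolding rep_def by blast
  have rep_shift: "rep (\<lambda>c. v (c - z)) = rep v" for v z
  proof -
    have "(\<exists>y. w = (\<lambda>c. v (c - y - z))) \<longleftrightarrow> (\<exists>y. w = (\<lambda>c. v (c - y)))" for w
    proof
      assume "\<exists>y. w = (\<lambda>c. v (c - y - z))"
      then obtain y where "w = (\<lambda>c. v (c - (y + z)))" by (auto simp: diff_diff_eq)
      then show "\<exists>y. w = (\<lambda>c. v (c - y))" by blast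
    next
      assume "\<exists>y. w = (\<lambda>c. v (c - y))"
      then obtain y where "w = (\<lambda>c. v (c - (y - z) - z))" by auto
      then show "\<exists>y. w = (\<lambda>c. v (c - y - z))" by blast
    qed
    then show ?thesis by (simp add: rep_def)
  qed
  have anti_shift: "anti (\<lambda>c. v (c - y))" if "anti v" for v y
    using that unfolding anti_def by (metis add_diff_eq diff_add_eq)
  have anti_rep: "anti (rep v)" if "anti v" for v
    using rep_ex[of v] anti_shift[OF that] by metis
  have ex: "\<exists>t. t < 2 ^ Suc a \<and> v = (\<lambda>c. rep v (c - int t))" if "anti v" for v
  proof -
    obtain y where y: "rep v = (\<lambda>c. v (c - y))" using rep_ex by blast
    define t where "t = nat ((- y) mod (2 * 2 ^ a))"
    have it: "int t = (- y) mod (2 * 2 ^ a)" by (simp add: t_def)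
    have "int t < int (2 ^ Suc a)" unfolding it by simp
    then have "t < 2 ^ Suc a" by (simp only: of_nat_less_iff)
    moreover have "rep v (c - int t) = rep v (c - (- y))" for c
      unfolding it by (rule antiperiodic_mod(2)) (use anti_rep[OF that] in \<open>simp add: anti_def\<close>)
    ultimately show ?thesis unfolding y by (intro exI[of _ t]) (auto simp: fun_eq_iff)
  qed
  define \<tau> where "\<tau> v = (SOME t. t < 2 ^ Suc a \<and> v = (\<lambda>c. rep v (c - int t)))" for v
  have \<tau>: "\<tau> v < 2 ^ Suc a" "v = (\<lambda>c. rep v (c - int (\<tau> v)))" if "anti v" for v
    using someI_ex[OF ex[OF that]] unfolding \<tau>_def by blast+
  have le: "t1 = t2" if "anti w" "t1 \<le> t2" "t2 < 2 ^ Suc a" "(\<lambda>c. w (c - int t1)) = (\<lambda>c. w (c - int t2))" for w t1 t2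
  proof (rule ccontr)
    assume "t1 \<noteq> t2"
    then have "0 < int t2 - int t1" using that(2) by simp
    moreover have "int t2 - int t1 < 2 ^ Suc a"
    proof -
      have "int t2 < int (2 ^ Suc a)" using that(3) by (simp only: of_nat_less_iff)
      then show ?thesis by simp
    qed
    moreover have "w (c - (int t2 - int t1)) = w c" for c
      using fun_cong[OF that(4), of "c + int t1"] by (simp add: algebra_simps)
    ultimately show False
      using antiperiodic_no_period[of w a "int t2 - int t1"] that(1) unfolding anti_def by blast
  qed
  have uniq: "t1 = t2" if "anti w" "t1 < 2 ^ Suc a" "t2 < 2 ^ Suc a" "(\<lambda>c. w (c - int t1)) = (\<lambda>c. w (c - int t2))" for w t1 t2
    using le[OF that(1), of t1 t2] le[OF that(1), of t2 t1] that(2-4) by (metis linear)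
  show ?thesis
  proof
    fix v :: "int \<Rightarrow> bool" assume "\<And>c. v (c + 2 ^ a) = (\<not> v c)"
    then have v: "anti v" by (simp add: anti_def)
    show "\<tau> v < 2 ^ Suc a" using \<tau>(1)[OF v] .
    define v' where "v' = (\<lambda>c. v (c - 1))"
    have v': "anti v'" using anti_shift[OF v] by (simp add: v'_def)
    define w where "w = rep v"
    have w: "anti w" "rep v' = w" using anti_rep[OF v] rep_shift[of v 1] by (auto simp: w_def v'_def)
    have "w (c - int ((\<tau> v + 1) mod 2 ^ Suc a)) = w (c - int (\<tau> v + 1))" for c
      using antiperiodic_mod(2)[of w "2 ^ a" c "int (\<tau> v + 1)"] w(1) by (simp add: anti_def zmod_int)
    moreover have "v' c = w (c - int (\<tau> v + 1))" for c
      using fun_cong[OF \<tau>(2)[OF v], of "c - 1"] by (simp add: v'_def w_def algebra_simps)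
    ultimately have "(\<lambda>c. w (c - int ((\<tau> v + 1) mod 2 ^ Suc a))) = v'" by auto
    also have "v' = (\<lambda>c. w (c - int (\<tau> v')))" using \<tau>(2)[OF v'] w(2) by simp
    finally have "(\<tau> v + 1) mod 2 ^ Suc a = \<tau> v'"
      by (intro uniq[OF w(1)]) (use \<tau>(1)[OF v'] in auto)
    then show "\<tau> (\<lambda>c. v (c - 1)) = (\<tau> v + 1) mod 2 ^ Suc a" by (simp add: v'_def)
  qed
qed

section \<open>Nearly balanced votes are rare\<close>

lemma central_binomial_bound: "(real (2 * n choose n) / 4 ^ n)\<^sup>2 \<le> 1 / (2 * real n + 1)"
proof (induction n)
  case 0
  show ?case by simp
next
  case (Suc n)
  have "Suc n * (2 * Suc n choose Suc n) = 2 * ((2 * n + 1) * (2 * n choose n))"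
  proof -
    have "Suc n * (2 * Suc n choose Suc n) = (2 * Suc n) * (Suc (2 * n) choose n)"
      using Suc_times_binomial_eq[of "Suc (2 * n)" n] by (simp add: mult.commute)
    moreover have "(Suc n) * (Suc (2 * n) choose n) = (2 * n + 1) * (2 * n choose n)"
      using binomial_absorb_comp[of "Suc (2 * n)" n] by (simp add: algebra_simps)
    ultimately show ?thesis by (simp add: algebra_simps)
  qed
  then have "real (Suc n) * real (2 * Suc n choose Suc n) = 2 * ((2 * real n + 1) * real (2 * n choose n))"
    by (metis (no_types, opaque_lifting) of_nat_1 of_nat_add of_nat_mult of_nat_numeral)
  moreover have "x / (4 * P) = (2 * real n + 1) / (2 * real n + 2) * (b / P)"
    if "real (Suc n) * x = 2 * ((2 * real n + 1) * b)" for x b P :: real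
  proof -
    have "x / (4 * P) = (real (Suc n) * x) / (real (Suc n) * (4 * P))"
      by (intro mult_divide_mult_cancel_left[symmetric]) simp
    also have "\<dots> = (2 * ((2 * real n + 1) * b)) / (2 * ((2 * real n + 2) * P))"
      unfolding that by (simp add: algebra_simps)
    also have "\<dots> = ((2 * real n + 1) * b) / ((2 * real n + 2) * P)"
      by (intro mult_divide_mult_cancel_left) simp
    finally show ?thesis by (simp only: times_divide_times_eq)
  qed
  ultimately have ratio: "real (2 * Suc n choose Suc n) / 4 ^ Suc n
      = (2 * real n + 1) / (2 * real n + 2) * (real (2 * n choose n) / 4 ^ n)"
    unfolding power_Suc by blast
  have "(real (2 * Suc n choose Suc n) / 4 ^ Suc n)\<^sup>2
      = ((2 * real n + 1) / (2 * real n + 2))\<^sup>2 * (real (2 * n choose n) / 4 ^ n)\<^sup>2"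
    unfolding ratio by (simp only: power_mult_distrib)
  also have "\<dots> \<le> ((2 * real n + 1) / (2 * real n + 2))\<^sup>2 * (1 / (2 * real n + 1))"
    by (intro mult_left_mono Suc.IH) auto
  also have "\<dots> = (2 * real n + 1) / (2 * real n + 2)\<^sup>2"
    by (simp add: power2_eq_square)
  \<comment> \<open>The form \<open>1 / (2 * n + 1)\<close> of the bound reproduces itself because
    \<open>(2 * n + 1) * (2 * n + 3) \<le> (2 * n + 2)\<^sup>2\<close>.\<close>
  also have "\<dots> \<le> 1 / (2 * real (Suc n) + 1)"
  proof -
    have "x / y \<le> 1 / z" if "x * z \<le> y" "y > 0" "z > 0" for x y z :: real
      using that by (simp add: field_simps)
    moreover have "(2 * real n + 1) * (2 * real (Suc n) + 1) \<le> (2 * real n + 2)\<^sup>2"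
      by (simp add: power2_eq_square algebra_simps)
    ultimately show ?thesis by simp
  qed
  finally show ?case .
qed

lemma central_binomial_tendsto_0: "(\<lambda>n. real (2 * n choose n) / 4 ^ n) \<longlonglongrightarrow> 0"
proof -
  have "(\<lambda>n. (real (2 * n choose n) / 4 ^ n)\<^sup>2) \<longlonglongrightarrow> 0"
  proof (rule tendsto_sandwich[OF _ _ tendsto_const])
    show "\<forall>\<^sub>F n in sequentially. (real (2 * n choose n) / 4 ^ n)\<^sup>2 \<le> 1 / (2 * real n + 1)"
      using central_binomial_bound by auto
    show "(\<lambda>n. 1 / (2 * real n + 1)) \<longlonglongrightarrow> 0" by real_asymp
  qed auto
  from tendsto_real_sqrt[OF this] show ?thesis by simp
qed

text \<open>Near-balance leaves at most \<open>2 * k + 1\<close> cardinalities, and each binomial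
  coefficient of \<open>2 * n + 1\<close> is at most twice the central one of
  \<open>2 * n\<close>.\<close>

lemma card_balanced_subsets:
  assumes "finite I" "card I = 2 * n + 1"
  shows "real (card {A. A \<subseteq> I \<and> \<bar>2 * int (card A) - int (card I)\<bar> \<le> 2 * int k})
    \<le> real (2 * k + 1) * (real (2 * n choose n) / 4 ^ n) * 2 ^ card I"
proof -
  define J where "J = {j. \<bar>2 * int j - int (card I)\<bar> \<le> 2 * int k}"
  have J_sub: "J \<subseteq> {n + 1 - k..n + k}" using assms(2) by (auto simp: J_def)
  then have finJ: "finite J" using finite_subset by blast
  have "card J \<le> card {n + 1 - k..n + k}" using J_sub by (intro card_mono) auto
  then have cJ: "card J \<le> 2 * k + 1" by simp
  have "{A. A \<subseteq> I \<and> \<bar>2 * int (card A) - int (card I)\<bar> \<le> 2 * int k} = (\<Union>j\<in>J. {A. A \<subseteq> I \<and> card A = j})"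
    by (auto simp: J_def)
  then have "card {A. A \<subseteq> I \<and> \<bar>2 * int (card A) - int (card I)\<bar> \<le> 2 * int k}
      \<le> (\<Sum>j\<in>J. card {A. A \<subseteq> I \<and> card A = j})"
    using card_UN_le[OF finJ] by simp
  also have "\<dots> = (\<Sum>j\<in>J. card I choose j)" by (simp add: n_subsets[OF assms(1)])
  also have "\<dots> \<le> (\<Sum>j\<in>J. 2 * (2 * n choose n))"
  proof (rule sum_mono)
    fix j
    have "card I choose j \<le> card I choose (card I div 2)" by (rule binomial_maximum)
    also have "\<dots> = (2 * n + 1) choose n" by (simp add: assms(2))
    also have "\<dots> \<le> 2 * (2 * n choose n)"
    proof (cases n)
      case (Suc l)
      then have "(2 * n + 1) choose n = (2 * n choose l) + (2 * n choose n)" by simp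
      moreover have "2 * n choose l \<le> 2 * n choose n" using binomial_maximum[of "2 * n" l] by simp
      ultimately show ?thesis by linarith
    qed simp
    finally show "card I choose j \<le> 2 * (2 * n choose n)" .
  qed
  also have "\<dots> \<le> (2 * k + 1) * (2 * (2 * n choose n))" unfolding sum_constant of_nat_id using cJ by (intro mult_right_mono) auto
  finally have "real (card {A. A \<subseteq> I \<and> \<bar>2 * int (card A) - int (card I)\<bar> \<le> 2 * int k})
      \<le> real ((2 * k + 1) * (2 * (2 * n choose n)))" by (simp only: of_nat_le_iff)
  also have "\<dots> = real (2 * k + 1) * (real (2 * n choose n) / 4 ^ n) * 2 ^ card I"
  proof -
    have "(2 :: real) ^ card I = 4 ^ n * 2" by (simp add: assms(2) power_mult)
    then show ?thesis by (simp add: field_simps)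
  qed
  finally show ?thesis .
qed

text \<open>Union bound over the coordinates, multiplied out so as to avoid division.\<close>

lemma card_PiE_exists_le:
  assumes "finite I" "finite X" "E \<subseteq> X"
  shows "card {Y \<in> I \<rightarrow>\<^sub>E X. \<exists>i\<in>I. Y i \<in> E} * card X \<le> card I * card E * card (I \<rightarrow>\<^sub>E X)"
proof -
  have finE: "finite E" using assms finite_subset by blast
  have one: "card {Y \<in> I \<rightarrow>\<^sub>E X. Y i \<in> E} * card X = card E * card (I \<rightarrow>\<^sub>E X)" if i: "i \<in> I" for i
  proof -
    have "{Y \<in> I \<rightarrow>\<^sub>E X. Y i \<in> E} = (\<Pi>\<^sub>E j\<in>I. if j = i then E else X)"
      using assms(3) i by (auto simp: PiE_def Pi_iff extensional_def split: if_splits) (metis subsetD)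
    then have "card {Y \<in> I \<rightarrow>\<^sub>E X. Y i \<in> E} = (\<Prod>j\<in>I. if j = i then card E else card X)"
      by (simp add: card_PiE[OF assms(1)] if_distrib cong: if_cong)
    also have "\<dots> = card E * (\<Prod>j\<in>I - {i}. card X)"
      using assms(1) i by (subst prod.remove[of _ i]) (auto intro!: prod.cong)
    also have "\<dots> * card X = card E * (\<Prod>j\<in>I. card X)"
      using prod.remove[OF assms(1) i, of "\<lambda>_. card X"] by simp
    finally show ?thesis using assms(1) by (simp add: card_PiE)
  qed
  have "{Y \<in> I \<rightarrow>\<^sub>E X. \<exists>i\<in>I. Y i \<in> E} = (\<Union>i\<in>I. {Y \<in> I \<rightarrow>\<^sub>E X. Y i \<in> E})" by blast
  then have "card {Y \<in> I \<rightarrow>\<^sub>E X. \<exists>i\<in>I. Y i \<in> E} \<le> (\<Sum>i\<in>I. card {Y \<in> I \<rightarrow>\<^sub>E X. Y i \<in> E})"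
    using card_UN_le[OF assms(1)] by simp
  then have "card {Y \<in> I \<rightarrow>\<^sub>E X. \<exists>i\<in>I. Y i \<in> E} * card X \<le> (\<Sum>i\<in>I. card {Y \<in> I \<rightarrow>\<^sub>E X. Y i \<in> E}) * card X"
    by simp
  also have "\<dots> = (\<Sum>i\<in>I. card E * card (I \<rightarrow>\<^sub>E X))" by (simp add: sum_distrib_right one)
  finally show ?thesis by simp
qed

lemma card_PiE_pattern:
  assumes "finite I" "finite X" "A \<subseteq> I" "card {x\<in>X. P x} = c" "card {x\<in>X. \<not> P x} = c"
  shows "card {Y \<in> I \<rightarrow>\<^sub>E X. {i\<in>I. P (Y i)} = A} = c ^ card I"
proof -
  have "{Y \<in> I \<rightarrow>\<^sub>E X. {i\<in>I. P (Y i)} = A} = (\<Pi>\<^sub>E i\<in>I. if i \<in> A then {x\<in>X. P x} else {x\<in>X. \<not> P x})"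
    using assms(3) by (auto simp: PiE_def Pi_iff extensional_def split: if_splits)
  then have "card {Y \<in> I \<rightarrow>\<^sub>E X. {i\<in>I. P (Y i)} = A} = (\<Prod>i\<in>I. c)"
    by (simp add: card_PiE[OF assms(1)] if_distrib assms(4,5) cong: if_cong)
  then show ?thesis by simp
qed

text \<open>As \<open>P\<close> splits \<open>X\<close> in half, all vote patterns on
  \<open>I\<close> are equally frequent, and it remains to count balanced subsets of
  \<open>I\<close>.\<close>

lemma card_PiE_balanced:
  assumes "finite I" "card I = 2 * n + 1" "finite X" "card {x\<in>X. P x} = card {x\<in>X. \<not> P x}"
  shows "real (card {Y \<in> I \<rightarrow>\<^sub>E X. \<bar>2 * int (card {i\<in>I. P (Y i)}) - int (card I)\<bar> \<le> 2 * int k})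
    \<le> real (2 * k + 1) * (real (2 * n choose n) / 4 ^ n) * real (card (I \<rightarrow>\<^sub>E X))"
proof -
  define c where "c = card {x\<in>X. P x}"
  define \<A> where "\<A> = {A. A \<subseteq> I \<and> \<bar>2 * int (card A) - int (card I)\<bar> \<le> 2 * int k}"
  have fin: "finite \<A>" using assms(1) by (auto simp: \<A>_def intro: finite_subset[of _ "Pow I"])
  have cX: "card X = 2 * c"
  proof -
    have "card X = card ({x\<in>X. P x} \<union> {x\<in>X. \<not> P x})" by (rule arg_cong[where f = card]) auto
    also have "\<dots> = card {x\<in>X. P x} + card {x\<in>X. \<not> P x}" using assms(3) by (intro card_Un_disjoint) auto
    finally show ?thesis using assms(4) by (simp add: c_def)
  qed
  have "{Y \<in> I \<rightarrow>\<^sub>E X. \<bar>2 * int (card {i\<in>I. P (Y i)}) - int (card I)\<bar> \<le> 2 * int k}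
      = (\<Union>A\<in>\<A>. {Y \<in> I \<rightarrow>\<^sub>E X. {i\<in>I. P (Y i)} = A})"
    by (auto simp: \<A>_def)
  then have "card {Y \<in> I \<rightarrow>\<^sub>E X. \<bar>2 * int (card {i\<in>I. P (Y i)}) - int (card I)\<bar> \<le> 2 * int k}
      \<le> (\<Sum>A\<in>\<A>. card {Y \<in> I \<rightarrow>\<^sub>E X. {i\<in>I. P (Y i)} = A})"
    using card_UN_le[OF fin] by simp
  also have "\<dots> = (\<Sum>A\<in>\<A>. c ^ card I)"
    using assms(4) by (intro sum.cong card_PiE_pattern[OF assms(1,3)]) (auto simp: \<A>_def c_def)
  also have "\<dots> = card \<A> * c ^ card I" by simp
  finally have "real (card {Y \<in> I \<rightarrow>\<^sub>E X. \<bar>2 * int (card {i\<in>I. P (Y i)}) - int (card I)\<bar> \<le> 2 * int k})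
      \<le> real (card \<A> * c ^ card I)" by (rule of_nat_mono)
  also have "\<dots> \<le> (real (2 * k + 1) * (real (2 * n choose n) / 4 ^ n) * 2 ^ card I) * real (c ^ card I)"
    unfolding of_nat_mult using card_balanced_subsets[OF assms(1,2)]
    by (intro mult_right_mono) (auto simp: \<A>_def)
  also have "\<dots> = real (2 * k + 1) * (real (2 * n choose n) / 4 ^ n) * real (card (I \<rightarrow>\<^sub>E X))"
    using assms(1) by (simp add: card_PiE cX power_mult_distrib)
  finally show ?thesis .
qed

section \<open>Counters from majority votes\<close>

text \<open>A rotation of a discrete torus, the power of the cyclic group of order \<open>q\<close>
  indexed by \<open>B\<close>. Discretising replaces Haar measure by counting, and extensional
  functions make the torus a finite set when \<open>B\<close> is finite.\<close>

definition translate :: "int \<Rightarrow> 'a set \<Rightarrow> ('a \<Rightarrow> int) \<Rightarrow> ('a \<Rightarrow> int) \<Rightarrow> 'a \<Rightarrow> int" where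
  "translate q B s Y = (\<lambda>i\<in>B. (Y i + s i) mod q)"

lemma translate_in: "q > 0 \<Longrightarrow> translate q B s Y \<in> B \<rightarrow>\<^sub>E {0..<q}"
  by (auto simp: translate_def)

lemma translate_translate: "translate q B s (translate q B s' Y) = translate q B (\<lambda>i. s i + s' i) Y"
  by (simp add: translate_def restrict_def fun_eq_iff mod_add_right_eq add_ac)

lemma translate_cong: "(\<And>i. i \<in> B \<Longrightarrow> s i mod q = s' i mod q) \<Longrightarrow> translate q B s Y = translate q B s' Y"
  unfolding translate_def by (intro restrict_ext) (rule mod_add_cong[OF refl])

lemma translate_0: "Y \<in> B \<rightarrow>\<^sub>E {0..<q} \<Longrightarrow> translate q B (\<lambda>i. 0) Y = Y"
  by (rule ext) (simp add: translate_def PiE_iff extensional_def restrict_def)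

lemma bij_betw_translate:
  assumes "q > 0"
  shows "bij_betw (translate q B s) (B \<rightarrow>\<^sub>E {0..<q}) (B \<rightarrow>\<^sub>E {0..<q})"
proof (rule bij_betw_byWitness[where f' = "translate q B (\<lambda>i. - s i)"])
  show "translate q B s ` (B \<rightarrow>\<^sub>E {0..<q}) \<subseteq> B \<rightarrow>\<^sub>E {0..<q}"
    "translate q B (\<lambda>i. - s i) ` (B \<rightarrow>\<^sub>E {0..<q}) \<subseteq> B \<rightarrow>\<^sub>E {0..<q}"
    by (rule image_subsetI, rule translate_in[OF assms])+
qed (simp_all add: translate_translate translate_0)

lemma card_translate:
  assumes "q > 0"
  shows "card {Y \<in> B \<rightarrow>\<^sub>E {0..<q}. P (translate q B s Y)} = card {Y \<in> B \<rightarrow>\<^sub>E {0..<q}. P Y}"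
proof -
  have "bij_betw (translate q B s) {Y \<in> B \<rightarrow>\<^sub>E {0..<q}. P (translate q B s Y)} {Y \<in> B \<rightarrow>\<^sub>E {0..<q}. P Y}"
    using bij_betw_translate[OF assms, of B s] unfolding bij_betw_def
    by (auto simp: inj_on_def image_iff)
  then show ?thesis by (rule bij_betw_same_card)
qed

text \<open>The circle of length \<open>2 * M * r\<close> is cut into \<open>2 * M\<close> arcs of
  length \<open>r\<close>; the half circle in question consists of \<open>M\<close> consecutive arcs
  beginning with number \<open>c\<close>.\<close>

definition in_half :: "int \<Rightarrow> int \<Rightarrow> int \<Rightarrow> int \<Rightarrow> bool" where
  "in_half r M c x \<longleftrightarrow> (x div r - c) mod (2 * M) < M"

lemma in_half_antiperiodic:
  assumes "M > 0"
  shows "in_half r M (c + M) x \<longleftrightarrow> \<not> in_half r M c x"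
proof -
  define u where "u = (x div r - c) mod (2 * M)"
  have u: "0 \<le> u" "u < 2 * M" using assms by (auto simp: u_def)
  have "(x div r - (c + M)) mod (2 * M) = (u - M) mod (2 * M)"
    by (simp add: u_def mod_simps algebra_simps)
  also have "\<dots> = (if u < M then u + M else u - M)"
  proof (cases "u < M")
    case True
    then have "(u - M + 2 * M) mod (2 * M) = u + M" using u assms by (intro trans[OF mod_pos_pos_trivial]) auto
    then show ?thesis using True by (simp only: mod_add_self2 if_True)
  next
    case False
    then show ?thesis using u by (simp add: mod_pos_pos_trivial)
  qed
  finally show ?thesis using u assms unfolding in_half_def u_def[symmetric] by auto
qed

lemma in_half_mod:
  assumes "r > 0" "M > 0"
  shows "in_half r M c (x mod (2 * M * r)) = in_half r M c x"
proof -
  have "x mod (2 * M * r) = x + r * (- (2 * M * (x div (2 * M * r))))"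
    by (simp add: minus_mult_div_eq_mod[symmetric] algebra_simps)
  then have "x mod (2 * M * r) div r = - (2 * M * (x div (2 * M * r))) + x div r"
    using assms by (simp only: div_mult_self2)
  then have "x mod (2 * M * r) div r - c = x div r - c + 2 * M * (- (x div (2 * M * r)))"
    by (simp only: mult_minus_right)
  then have "(x mod (2 * M * r) div r - c) mod (2 * M) = (x div r - c + 2 * M * (- (x div (2 * M * r)))) mod (2 * M)"
    by (rule arg_cong)
  also have "\<dots> = (x div r - c) mod (2 * M)" by (rule mod_mult_self2)
  finally show ?thesis by (simp add: in_half_def)
qed

text \<open>A point at least \<open>w\<close> away from the ends of its arc does not leave the arc
  when perturbed by at most \<open>w\<close>. So moving it by \<open>e\<close> arcs plus an error
  \<open>t\<close> amounts to turning the half circle back by \<open>e\<close> arcs.\<close>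

lemma in_half_shift:
  assumes "r > 0" "M > 0" "w \<le> x mod r" "x mod r < r - w" "\<bar>t\<bar> \<le> w"
  shows "in_half r M c ((x + (e * r + t + j * (2 * M * r))) mod (2 * M * r)) = in_half r M (c - e) x"
proof -
  have "(x + t) div r = x div r"
  proof -
    have "x + t = (x mod r + t) + r * (x div r)" by simp
    then have "(x + t) div r = x div r + (x mod r + t) div r" using assms(1) by (metis div_mult_self2 less_irrefl)
    then show ?thesis using assms by (simp add: div_pos_pos_trivial)
  qed
  moreover have "x + (e * r + t + j * (2 * M * r)) = (x + t) + r * (e + j * (2 * M))" by (simp add: algebra_simps)
  ultimately have "(x + (e * r + t + j * (2 * M * r))) div r = e + j * (2 * M) + x div r"
    using assms(1) by (simp only: div_mult_self2)
  then have "((x + (e * r + t + j * (2 * M * r))) div r - c) mod (2 * M) = (x div r - (c - e) + j * (2 * M)) mod (2 * M)"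
    by (simp add: algebra_simps)
  also have "\<dots> = (x div r - (c - e)) mod (2 * M)" by (rule mod_mult_self1)
  finally show ?thesis unfolding in_half_mod[OF assms(1,2)] by (simp add: in_half_def)
qed

text \<open>A half turn exchanges a half circle with its complement.\<close>

lemma card_in_half:
  assumes "r > 0" "M > 0"
  shows "card {x\<in>{0..<2 * M * r}. in_half r M c x} = card {x\<in>{0..<2 * M * r}. \<not> in_half r M c x}"
proof -
  let ?q = "2 * M * r"
  have q: "?q > 0" using assms by simp
  have flip: "in_half r M c ((x + M * r) mod ?q) = (\<not> in_half r M c x)" for x
  proof -
    have "in_half r M c ((x + (M * r + 0 + 0 * ?q)) mod ?q) = in_half r M (c - M) x"
      by (rule in_half_shift[where w = 0]) (use assms in auto)
    then show ?thesis using in_half_antiperiodic[OF assms(2), of r "c - M" x] by simp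
  qed
  have inv: "((x + M * r) mod ?q + M * r) mod ?q = x" if "x \<in> {0..<?q}" for x
  proof -
    have "((x + M * r) mod ?q + M * r) mod ?q = (x + 2 * M * r) mod ?q"
      by (simp add: mod_simps algebra_simps)
    then show ?thesis using that by simp
  qed
  have "bij_betw (\<lambda>x. (x + M * r) mod ?q) {x\<in>{0..<?q}. in_half r M c x} {x\<in>{0..<?q}. \<not> in_half r M c x}"
    by (rule bij_betw_byWitness[where f' = "\<lambda>x. (x + M * r) mod ?q"])
      (use inv flip q in auto)
  then show ?thesis by (rule bij_betw_same_card)
qed

definition count_half :: "int \<Rightarrow> int \<Rightarrow> 'a set \<Rightarrow> ('a \<Rightarrow> int) \<Rightarrow> int \<Rightarrow> nat" where
  "count_half r M B Y c = card {i\<in>B. in_half r M c (Y i)}"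

text \<open>To be seen as a function of \<open>c\<close>, a pattern of votes over all half circles.
  For an odd number of voters there are no ties, so it inherits the antiperiod
  \<open>M\<close>.\<close>

definition majority :: "int \<Rightarrow> int \<Rightarrow> 'a set \<Rightarrow> ('a \<Rightarrow> int) \<Rightarrow> int \<Rightarrow> bool" where
  "majority r M B Y c \<longleftrightarrow> card B < 2 * count_half r M B Y c"

lemma count_half_antiperiodic:
  assumes "finite B" "M > 0"
  shows "count_half r M B Y (c + M) + count_half r M B Y c = card B"
proof -
  have "card {i\<in>B. \<not> in_half r M c (Y i)} + card {i\<in>B. in_half r M c (Y i)} =
    card ({i\<in>B. \<not> in_half r M c (Y i)} \<union> {i\<in>B. in_half r M c (Y i)})"
    using assms(1) by (intro card_Un_disjoint[symmetric]) auto
  also have "{i\<in>B. \<not> in_half r M c (Y i)} \<union> {i\<in>B. in_half r M c (Y i)} = B" by auto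
  finally show ?thesis by (simp add: count_half_def in_half_antiperiodic[OF assms(2)])
qed

lemma majority_antiperiodic:
  assumes "finite B" "M > 0" "odd (card B)"
  shows "majority r M B Y (c + M) = (\<not> majority r M B Y c)"
proof -
  have "2 * count_half r M B Y c \<noteq> card B" using assms(3) by (metis dvd_triv_left)
  then show ?thesis using count_half_antiperiodic[OF assms(1,2), of r Y c] by (auto simp: majority_def)
qed

lemma card_diff_le:
  assumes "finite A" "finite B"
  shows "card A \<le> card B + card (A - B)"
proof -
  have "card A \<le> card (B \<union> (A - B))" using assms by (intro card_mono) auto
  also have "\<dots> \<le> card B + card (A - B)" by (rule card_Un_le)
  finally show ?thesis .
qed

text \<open>Only the bad coordinates can vote otherwise than predicted by turning the half
  circle.\<close>

lemma count_half_move: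
  assumes "finite B" "r > 0" "M > 0"
    and inner: "\<And>i. i \<in> B \<Longrightarrow> w \<le> Y i mod r \<and> Y i mod r < r - w"
    and bad: "card {i\<in>B. \<not> (\<exists>t j. \<bar>t\<bar> \<le> w \<and> s i = e * r + t + j * (2 * M * r))} \<le> k"
  shows "\<bar>int (count_half r M B (translate (2 * M * r) B s Y) c) - int (count_half r M B Y (c - e))\<bar> \<le> int k"
proof -
  let ?bad = "{i\<in>B. \<not> (\<exists>t j. \<bar>t\<bar> \<le> w \<and> s i = e * r + t + j * (2 * M * r))}"
  let ?X = "{i\<in>B. in_half r M c (translate (2 * M * r) B s Y i)}" and ?Z = "{i\<in>B. in_half r M (c - e) (Y i)}"
  have eq: "in_half r M c (translate (2 * M * r) B s Y i) = in_half r M (c - e) (Y i)" if i: "i \<in> B" "i \<notin> ?bad" for i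
  proof -
    obtain t j where "\<bar>t\<bar> \<le> w" "s i = e * r + t + j * (2 * M * r)" using i by blast
    then show ?thesis using in_half_shift[OF assms(2,3), of w "Y i" t c e j] inner[OF i(1)] i(1)
      by (simp add: translate_def)
  qed
  have fin: "finite ?X" "finite ?Z" "finite ?bad" using assms(1) by auto
  have "?X - ?Z \<subseteq> ?bad" "?Z - ?X \<subseteq> ?bad" using eq by blast+
  then have "card (?X - ?Z) \<le> k" "card (?Z - ?X) \<le> k"
    using card_mono[OF fin(3)] bad by (meson le_trans)+
  then show ?thesis
    using card_diff_le[OF fin(1,2)] card_diff_le[OF fin(2,1)] unfolding count_half_def by linarith
qed

text \<open>Each of the \<open>2 * M\<close> arcs contributes two margins of width
  \<open>w\<close>.\<close>

lemma card_mod_edge: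
  fixes M r w :: int
  assumes "M > 0" "w > 0" "r \<ge> 2 * w"
  shows "int (card {x\<in>{0..<2 * M * r}. \<not> (w \<le> x mod r \<and> x mod r < r - w)}) \<le> 2 * M * (2 * w)"
proof -
  let ?E = "{x\<in>{0..<2 * M * r}. \<not> (w \<le> x mod r \<and> x mod r < r - w)}"
  have "?E \<subseteq> (\<lambda>(j, t). j * r + t) ` ({0..<2 * M} \<times> ({0..<w} \<union> {r - w..<r}))"
  proof
    fix x assume x: "x \<in> ?E"
    have r: "r > 0" using assms by simp
    have "0 \<le> x div r" using x r by (simp add: pos_imp_zdiv_nonneg_iff)
    moreover have "x div r < 2 * M"
    proof (rule ccontr)
      assume "\<not> x div r < 2 * M"
      then have "2 * M * r \<le> x div r * r" using r by (intro mult_right_mono) auto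
      also have "\<dots> \<le> x" using r by (metis add_0 add_le_cancel_left diff_add_cancel
            minus_mod_eq_div_mult pos_mod_sign le_add_same_cancel1)
      finally show False using x by simp
    qed
    moreover have "x mod r \<in> {0..<w} \<union> {r - w..<r}" using x r by auto
    ultimately show "x \<in> (\<lambda>(j, t). j * r + t) ` ({0..<2 * M} \<times> ({0..<w} \<union> {r - w..<r}))"
      by (intro image_eqI[where x = "(x div r, x mod r)"]) auto
  qed
  then have "card ?E \<le> card ((\<lambda>(j, t). j * r + t) ` ({0..<2 * M} \<times> ({0..<w} \<union> {r - w..<r})))"
    by (intro card_mono) auto
  also have "\<dots> \<le> card ({0..<2 * M} \<times> ({0..<w} \<union> {r - w..<r}))" by (intro card_image_le) auto
  also have "\<dots> \<le> nat (2 * M) * (nat w + nat w)"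
    unfolding card_cartesian_product using card_Un_le[of "{0..<w}" "{r - w..<r}"] by (intro mult_mono) auto
  finally have "int (card ?E) \<le> int (nat (2 * M) * (nat w + nat w))" by (rule of_nat_mono)
  then show ?thesis using assms by simp
qed

text \<open>Away from exceptional points, \<psi> is the position of the majority pattern in its
  cyclic orbit under shifts, which a rotation by one arc advances by one. The three terms of the
  bound account for a coordinate close to the end of an arc, for a vote that \<open>k\<close> voters
  could overturn, and for the last position of the cycle.\<close>

lemma block_map:
  fixes B :: "'a set" and w K :: int and a n k :: nat
  defines "M \<equiv> (2 ^ a :: int)"
  defines "r \<equiv> w * K"
  defines "q \<equiv> 2 * M * r"
  defines "\<Omega> \<equiv> B \<rightarrow>\<^sub>E {0..<q}"
  assumes B: "finite B" "card B = 2 * n + 1" and w: "w > 0" and K: "K \<ge> 2"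
  obtains \<psi> :: "('a \<Rightarrow> int) \<Rightarrow> nat option" where
    "real (card {Y\<in>\<Omega>. \<psi> Y = None}) \<le>
      (2 * real (card B) / of_int K + 2 * of_int M * (real (2 * k + 1) * (real (2 * n choose n) / 4 ^ n)) + 1 / (2 * of_int M))
      * real (card \<Omega>)"
    "\<And>Y s e j j'. Y \<in> \<Omega> \<Longrightarrow> e \<le> 1 \<Longrightarrow> \<psi> Y = Some j \<Longrightarrow> \<psi> (translate q B s Y) = Some j' \<Longrightarrow>
      card {i\<in>B. \<not> (\<exists>t z. \<bar>t\<bar> \<le> w \<and> s i = int e * r + t + z * q)} \<le> k \<Longrightarrow> j' = j + e"
proof -
  have M: "M > 0" by (simp add: M_def)
  have r: "r > 0" "r \<ge> 2 * w" using w K by (simp_all add: r_def mult.commute mult_left_mono)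
  have q: "q > 0" using M r by (simp add: q_def)
  have fin: "finite \<Omega>" using B(1) by (auto simp: \<Omega>_def intro: finite_PiE)
  have odd: "odd (card B)" using B(2) by simp
  obtain \<tau> :: "(int \<Rightarrow> bool) \<Rightarrow> nat" where
    \<tau>: "\<And>v. (\<And>c. v (c + 2 ^ a) = (\<not> v c)) \<Longrightarrow> \<tau> v < 2 ^ Suc a"
      "\<And>v. (\<And>c. v (c + 2 ^ a) = (\<not> v c)) \<Longrightarrow> \<tau> (\<lambda>c. v (c - 1)) = (\<tau> v + 1) mod 2 ^ Suc a"
    using orbit_position[of a] by blast
  define v where "v Y = majority r M B Y" for Y
  have anti: "v Y (c + 2 ^ a) = (\<not> v Y c)" for Y c
    using majority_antiperiodic[OF B(1) M odd] by (simp add: v_def M_def)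
  define edge where "edge Y \<longleftrightarrow> (\<exists>i\<in>B. Y i \<in> {x\<in>{0..<q}. \<not> (w \<le> x mod r \<and> x mod r < r - w)})" for Y
  define tie where "tie c Y \<longleftrightarrow> \<bar>2 * int (count_half r M B Y c) - int (card B)\<bar> \<le> 2 * int k" for c Y
  \<comment> \<open>Positions are defined modulo \<open>2 ^ Suc a\<close> only. Dropping the last
    one prevents wrapping around and makes the counter an honest natural number, as the later
    translations by multiples of the counter require.\<close>
  define wrap where "wrap Y \<longleftrightarrow> \<tau> (v Y) = 2 ^ Suc a - 1" for Y
  define \<psi> where "\<psi> Y = (if edge Y \<or> (\<exists>c\<in>{0..<2 * M}. tie c Y) \<or> wrap Y then None else Some (\<tau> (v Y)))" for Y
  have count_period: "count_half r M B Y (c mod (2 * M)) = count_half r M B Y c" for Y c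
  proof -
    have "in_half r M (c mod (2 * M)) x = in_half r M c x" for x
      unfolding in_half_def by (simp only: mod_diff_right_eq)
    then show ?thesis by (simp add: count_half_def)
  qed
  have no_tie: "\<not> tie c Y" if "\<psi> Y \<noteq> None" for c Y
  proof -
    have "\<not> tie (c mod (2 * M)) Y" using that M by (auto simp: \<psi>_def split: if_splits)
    then show ?thesis by (simp add: tie_def count_period)
  qed
  have edge_card: "real (card {Y\<in>\<Omega>. edge Y}) \<le> 2 * real (card B) / of_int K * real (card \<Omega>)"
  proof -
    let ?E = "{x\<in>{0..<q}. \<not> (w \<le> x mod r \<and> x mod r < r - w)}"
    have "card {Y\<in>\<Omega>. edge Y} * nat q \<le> card B * card ?E * card \<Omega>"
    proof -
      have "?E \<subseteq> {0..<q}" by auto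
      from card_PiE_exists_le[OF B(1) _ this] show ?thesis
        unfolding \<Omega>_def edge_def by (simp only: finite_atLeastLessThan_int card_atLeastLessThan_int diff_zero)
    qed
    then have "int (card {Y\<in>\<Omega>. edge Y} * nat q) \<le> int (card B * card ?E * card \<Omega>)" by (rule of_nat_mono)
    also have "\<dots> = int (card B) * int (card \<Omega>) * int (card ?E)" by simp
    also have "\<dots> \<le> int (card B) * int (card \<Omega>) * (2 * M * (2 * w))"
      using card_mod_edge[OF M w r(2)] unfolding q_def by (intro mult_left_mono) auto
    finally have "int (card {Y\<in>\<Omega>. edge Y}) * (2 * M * w * K) \<le> int (card B) * int (card \<Omega>) * 2 * (2 * M * w)"
      using q by (simp add: q_def r_def algebra_simps)
    then have "(2 * M * w) * (int (card {Y\<in>\<Omega>. edge Y}) * K) \<le> (2 * M * w) * (int (card B) * int (card \<Omega>) * 2)"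
      by (simp add: algebra_simps)
    then have "int (card {Y\<in>\<Omega>. edge Y}) * K \<le> int (card B) * int (card \<Omega>) * 2"
      by (rule mult_left_le_imp_le) (use M w in simp)
    then have "real_of_int (int (card {Y\<in>\<Omega>. edge Y}) * K) \<le> real_of_int (int (card B) * int (card \<Omega>) * 2)"
      by (simp only: of_int_le_iff)
    then show ?thesis using K by (simp add: field_simps)
  qed
  have tie_card: "real (card {Y\<in>\<Omega>. \<exists>c\<in>{0..<2 * M}. tie c Y})
    \<le> 2 * of_int M * (real (2 * k + 1) * (real (2 * n choose n) / 4 ^ n)) * real (card \<Omega>)"
  proof -
    have one: "real (card {Y\<in>\<Omega>. tie c Y}) \<le> real (2 * k + 1) * (real (2 * n choose n) / 4 ^ n) * real (card \<Omega>)" for c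
      unfolding tie_def \<Omega>_def count_half_def
      by (rule card_PiE_balanced[OF B]) (use card_in_half[OF r(1) M] in \<open>auto simp: q_def\<close>)
    have "{Y\<in>\<Omega>. \<exists>c\<in>{0..<2 * M}. tie c Y} = (\<Union>c\<in>{0..<2 * M}. {Y\<in>\<Omega>. tie c Y})" by blast
    then have "card {Y\<in>\<Omega>. \<exists>c\<in>{0..<2 * M}. tie c Y} \<le> (\<Sum>c\<in>{0..<2 * M}. card {Y\<in>\<Omega>. tie c Y})"
      using card_UN_le[of "{0..<2 * M}" "\<lambda>c. {Y\<in>\<Omega>. tie c Y}"] by simp
    then have "real (card {Y\<in>\<Omega>. \<exists>c\<in>{0..<2 * M}. tie c Y}) \<le> real (\<Sum>c\<in>{0..<2 * M}. card {Y\<in>\<Omega>. tie c Y})"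
      by (rule of_nat_mono)
    also have "\<dots> \<le> (\<Sum>c\<in>{0..<2 * M}. real (2 * k + 1) * (real (2 * n choose n) / 4 ^ n) * real (card \<Omega>))"
      unfolding of_nat_sum by (rule sum_mono) (rule one)
    finally show ?thesis using M by simp
  qed
  have wrap_card: "real (card {Y\<in>\<Omega>. wrap Y}) = 1 / (2 * of_int M) * real (card \<Omega>)"
  proof -
    define f where "f j = card {Y\<in>\<Omega>. \<tau> (v Y) = j}" for j
    \<comment> \<open>Rotating all coordinates by a full arc is a bijection of \<Omega> that
      advances every position by one; hence all positions are equally frequent.\<close>
    have step: "\<tau> (v (translate q B (\<lambda>_. r) Y)) = (\<tau> (v Y) + 1) mod 2 ^ Suc a" for Y
    proof -
      have "\<bar>int (count_half r M B (translate q B (\<lambda>_. r) Y) c) - int (count_half r M B Y (c - 1))\<bar> \<le> int 0" for c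
        unfolding q_def
      proof (rule count_half_move[OF B(1) r(1) M, where w = 0])
        have "\<exists>t j. \<bar>t\<bar> \<le> (0::int) \<and> r = 1 * r + t + j * (2 * M * r)" by (intro exI[of _ 0]) auto
        then show "card {i\<in>B. \<not> (\<exists>t j. \<bar>t\<bar> \<le> 0 \<and> r = 1 * r + t + j * (2 * M * r))} \<le> 0" by simp
      qed (use r in auto)
      then have "v (translate q B (\<lambda>_. r) Y) = (\<lambda>c. v Y (c - 1))" by (auto simp: v_def majority_def)
      then show ?thesis using \<tau>(2)[of "v Y"] anti by simp
    qed
    have mono: "f j = f (Suc j)" if "Suc j < 2 ^ Suc a" for j
    proof -
      have "\<tau> (v (translate q B (\<lambda>_. r) Y)) = Suc j \<longleftrightarrow> \<tau> (v Y) = j" for Y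
      proof (cases "\<tau> (v Y) + 1 < 2 ^ Suc a")
        case True
        then show ?thesis unfolding step by simp
      next
        case False
        then have "\<tau> (v Y) + 1 = 2 ^ Suc a" using \<tau>(1)[of "v Y"] anti by simp
        then show ?thesis unfolding step using that by simp
      qed
      then show ?thesis
        unfolding f_def \<Omega>_def using card_translate[OF q, of B "\<lambda>Y. \<tau> (v Y) = Suc j" "\<lambda>_. r"] by simp
    qed
    have const: "f j = f 0" if "j < 2 ^ Suc a" for j
      using that by (induction j) (use mono in \<open>auto simp: Suc_lessD\<close>)
    have "\<Omega> = (\<Union>j\<in>{..<2 ^ Suc a}. {Y\<in>\<Omega>. \<tau> (v Y) = j})" using \<tau>(1) anti by auto
    then have "card \<Omega> = card (\<Union>j\<in>{..<2 ^ Suc a}. {Y\<in>\<Omega>. \<tau> (v Y) = j})" by simp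
    also have "\<dots> = (\<Sum>j<2 ^ Suc a. f j)" unfolding f_def using fin by (intro card_UN_disjoint) auto
    also have "\<dots> = (\<Sum>j<(2::nat) ^ Suc a. f 0)" by (intro sum.cong const) auto
    also have "\<dots> = 2 ^ Suc a * card {Y\<in>\<Omega>. wrap Y}"
      unfolding wrap_def using const[of "2 ^ Suc a - 1"] by (simp add: f_def)
    finally show ?thesis by (simp add: M_def)
  qed
  show ?thesis
  proof
    have "{Y\<in>\<Omega>. \<psi> Y = None} \<subseteq> {Y\<in>\<Omega>. edge Y} \<union> {Y\<in>\<Omega>. \<exists>c\<in>{0..<2 * M}. tie c Y} \<union> {Y\<in>\<Omega>. wrap Y}"
      by (auto simp: \<psi>_def split: if_splits)
    then have "card {Y\<in>\<Omega>. \<psi> Y = None} \<le> card ({Y\<in>\<Omega>. edge Y} \<union> {Y\<in>\<Omega>. \<exists>c\<in>{0..<2 * M}. tie c Y} \<union> {Y\<in>\<Omega>. wrap Y})"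
      using fin by (intro card_mono) auto
    also have "\<dots> \<le> card {Y\<in>\<Omega>. edge Y} + card {Y\<in>\<Omega>. \<exists>c\<in>{0..<2 * M}. tie c Y} + card {Y\<in>\<Omega>. wrap Y}"
      using card_Un_le by (meson add_le_mono1 le_trans)
    finally have "real (card {Y\<in>\<Omega>. \<psi> Y = None}) \<le> real (card {Y\<in>\<Omega>. edge Y}) +
        real (card {Y\<in>\<Omega>. \<exists>c\<in>{0..<2 * M}. tie c Y}) + real (card {Y\<in>\<Omega>. wrap Y})" by linarith
    also have "\<dots> \<le> (2 * real (card B) / of_int K + 2 * of_int M * (real (2 * k + 1) * (real (2 * n choose n) / 4 ^ n)) + 1 / (2 * of_int M))
      * real (card \<Omega>)"
      unfolding distrib_right using edge_card tie_card wrap_card by linarith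
    finally show "real (card {Y\<in>\<Omega>. \<psi> Y = None}) \<le>
      (2 * real (card B) / of_int K + 2 * of_int M * (real (2 * k + 1) * (real (2 * n choose n) / 4 ^ n)) + 1 / (2 * of_int M))
      * real (card \<Omega>)" .
  next
    fix Y s and e j j' :: nat
    assume Y: "Y \<in> \<Omega>" and e: "e \<le> 1" and j: "\<psi> Y = Some j" and j': "\<psi> (translate q B s Y) = Some j'"
      and bad: "card {i\<in>B. \<not> (\<exists>t z. \<bar>t\<bar> \<le> w \<and> s i = int e * r + t + z * q)} \<le> k"
    have ne: "\<not> edge Y" "\<not> wrap Y" and jv: "j = \<tau> (v Y)" using j by (auto simp: \<psi>_def split: if_splits)
    have jv': "j' = \<tau> (v (translate q B s Y))" using j' by (auto simp: \<psi>_def split: if_splits)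
    have inner: "w \<le> Y i mod r \<and> Y i mod r < r - w" if "i \<in> B" for i
      using ne(1) Y that by (auto simp: edge_def \<Omega>_def PiE_iff)
    have "v (translate q B s Y) c = v Y (c - int e)" for c
    proof -
      have "\<bar>int (count_half r M B (translate q B s Y) c) - int (count_half r M B Y (c - int e))\<bar> \<le> int k"
        unfolding q_def by (rule count_half_move[OF B(1) r(1) M inner]) (use bad in \<open>simp_all add: q_def\<close>)
      \<comment> \<open>Without a near tie the two sides differ by more than \<open>2 * k\<close>
        votes, and moving \<open>k\<close> votes changes this difference by at most
        \<open>2 * k\<close>.\<close>
      moreover have "\<not> tie (c - int e) Y" using no_tie j by simp
      ultimately show ?thesis unfolding v_def majority_def tie_def by linarith
    qed
    then have veq: "v (translate q B s Y) = (\<lambda>c. v Y (c - int e))" by blast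
    show "j' = j + e"
    proof (cases "e = 0")
      case True
      then show ?thesis using jv jv' veq by simp
    next
      case False
      then have "e = 1" using e by simp
      then have "j' = (\<tau> (v Y) + 1) mod 2 ^ Suc a" using jv' veq \<tau>(2)[of "v Y"] anti by simp
      moreover have "\<tau> (v Y) + 1 < 2 ^ Suc a" using ne(2) \<tau>(1)[of "v Y"] anti by (fastforce simp: wrap_def)
      ultimately show ?thesis using jv \<open>e = 1\<close> by simp
    qed
  qed
qed

text \<open>The functions \<open>y Y\<close>, for \<open>Y\<in>\<Omega>\<close>, are partial counters on the integers: a shift by an element
  of \<open>F\<close> (perturbed by at most \<open>L\<close>) advances them by one, a shift by at most \<open>L\<close> leaves them fixed.\<close>

definition flip_block ::
  "(real \<Rightarrow> int) set \<Rightarrow> int \<Rightarrow> ((real \<Rightarrow> int) \<Rightarrow> int \<Rightarrow> nat option) \<Rightarrow> real \<Rightarrow> int \<Rightarrow> int set \<Rightarrow> bool" where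
  "flip_block \<Omega> q y p L F \<longleftrightarrow>
    q > 0 \<and> finite \<Omega> \<and> \<Omega> \<noteq> {} \<and> (\<forall>Y n. y Y (n + q) = y Y n) \<and>
    (\<forall>n. real (card {Y\<in>\<Omega>. y Y n = None}) \<le> p * real (card \<Omega>)) \<and>
    (\<forall>n j. card {Y\<in>\<Omega>. y Y n = Some j} = card {Y\<in>\<Omega>. y Y 0 = Some j}) \<and>
    (\<forall>Y\<in>\<Omega>. \<forall>n e j j'. \<bar>e\<bar> \<le> L \<longrightarrow> y Y n = Some j \<longrightarrow> y Y (n + e) = Some j' \<longrightarrow> j' = j) \<and>
    (\<forall>Y\<in>\<Omega>. \<forall>n f c j j'. f \<in> F \<longrightarrow> \<bar>c\<bar> \<le> L \<longrightarrow> y Y n = Some j \<longrightarrow> y Y (n + (f - c)) = Some j' \<longrightarrow> j' = Suc j)"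

text \<open>The order of choices matters. First \<open>M\<close>, \<open>n\<close> and
  \<open>K\<close> make the three losses at most \<open>p / 3\<close> each; they fix the size of
  \<open>B\<close> and the tolerance \<epsilon>, from which \<open>F\<close> arises. The margin
  \<open>w\<close>, and with it the modulus \<open>q\<close>, comes last, large compared with the
  elements of \<open>F\<close>, so that rounding \<open>B\<close> to multiples of
  \<open>1 / q\<close> does no harm.\<close>

lemma flip_block_exists:
  fixes S :: "int set" and Q m L :: int and d p :: real
  assumes S: "bohr_dense S" and Q: "Q > 0" and d: "d > 0" and p: "p > 0" and L: "L \<ge> 0"
  obtains F q \<Omega> y where "finite F" "F \<subseteq> S" "\<And>a. F \<inter> bohr_nbhd k a d m \<noteq> {}"
    "\<And>f. f \<in> F \<Longrightarrow> Q dvd f - m" "flip_block \<Omega> q y p L F"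
proof -
  obtain a where a: "(1 / 2) ^ a < p / 3" using real_arch_pow_inv[of "p / 3" "1 / 2"] p by auto
  define M where "M = (2 ^ a :: int)"
  have M: "M > 0" by (simp add: M_def)
  have Ma: "1 / (2 * of_int M) \<le> p / 3"
  proof -
    have "1 / (2 * of_int M) \<le> (1 / 2 :: real) ^ a" by (simp add: M_def field_simps)
    then show ?thesis using a by linarith
  qed
  have "0 < p / (3 * (2 * of_int M * real (2 * k + 1)))" using p M by simp
  with central_binomial_tendsto_0 obtain n
    where n: "real (2 * n choose n) / 4 ^ n < p / (3 * (2 * of_int M * real (2 * k + 1)))"
    by (metis (no_types, lifting) eventually_sequentially le_refl order_tendstoD(2))
  have Mn: "2 * of_int M * (real (2 * k + 1) * (real (2 * n choose n) / 4 ^ n)) \<le> p / 3"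
  proof -
    have "x * y \<le> p / 3" if "y < p / (3 * x)" "x > 0" for x y :: real
      using that by (simp add: field_simps)
    from this[OF n] show ?thesis using M by (simp add: mult.assoc)
  qed
  define K where "K = max 2 \<lceil>6 * real (2 * n + 1) / p\<rceil>"
  have K: "K \<ge> 2" by (simp add: K_def)
  have Kn: "2 * real (2 * n + 1) / of_int K \<le> p / 3"
  proof -
    have "6 * real (2 * n + 1) / p \<le> of_int K" unfolding K_def by linarith
    then show ?thesis using p K by (simp add: field_simps)
  qed
  \<comment> \<open>In units of \<open>1 / q\<close>, an error of \<epsilon> will be a quarter of
    the margin \<open>w\<close>.\<close>
  define \<epsilon> where "\<epsilon> = 1 / (8 * of_int M * of_int K :: real)"
  have \<epsilon>: "0 < \<epsilon>" using M K by (simp add: \<epsilon>_def)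
  \<comment> \<open>Elements of \<open>B\<close> below \<epsilon>' stay within \<epsilon> after
    multiplication by an integer up to \<open>L\<close>, so such shifts are mere
    perturbations.\<close>
  define \<epsilon>' where "\<epsilon>' = min 1 (\<epsilon> / (of_int L + 1))"
  have \<epsilon>': "0 < \<epsilon>'" "\<epsilon>' \<le> 1" "of_int L * \<epsilon>' \<le> \<epsilon>"
  proof -
    show "0 < \<epsilon>'" using \<epsilon> L by (simp add: \<epsilon>'_def)
    then have "of_int L * \<epsilon>' \<le> (of_int L + 1) * \<epsilon>'" by (simp add: algebra_simps)
    also have "\<dots> \<le> (of_int L + 1) * (\<epsilon> / (of_int L + 1))"
      using L by (intro mult_left_mono) (auto simp: \<epsilon>'_def)
    also have "\<dots> = \<epsilon>" using L by simp
    finally show "of_int L * \<epsilon>' \<le> \<epsilon>" .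
  qed (simp add: \<epsilon>'_def)
  obtain B :: "real set" where B: "finite B" "card B = 2 * n + 1" "B \<subseteq> {0<..<\<epsilon>'}"
    "rat_real.independent (insert 1 B)"
    using small_independent_reals[OF \<epsilon>'(1,2)] by blast
  have B1: "1 \<notin> B" using B(3) \<epsilon>'(2) by auto
  \<comment> \<open>The target \<open>1 / (2 * M)\<close> is the length of one arc as a fraction of
    the circle: under \<open>f\<close> all but \<open>k\<close> coordinates advance by about one
    arc.\<close>
  obtain F where F: "finite F" "F \<subseteq> S" "\<And>a. F \<inter> bohr_nbhd k a d m \<noteq> {}" "\<And>f. f \<in> F \<Longrightarrow> Q dvd f - m"
    "\<And>f. f \<in> F \<Longrightarrow> card {b\<in>B. \<not> near_int \<epsilon> (of_int f * b - 1 / (2 * of_int M))} \<le> k"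
    using finite_bohr_Hamming[OF S B(1,4) B1 Q d \<epsilon>, of k m "\<lambda>_. 1 / (2 * of_int M)"] by blast
  define G where "G = (\<Sum>f\<in>F. \<bar>f\<bar>)"
  have G: "G \<ge> 0" "\<And>f. f \<in> F \<Longrightarrow> \<bar>f\<bar> \<le> G"
    using F(1) by (auto simp: G_def intro: sum_nonneg member_le_sum)
  define w where "w = 4 * (L + 1 + G)"
  have w: "w > 0" "4 * L \<le> w" using L G(1) by (simp_all add: w_def)
  have "real_of_int (4 * L) \<le> real_of_int w" using w(2) by (simp only: of_int_le_iff)
  then have wL: "real_of_int L \<le> of_int w / 4" by simp
  have wf: "\<bar>real_of_int f\<bar> \<le> of_int w / 4" if "f \<in> F" for f
  proof -
    have "4 * \<bar>f\<bar> \<le> w" using L G(2)[OF that] by (simp add: w_def)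
    then have "real_of_int (4 * \<bar>f\<bar>) \<le> real_of_int w" by (simp only: of_int_le_iff)
    then show ?thesis by simp
  qed
  define r where "r = w * K"
  define q where "q = 2 * M * r"
  define \<Omega> where "\<Omega> = B \<rightarrow>\<^sub>E {0..<q}"
  have q: "q > 0" using M w(1) K by (simp add: q_def r_def)
  have q\<epsilon>: "of_int q * \<epsilon> = of_int w / 4" using M K by (simp add: q_def r_def \<epsilon>_def)
  have qM: "of_int q * (1 / (2 * of_int M)) = real_of_int r" using M by (simp add: q_def)
  \<comment> \<open>Rounding makes the orbits of the torus rotation periodic with period
    \<open>q\<close>.\<close>
  define s where "s i = \<lfloor>of_int q * i\<rfloor>" for i :: real
  have s_round: "\<bar>of_int (s i) - of_int q * i\<bar> \<le> 1" for i unfolding s_def by linarith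
  have small: "\<bar>real_of_int (e * s i)\<bar> \<le> of_int w / 2" if e: "\<bar>e\<bar> \<le> L" and i: "i \<in> B" for e i
  proof -
    have i0: "0 < i" "i < \<epsilon>'" using B(3) i by auto
    have "\<bar>real_of_int (s i)\<bar> \<le> of_int q * i + 1" using s_round[of i] i0 q by (smt (verit) mult_nonneg_nonneg of_int_0_le_iff)
    also have "\<dots> \<le> of_int q * \<epsilon>' + 1" using i0 q by simp
    finally have si: "\<bar>real_of_int (s i)\<bar> \<le> of_int q * \<epsilon>' + 1" .
    have "\<bar>real_of_int (e * s i)\<bar> = \<bar>real_of_int e\<bar> * \<bar>real_of_int (s i)\<bar>" by (simp add: abs_mult)
    also have "\<dots> \<le> of_int L * (of_int q * \<epsilon>' + 1)"
      using e si L by (intro mult_mono) auto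
    also have "\<dots> = of_int q * (of_int L * \<epsilon>') + of_int L" by (simp add: algebra_simps)
    also have "\<dots> \<le> of_int q * \<epsilon> + of_int L" using \<epsilon>'(3) q by simp
    also have "\<dots> \<le> of_int w / 2" using q\<epsilon> wL by linarith
    finally show ?thesis .
  qed
  obtain \<psi> :: "(real \<Rightarrow> int) \<Rightarrow> nat option" where
    \<psi>_card: "real (card {Y\<in>\<Omega>. \<psi> Y = None}) \<le>
      (2 * real (card B) / of_int K + 2 * of_int M * (real (2 * k + 1) * (real (2 * n choose n) / 4 ^ n)) + 1 / (2 * of_int M))
      * real (card \<Omega>)"
    and \<psi>: "\<And>Y s e j j'. Y \<in> \<Omega> \<Longrightarrow> e \<le> 1 \<Longrightarrow> \<psi> Y = Some j \<Longrightarrow> \<psi> (translate q B s Y) = Some j' \<Longrightarrow>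
      card {i\<in>B. \<not> (\<exists>t z. \<bar>t\<bar> \<le> w \<and> s i = int e * r + t + z * q)} \<le> k \<Longrightarrow> j' = j + e"
    apply (rule block_map[OF B(1,2) w(1) K, of a k, folded M_def, folded r_def, folded q_def, folded \<Omega>_def])
    subgoal premises prems by (rule prems(1)) (fact prems)+
    done
  define y where "y Y n = \<psi> (translate q B (\<lambda>i. n * s i) Y)" for Y n
  have y_add: "y Y (n + e) = \<psi> (translate q B (\<lambda>i. e * s i) (translate q B (\<lambda>i. n * s i) Y))" for Y n e
    by (simp add: y_def translate_translate algebra_simps)
  have in\<Omega>: "translate q B s Y \<in> \<Omega>" for s Y unfolding \<Omega>_def by (rule translate_in[OF q])
  have block: "flip_block \<Omega> q y p L F"
    unfolding flip_block_def
  proof (intro conjI allI ballI impI)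
    show "q > 0" by fact
    show "finite \<Omega>" using B(1) by (auto simp: \<Omega>_def intro: finite_PiE)
    show "\<Omega> \<noteq> {}" using q by (auto simp: \<Omega>_def PiE_eq_empty_iff)
    show "y Y (n + q) = y Y n" for Y n
      unfolding y_def by (rule arg_cong[where f = \<psi>], rule translate_cong) (simp add: distrib_right)
    have shift: "card {Y\<in>\<Omega>. y Y n = z} = card {Y\<in>\<Omega>. \<psi> Y = z}" for n z
      unfolding y_def \<Omega>_def by (rule card_translate[OF q])
    show "real (card {Y\<in>\<Omega>. y Y l = None}) \<le> p * real (card \<Omega>)" for l
    proof -
      have "real (card {Y\<in>\<Omega>. \<psi> Y = None}) \<le> p * real (card \<Omega>)"
      proof (rule order_trans[OF \<psi>_card], rule mult_right_mono)
        have "x + y + z \<le> p" if "x \<le> p / 3" "y \<le> p / 3" "z \<le> p / 3" for x y z :: real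
          using that by linarith
        from this[OF Kn Mn Ma]
        show "2 * real (card B) / of_int K + 2 * of_int M * (real (2 * k + 1) * (real (2 * n choose n) / 4 ^ n))
            + 1 / (2 * of_int M) \<le> p" by (simp only: B(2))
      qed simp
      then show ?thesis by (simp only: shift)
    qed
    show "card {Y\<in>\<Omega>. y Y n = Some j} = card {Y\<in>\<Omega>. y Y 0 = Some j}" for n j
      by (simp only: shift)
  next
    fix Y n e j j' assume "Y \<in> \<Omega>" and e: "\<bar>e\<bar> \<le> L" and j: "y Y n = Some j" "y Y (n + e) = Some j'"
    have "\<exists>t z. \<bar>t\<bar> \<le> w \<and> e * s i = int 0 * r + t + z * q" if "i \<in> B" for i
    proof (intro exI conjI)
      have "real_of_int \<bar>e * s i\<bar> \<le> of_int w" using small[OF e that] w(1) by simp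
      then show "\<bar>e * s i\<bar> \<le> w" by (simp only: of_int_le_iff)
      show "e * s i = int 0 * r + e * s i + 0 * q" by simp
    qed
    then have "{i\<in>B. \<not> (\<exists>t z. \<bar>t\<bar> \<le> w \<and> e * s i = int 0 * r + t + z * q)} = {}" by blast
    then have "card {i\<in>B. \<not> (\<exists>t z. \<bar>t\<bar> \<le> w \<and> e * s i = int 0 * r + t + z * q)} \<le> k"
      by (simp only: card.empty)
    from \<psi>[OF in\<Omega>, where e = 0, OF _ j(1)[unfolded y_def] j(2)[unfolded y_add] this]
    show "j' = j" by simp
  next
    fix Y n f c j j' assume "Y \<in> \<Omega>" and f: "f \<in> F" and c: "\<bar>c\<bar> \<le> L"
      and j: "y Y n = Some j" "y Y (n + (f - c)) = Some j'"
    have *: "\<exists>t z. \<bar>t\<bar> \<le> w \<and> (f - c) * s i = int 1 * r + t + z * q"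
      if i: "i \<in> B" and near: "near_int \<epsilon> (of_int f * i - 1 / (2 * of_int M))" for i
    proof -
      obtain z :: int where z: "\<bar>of_int f * i - 1 / (2 * of_int M) - of_int z\<bar> < \<epsilon>"
        using near unfolding near_int_def by blast
      define t where "t = (f - c) * s i - r - z * q"
      have "real_of_int t = of_int q * (of_int f * i - 1 / (2 * of_int M) - of_int z)
          + of_int f * (of_int (s i) - of_int q * i) - of_int (c * s i)"
        unfolding right_diff_distrib qM by (simp add: t_def algebra_simps)
      moreover have "\<bar>of_int q * (of_int f * i - 1 / (2 * of_int M) - of_int z)\<bar> \<le> of_int w / 4"
        unfolding abs_mult q\<epsilon>[symmetric] using z q by (intro mult_mono) auto
      moreover have "\<bar>of_int f * (of_int (s i) - of_int q * i)\<bar> \<le> of_int w / 4 * 1"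
        unfolding abs_mult using wf[OF f] s_round[of i] w(1) by (intro mult_mono) auto
      moreover have "\<bar>real_of_int (c * s i)\<bar> \<le> of_int w / 2" by (rule small[OF c i])
      ultimately have "real_of_int \<bar>t\<bar> \<le> of_int w" by linarith
      then have "\<bar>t\<bar> \<le> w" by (simp only: of_int_le_iff)
      moreover have "(f - c) * s i = int 1 * r + t + z * q" by (simp add: t_def)
      ultimately show ?thesis by blast
    qed
    then have "{i\<in>B. \<not> (\<exists>t z. \<bar>t\<bar> \<le> w \<and> (f - c) * s i = int 1 * r + t + z * q)}
        \<subseteq> {b\<in>B. \<not> near_int \<epsilon> (of_int f * b - 1 / (2 * of_int M))}" by blast
    then have "card {i\<in>B. \<not> (\<exists>t z. \<bar>t\<bar> \<le> w \<and> (f - c) * s i = int 1 * r + t + z * q)}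
        \<le> card {b\<in>B. \<not> near_int \<epsilon> (of_int f * b - 1 / (2 * of_int M))}"
      using B(1) by (intro card_mono) auto
    then have "card {i\<in>B. \<not> (\<exists>t z. \<bar>t\<bar> \<le> w \<and> (f - c) * s i = int 1 * r + t + z * q)} \<le> k"
      using F(5)[OF f] by linarith
    from \<psi>[OF in\<Omega>, where e = 1, OF _ j(1)[unfolded y_def] j(2)[unfolded y_add] this]
    show "j' = Suc j" by simp
  qed
  show ?thesis by (rule that) (fact F block)+
qed

section \<open>Periodic sets and measure preserving systems\<close>

lemma periodic_add_mult:
  fixes f :: "int \<Rightarrow> 'a"
  assumes "\<And>n. f (n + Q) = f n"
  shows "f (n + j * Q) = f n"
proof (induction j rule: int_induct[where k = 0])
  case (step1 i)
  then show ?case using assms[of "n + i * Q"] by (simp add: algebra_simps)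
next
  case (step2 i)
  then show ?case using assms[of "n + (i - 1) * Q"] by (simp add: algebra_simps)
qed simp

lemma periodic_mod:
  fixes f :: "int \<Rightarrow> 'a"
  assumes "\<And>n. f (n + Q) = f n"
  shows "f (n mod Q) = f n"
proof -
  have "f (n mod Q + (n div Q) * Q) = f (n mod Q)" by (rule periodic_add_mult[of f Q, OF assms])
  then show ?thesis by simp
qed

lemma card_periodic_window:
  fixes Q a :: int
  assumes P: "\<And>n. P (n + Q) = P n" and "Q > 0"
  shows "card {n\<in>{a..<a + Q}. P n} = card {n\<in>{0..<Q}. P n}"
proof -
  have "bij_betw (\<lambda>n. n mod Q) {n\<in>{a..<a + Q}. P n} {n\<in>{0..<Q}. P n}"
  proof (rule bij_betw_byWitness[where f' = "\<lambda>n. a + (n - a) mod Q"])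
    have "a + (n mod Q - a) mod Q = n" if "n \<in> {a..<a + Q}" for n
      using that by (simp add: mod_simps)
    then show "\<forall>n\<in>{n\<in>{a..<a + Q}. P n}. a + (n mod Q - a) mod Q = n" by blast
    have "(a + (n - a) mod Q) mod Q = n" if "n \<in> {0..<Q}" for n
      using that by (simp add: mod_simps)
    then show "\<forall>n\<in>{n\<in>{0..<Q}. P n}. (a + (n - a) mod Q) mod Q = n" by blast
    show "(\<lambda>n. n mod Q) ` {n\<in>{a..<a + Q}. P n} \<subseteq> {n\<in>{0..<Q}. P n}"
      using assms(2) periodic_mod[of P Q, OF P] by auto
    have "P (a + (n - a) mod Q) = P n" for n
      using periodic_mod[of "\<lambda>n. P (a + n)" Q "n - a"] P by (simp add: add.assoc[symmetric])
    then show "(\<lambda>n. a + (n - a) mod Q) ` {n\<in>{0..<Q}. P n} \<subseteq> {n\<in>{a..<a + Q}. P n}"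
      using assms(2) by auto
  qed
  then show ?thesis by (rule bij_betw_same_card)
qed

lemma card_periodic_shift:
  fixes Q s :: int
  assumes P: "\<And>n. P (n + Q) = P n" and "Q > 0"
  shows "card {n\<in>{0..<Q}. P (n + s)} = card {n\<in>{0..<Q}. P n}"
proof -
  have "bij_betw (\<lambda>n. n + s) {n\<in>{0..<Q}. P (n + s)} {n\<in>{s..<s + Q}. P n}"
    by (rule bij_betw_byWitness[where f' = "\<lambda>n. n - s"]) auto
  then show ?thesis using card_periodic_window[of P Q, OF assms, of s] by (simp add: bij_betw_same_card)
qed

lemma finite_int_filter: "finite {n\<in>{a..<b::int}. P n}"
  by (rule finite_subset[of _ "{a..<b}"]) auto

lemma card_periodic_multiple:
  fixes Q :: int
  assumes P: "\<And>n. P (n + Q) = P n" and "Q > 0"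
  shows "card {n\<in>{0..<int t * Q}. P n} = t * card {n\<in>{0..<Q}. P n}"
proof (induction t)
  case (Suc t)
  define b where "b = int t * Q"
  have b: "0 \<le> b" "int (Suc t) * Q = b + Q" using assms(2) by (simp_all add: b_def algebra_simps)
  have "{n\<in>{0..<int (Suc t) * Q}. P n} = {n\<in>{0..<b}. P n} \<union> {n\<in>{b..<b + Q}. P n}"
    unfolding b(2) using assms(2) b(1) by auto
  then have "card {n\<in>{0..<int (Suc t) * Q}. P n} = card ({n\<in>{0..<b}. P n} \<union> {n\<in>{b..<b + Q}. P n})"
    by (simp only:)
  also have "\<dots> = card {n\<in>{0..<b}. P n} + card {n\<in>{b..<b + Q}. P n}"
    by (intro card_Un_disjoint finite_int_filter) auto
  finally show ?case using Suc card_periodic_window[of P Q, OF assms, of b] by (simp add: b_def)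
qed simp

section \<open>Word frequencies and one-sided cylinders\<close>

definition occurs_at :: "int set \<Rightarrow> bool list \<Rightarrow> int \<Rightarrow> bool" where
  "occurs_at D w t \<longleftrightarrow> (\<forall>i<length w. (t + int i \<in> D) = w ! i)"

definition frequency :: "int \<Rightarrow> int set \<Rightarrow> bool list \<Rightarrow> real" where
  "frequency Q D w = real (card {t\<in>{0..<Q}. occurs_at D w t}) / of_int Q"

lemma frequency_Nil: "Q > 0 \<Longrightarrow> frequency Q D [] = 1"
proof -
  assume "Q > 0"
  moreover have "{t\<in>{0..<Q}. occurs_at D [] t} = {0..<Q}" by (auto simp: occurs_at_def)
  ultimately show ?thesis by (simp add: frequency_def)
qed

lemma frequency_range: "Q > 0 \<Longrightarrow> frequency Q D w \<in> {0..1}"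
proof -
  assume "Q > 0"
  have "card {t\<in>{0..<Q}. occurs_at D w t} \<le> card {0..<Q}" by (intro card_mono) auto
  then show ?thesis using \<open>Q > 0\<close> by (simp add: frequency_def)
qed

lemma frequency_append:
  "frequency Q D w = frequency Q D (w @ [False]) + frequency Q D (w @ [True])"
proof -
  have eq: "occurs_at D (w @ [b]) t \<longleftrightarrow> occurs_at D w t \<and> (t + int (length w) \<in> D) = b" for b t
    by (auto simp: occurs_at_def nth_append less_Suc_eq)
  have "{t\<in>{0..<Q}. occurs_at D w t} = {t\<in>{0..<Q}. occurs_at D (w @ [False]) t} \<union> {t\<in>{0..<Q}. occurs_at D (w @ [True]) t}"
    by (auto simp: eq)
  then have "card {t\<in>{0..<Q}. occurs_at D w t} = card {t\<in>{0..<Q}. occurs_at D (w @ [False]) t} + card {t\<in>{0..<Q}. occurs_at D (w @ [True]) t}"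
    by (simp only:) (intro card_Un_disjoint finite_int_filter, auto simp: eq)
  then show ?thesis by (simp add: frequency_def add_divide_distrib)
qed

text \<open>The starting point moves by one, which periodicity makes harmless. In the limit this
  identity becomes shift invariance, while \<open>frequency_append\<close> becomes
  consistency.\<close>

lemma frequency_Cons:
  assumes D: "\<And>n. n + Q \<in> D \<longleftrightarrow> n \<in> D" and Q: "Q > 0"
  shows "frequency Q D w = frequency Q D (False # w) + frequency Q D (True # w)"
proof -
  have eq: "occurs_at D (b # w) t \<longleftrightarrow> (t \<in> D) = b \<and> occurs_at D w (t + 1)" for b t
    by (simp add: occurs_at_def All_less_Suc2 algebra_simps)
  have "occurs_at D w (t + Q) = occurs_at D w t" for t
  proof -
    have "t + Q + int i \<in> D \<longleftrightarrow> t + int i \<in> D" for i using D[of "t + int i"] by (simp add: add_ac)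
    then show ?thesis by (simp add: occurs_at_def)
  qed
  then have "card {t\<in>{0..<Q}. occurs_at D w t} = card {t\<in>{0..<Q}. occurs_at D w (t + 1)}"
    using card_periodic_shift[of "occurs_at D w" Q 1] Q by simp
  also have "{t\<in>{0..<Q}. occurs_at D w (t + 1)} = {t\<in>{0..<Q}. occurs_at D (False # w) t} \<union> {t\<in>{0..<Q}. occurs_at D (True # w) t}"
    by (auto simp: eq)
  also have "card \<dots> = card {t\<in>{0..<Q}. occurs_at D (False # w) t} + card {t\<in>{0..<Q}. occurs_at D (True # w) t}"
    by (intro card_Un_disjoint finite_int_filter) (auto simp: eq)
  finally show ?thesis by (simp add: frequency_def add_divide_distrib)
qed

text \<open>Countability of the index type makes the cube metrizable, so that compactness provides a
  convergent subsequence.\<close>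

lemma seq_compact_cube:
  fixes f :: "nat \<Rightarrow> 'a::countable \<Rightarrow> real"
  assumes "\<And>t w. f t w \<in> {0..1}"
  obtains p r where "strict_mono r" "\<And>w. (\<lambda>t. f (r t) w) \<longlonglongrightarrow> p w" "\<And>w. 0 \<le> p w"
proof -
  define K where "K = PiE (UNIV :: 'a set) (\<lambda>_. {0..1::real})"
  have "compactin (product_topology (\<lambda>_. euclidean) (UNIV :: 'a set)) K"
    unfolding K_def compactin_PiE by simp
  then have "compact K" by (simp add: euclidean_product_topology)
  moreover have "f t \<in> K" for t using assms by (simp add: K_def PiE_UNIV_domain Pi_iff)
  ultimately obtain p r where pr: "strict_mono r" "(f \<circ> r) \<longlonglongrightarrow> p"
    unfolding compact_def by metis
  have lim: "(\<lambda>t. f (r t) w) \<longlonglongrightarrow> p w" for w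
  proof -
    have "continuous_on UNIV (\<lambda>x :: 'a \<Rightarrow> real. x w)" by (rule continuous_on_product_coordinates)
    then have "isCont (\<lambda>x :: 'a \<Rightarrow> real. x w) p" by (rule continuous_on_interior) simp
    from isCont_tendsto_compose[OF this pr(2)] show ?thesis by (simp add: o_def)
  qed
  have "0 \<le> p w" for w
    by (rule LIMSEQ_le_const[OF lim]) (use assms in auto)
  then show ?thesis using that pr(1) lim by blast
qed

definition cylinder :: "bool list \<Rightarrow> (int \<Rightarrow> bool) set" where
  "cylinder w = {\<omega>. \<forall>i<length w. \<omega> (int i) = w ! i}"

text \<open>Points are two-sided sequences, which makes the shift bijective, but only nonnegative
  coordinates are measurable. This suffices, as the inverse of the transformation need not be
  measurable.\<close>

definition cylinder_algebra :: "(int \<Rightarrow> bool) measure" where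
  "cylinder_algebra = sigma UNIV (range cylinder)"

lemma cylinder_sets: "cylinder w \<in> sets cylinder_algebra"
  by (simp add: cylinder_algebra_def)

lemma space_cylinder_algebra: "space cylinder_algebra = UNIV"
  by (simp add: cylinder_algebra_def)

lemma cylinder_disjoint: "length v = length w \<Longrightarrow> v \<noteq> w \<Longrightarrow> cylinder v \<inter> cylinder w = {}"
  by (auto simp: cylinder_def list_eq_iff_nth_eq)

lemma coordinates_eq_cylinders:
  assumes "\<And>\<omega> \<omega>'. (\<And>i. i < n \<Longrightarrow> \<omega> (int i) = \<omega>' (int i)) \<Longrightarrow> P \<omega> = P \<omega>'"
  shows "{\<omega>. P \<omega>} = (\<Union>w\<in>{w. length w = n \<and> cylinder w \<subseteq> {\<omega>. P \<omega>}}. cylinder w)"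
proof (intro equalityI subsetI)
  fix \<omega> assume \<omega>: "\<omega> \<in> {\<omega>. P \<omega>}"
  define w where "w = map (\<lambda>i. \<omega> (int i)) [0..<n]"
  have "P \<omega>'" if "\<omega>' \<in> cylinder w" for \<omega>'
    using assms[of \<omega>' \<omega>] that \<omega> by (auto simp: cylinder_def w_def)
  moreover have "\<omega> \<in> cylinder w" by (simp add: cylinder_def w_def)
  moreover have "length w = n" by (simp add: w_def)
  ultimately show "\<omega> \<in> (\<Union>w\<in>{w. length w = n \<and> cylinder w \<subseteq> {\<omega>. P \<omega>}}. cylinder w)" by blast
qed auto

lemma finite_bool_lists: "finite {w :: bool list. length w = n \<and> P w}"
  by (rule finite_subset[OF _ finite_lists_length_eq[of "UNIV :: bool set" n]]) auto

text \<open>Two cylinders are nested or disjoint, according to whether the shorter word is a prefix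
  of the longer; the empty set is added for the latter case.\<close>

lemma Int_stable_cylinders: "Int_stable (insert {} (range cylinder))"
proof -
  have sub: "cylinder v \<inter> cylinder w \<in> insert {} (range cylinder)" if le: "length v \<le> length w" for v w
  proof (cases "v = take (length v) w")
    case True
    have "cylinder w \<subseteq> cylinder v"
    proof
      fix \<omega> assume \<omega>: "\<omega> \<in> cylinder w"
      have "\<omega> (int i) = v ! i" if i: "i < length v" for i
      proof -
        have "v ! i = take (length v) w ! i" using True by simp
        also have "\<dots> = w ! i" using i by simp
        finally show ?thesis using \<omega> i le by (simp add: cylinder_def)
      qed
      then show "\<omega> \<in> cylinder v" by (simp add: cylinder_def)
    qed
    then show ?thesis by (simp add: Int_absorb1)
  next
    case False
    then obtain i where i: "i < length v" "v ! i \<noteq> w ! i"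
      using le by (auto simp: list_eq_iff_nth_eq min_absorb2)
    then have "cylinder v \<inter> cylinder w = {}" using le by (fastforce simp: cylinder_def)
    then show ?thesis by simp
  qed
  then have "cylinder v \<inter> cylinder w \<in> insert {} (range cylinder)" for v w
    by (metis inf_commute linear)
  then show ?thesis by (auto simp: Int_stable_def)
qed

text \<open>A consistent family of word frequencies is realized on \<open>[0, 1)\<close>: each word
  gets an interval of the right length, the intervals of the one-letter extensions of a word
  partitioning the interval of the word from left to right.\<close>

lemma process_of_frequencies:
  fixes p :: "bool list \<Rightarrow> real"
  assumes nonneg: "\<And>w. 0 \<le> p w" and Nil: "p [] = 1"
    and app: "\<And>w. p w = p (w @ [False]) + p (w @ [True])"
  obtains N where "prob_space N" "sets N = sets cylinder_algebra" "\<And>w. measure N (cylinder w) = p w"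
proof -
  \<comment> \<open>The left end of the interval of \<open>w\<close>: at each letter
    \<open>True\<close> the interval of the sibling ending in \<open>False\<close> is
    skipped.\<close>
  define lo where "lo w = (\<Sum>i<length w. if w ! i then p (take i w @ [False]) else 0)" for w
  have lo_app: "lo (w @ [b]) = lo w + (if b then p (w @ [False]) else 0)" for w b
    by (auto simp: lo_def nth_append intro!: sum.cong)
  define word where "word x = rec_nat [] (\<lambda>_ w. w @ [lo w + p (w @ [False]) \<le> x])" for x :: real
  have word_0: "word x 0 = []" and word_Suc: "word x (Suc n) = word x n @ [lo (word x n) + p (word x n @ [False]) \<le> x]" for x n
    by (simp_all add: word_def)
  have len: "length (word x n) = n" for x n by (induction n) (simp_all add: word_0 word_Suc)
  have nth: "word x n ! i = word x (Suc i) ! i" if "i < n" for x n i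
    using that
  proof (induction n)
    case (Suc n)
    then show ?case by (cases "i = n") (auto simp: word_Suc[of x n] nth_append len less_Suc_eq)
  qed simp
  have interval: "{x\<in>{0..<1}. word x (length w) = w} = {lo w..<lo w + p w}" for w
  proof (induction w rule: rev_induct)
    case Nil
    show ?case by (auto simp: word_0 lo_def assms(2))
  next
    case (snoc b w)
    have "{x\<in>{0..<1}. word x (length (w @ [b])) = w @ [b]}
        = {x\<in>{0..<1}. word x (length w) = w} \<inter> {x. (lo w + p (w @ [False]) \<le> x) = b}"
      by (auto simp: word_Suc)
    also have "\<dots> = {lo (w @ [b])..<lo (w @ [b]) + p (w @ [b])}"
      unfolding snoc lo_app using app[of w] nonneg[of "w @ [False]"] nonneg[of "w @ [True]"]
      by (cases b) auto
    finally show ?case .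
  qed
  \<comment> \<open>Since \<open>nat\<close> sends negative integers to zero, negative coordinates
    repeat the letter at zero; cylinders do not see them.\<close>
  define \<Phi> where "\<Phi> x = (\<lambda>k. word x (Suc (nat k)) ! nat k)" for x
  have vim: "\<Phi> -` cylinder w = {x. word x (length w) = w}" for w
  proof (intro set_eqI)
    fix x
    have "word x (length w) = w \<longleftrightarrow> (\<forall>i<length w. word x (length w) ! i = w ! i)"
      by (simp add: list_eq_iff_nth_eq len)
    also have "\<dots> \<longleftrightarrow> (\<forall>i<length w. word x (Suc i) ! i = w ! i)" using nth[of _ "length w" x] by simp
    finally show "x \<in> \<Phi> -` cylinder w \<longleftrightarrow> x \<in> {x. word x (length w) = w}"
      by (simp add: cylinder_def \<Phi>_def)
  qed
  have borel: "{x. word x (length w) = w} \<in> sets borel" for w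
  proof (induction w rule: rev_induct)
    case (snoc b w)
    have "{x. word x (length (w @ [b])) = w @ [b]}
        = {x. word x (length w) = w} \<inter> (if b then {lo w + p (w @ [False])..} else {..<lo w + p (w @ [False])})"
      by (auto simp: word_Suc)
    also have "\<dots> \<in> sets borel" using snoc by auto
    finally show ?case .
  qed (simp add: word_0)
  define U where "U = uniform_measure lborel {0..<1::real}"
  have U: "prob_space U" unfolding U_def by (rule prob_space_uniform_measure) auto
  have \<Phi>: "\<Phi> \<in> U \<rightarrow>\<^sub>M cylinder_algebra"
    unfolding cylinder_algebra_def by (rule measurable_measure_of) (auto simp: U_def vim borel)
  define N where "N = distr U cylinder_algebra \<Phi>"
  show ?thesis
  proof
    show "prob_space N" unfolding N_def by (rule prob_space.prob_space_distr[OF U \<Phi>])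
    show "sets N = sets cylinder_algebra" by (simp add: N_def)
    fix w
    have "measure N (cylinder w) = measure U {x. word x (length w) = w}"
      unfolding N_def using \<Phi> cylinder_sets by (simp add: measure_distr vim U_def)
    also have "\<dots> = measure lborel ({0..<1} \<inter> {x. word x (length w) = w})"
      unfolding U_def using borel by (subst measure_uniform_measure) auto
    also have "{0..<1} \<inter> {x. word x (length w) = w} = {lo w..<lo w + p w}"
      using interval[of w] by (simp only: Int_def mem_Collect_eq)
    finally show "measure N (cylinder w) = p w" using nonneg[of w] by simp
  qed
qed

text \<open>A form of Furstenberg's correspondence principle. Sets avoiding larger and larger finite
  parts of \<open>R\<close> have word frequencies converging along a subsequence, and the limits
  define a shift-invariant measure. Two visits at a distance in \<open>R\<close> form a null event
  in the limit, and discarding these events leaves a nonrecurrent set.\<close>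

lemma not_measurable_recurrence_if_periodic:
  fixes R :: "int set" and \<kappa> :: real
  assumes \<kappa>: "\<kappa> > 0"
    and ex: "\<And>R0. finite R0 \<Longrightarrow> R0 \<subseteq> R \<Longrightarrow> \<exists>Q D. Q > 0 \<and> (\<forall>n. n + Q \<in> D \<longleftrightarrow> n \<in> D) \<and>
      \<kappa> * of_int Q \<le> real (card {n\<in>{0..<Q}. n \<in> D}) \<and> (\<forall>e\<in>R0. \<forall>n\<in>D. n + e \<notin> D)"
  shows "\<not> measurable_recurrence R"
proof -
  define good where "good t Q D \<longleftrightarrow> Q > 0 \<and> (\<forall>n. n + Q \<in> D \<longleftrightarrow> n \<in> D) \<and>
      \<kappa> * of_int Q \<le> real (card {n\<in>{0..<Q}. n \<in> D}) \<and> (\<forall>e\<in>R \<inter> {- int t..int t}. \<forall>n\<in>D. n + e \<notin> D)"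
    for t :: nat and Q :: int and D
  have "\<exists>Q D. good t Q D" for t
    unfolding good_def by (rule ex) auto
  then obtain Q D where good: "\<And>t. good t (Q t) (D t)" by metis
  have Q: "Q t > 0" and D: "n + Q t \<in> D t \<longleftrightarrow> n \<in> D t"
    and dens: "\<kappa> * of_int (Q t) \<le> real (card {n\<in>{0..<Q t}. n \<in> D t})" for t n
    using good[of t] unfolding good_def by blast+
  have avoid: "n + e \<notin> D t" if "e \<in> R" "\<bar>e\<bar> \<le> int t" "n \<in> D t" for t e n
  proof -
    have "e \<in> R \<inter> {- int t..int t}" using that by auto
    then show ?thesis using good[of t] that(3) unfolding good_def by blast
  qed
  obtain p r where r: "strict_mono r" and lim: "\<And>w. (\<lambda>t. frequency (Q (r t)) (D (r t)) w) \<longlonglongrightarrow> p w"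
    and nonneg: "\<And>w. 0 \<le> p w"
    apply (rule seq_compact_cube[of "\<lambda>t. frequency (Q t) (D t)", OF frequency_range[OF Q]])
    subgoal premises prems by (rule prems(1)) (fact prems)+
    done
  have Nil: "p [] = 1"
    by (rule LIMSEQ_unique[OF lim]) (simp add: frequency_Nil Q)
  have app: "p w = p (w @ [False]) + p (w @ [True])" for w
  proof (rule LIMSEQ_unique[OF lim])
    show "(\<lambda>t. frequency (Q (r t)) (D (r t)) w) \<longlonglongrightarrow> p (w @ [False]) + p (w @ [True])"
      unfolding frequency_append[of _ _ w] by (intro tendsto_add lim)
  qed
  have Cons: "p w = p (False # w) + p (True # w)" for w
  proof (rule LIMSEQ_unique[OF lim])
    show "(\<lambda>t. frequency (Q (r t)) (D (r t)) w) \<longlonglongrightarrow> p (False # w) + p (True # w)"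
      unfolding frequency_Cons[OF D Q, of _ w] by (intro tendsto_add lim)
  qed
  have pos: "\<kappa> \<le> p [True]"
  proof (rule LIMSEQ_le_const[OF lim])
    have "\<kappa> \<le> frequency (Q t) (D t) [True]" for t
      using dens[of t] Q[of t] by (simp add: frequency_def occurs_at_def field_simps)
    then show "\<exists>N. \<forall>n\<ge>N. \<kappa> \<le> frequency (Q (r n)) (D (r n)) [True]" by blast
  qed
  \<comment> \<open>Avoiding \<open>e\<close> and avoiding \<open>- e\<close> are the same condition
    on a set, so the distance \<open>k\<close> covers both signs. From index \<open>k\<close> on,
    the subsequence excludes \<open>e\<close> because \<open>t \<le> r t\<close>.\<close>
  have null: "p w = 0" if e: "e \<in> R" and k: "k = nat \<bar>e\<bar>" and w: "length w = Suc k" "w ! 0" "w ! k" for e k w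
  proof (rule LIMSEQ_unique[OF lim])
    have "frequency (Q (r t)) (D (r t)) w = 0" if t: "t \<ge> k" for t
    proof -
      have "t \<le> r t" using r by (simp add: seq_suble)
      then have rt: "\<bar>e\<bar> \<le> int (r t)" using t k by linarith
      have "\<not> occurs_at (D (r t)) w n" for n
      proof
        assume occ: "occurs_at (D (r t)) w n"
        have "n \<in> D (r t)" "n + int k \<in> D (r t)"
          using occ[unfolded occurs_at_def, rule_format, of 0] occ[unfolded occurs_at_def, rule_format, of k] w by auto
        then show False
          using avoid[OF e rt, of n] avoid[OF e rt, of "n + int k"] k by (cases "e \<ge> 0") auto
      qed
      then show ?thesis by (simp add: frequency_def)
    qed
    then show "(\<lambda>t. frequency (Q (r t)) (D (r t)) w) \<longlonglongrightarrow> 0"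
      by (intro tendsto_eventually eventually_sequentiallyI[of k]) auto
  qed
  obtain N where N: "prob_space N" and setsN: "sets N = sets cylinder_algebra"
    and meas: "\<And>w. measure N (cylinder w) = p w"
    using process_of_frequencies[OF nonneg Nil app] by metis
  interpret prob_space N by (rule N)
  have spN: "space N = UNIV" using sets_eq_imp_space_eq[OF setsN] by (simp add: space_cylinder_algebra)
  define \<sigma> where "\<sigma> \<omega> = (\<lambda>n. \<omega> (n + 1))" for \<omega> :: "int \<Rightarrow> bool"
  have \<sigma>_cyl: "\<sigma> -` cylinder w = cylinder (False # w) \<union> cylinder (True # w)" for w
  proof (intro set_eqI)
    fix \<omega>
    have "\<omega> \<in> cylinder (b # w) \<longleftrightarrow> \<omega> 0 = b \<and> (\<forall>i<length w. \<omega> (int i + 1) = w ! i)" for b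
      by (auto simp: cylinder_def less_Suc_eq_0_disj add.commute)
    then show "\<omega> \<in> \<sigma> -` cylinder w \<longleftrightarrow> \<omega> \<in> cylinder (False # w) \<union> cylinder (True # w)"
      by (auto simp: cylinder_def \<sigma>_def)
  qed
  have \<sigma>m: "\<sigma> \<in> N \<rightarrow>\<^sub>M N"
  proof (rule measurable_sigma_sets[where A = "range cylinder" and \<Omega> = UNIV])
    show "sets N = sigma_sets UNIV (range cylinder)" using setsN by (simp add: cylinder_algebra_def)
    fix A assume "A \<in> range cylinder"
    then obtain w where "A = cylinder w" by auto
    then show "\<sigma> -` A \<inter> space N \<in> sets N" using cylinder_sets by (simp add: \<sigma>_cyl spN setsN)
  qed auto
  \<comment> \<open>The cylinders with the empty set generate the sigma-algebra and are closed under
    intersection, so measures need comparing only there, where \<open>Cons\<close> gives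
    equality.\<close>
  have "distr N N \<sigma> = N"
  proof (rule measure_eqI_generator_eq[OF Int_stable_cylinders, where \<Omega> = UNIV and A = "\<lambda>_. UNIV"])
    have "sigma_sets UNIV (insert {} (range cylinder)) = sigma_sets UNIV (range cylinder)"
      by (intro sigma_sets_eqI) (auto intro: sigma_sets.Empty)
    then show "sets (distr N N \<sigma>) = sigma_sets UNIV (insert {} (range cylinder))"
      "sets N = sigma_sets UNIV (insert {} (range cylinder))"
      by (simp_all add: setsN cylinder_algebra_def)
    have "cylinder [] = UNIV" by (simp add: cylinder_def)
    then show "range (\<lambda>_::nat. UNIV) \<subseteq> insert {} (range cylinder)" by (metis image_subsetI insertCI rangeI)
    fix A :: "(int \<Rightarrow> bool) set" assume "A \<in> insert {} (range cylinder)"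
    then consider "A = {}" | w where "A = cylinder w" by auto
    then show "emeasure (distr N N \<sigma>) A = emeasure N A"
    proof cases
      case 2
      have "emeasure (distr N N \<sigma>) A = emeasure N (cylinder (False # w) \<union> cylinder (True # w))"
        using \<sigma>m 2 cylinder_sets by (simp add: emeasure_distr spN setsN \<sigma>_cyl)
      also have "\<dots> = ennreal (measure N (cylinder (False # w)) + measure N (cylinder (True # w)))"
        using cylinder_sets cylinder_disjoint[of "False # w" "True # w"]
        by (simp add: emeasure_eq_measure finite_measure_Union setsN)
      also have "\<dots> = emeasure N A" using Cons[of w] 2 by (simp add: meas emeasure_eq_measure)
      finally show ?thesis .
    qed simp
  next
    show "emeasure (distr N N \<sigma>) UNIV \<noteq> \<infinity>" for i :: nat
    proof -
      interpret distr: prob_space "distr N N \<sigma>" by (rule prob_space_distr[OF \<sigma>m])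
      show ?thesis by (simp add: distr.emeasure_finite)
    qed
  qed auto
  then have inv: "measure N (\<sigma> -` A \<inter> space N) = measure N A" if "A \<in> sets N" for A
    using measure_distr[OF \<sigma>m that] by simp
  have bij\<sigma>: "bij \<sigma>"
    by (rule o_bij[where g = "\<lambda>\<omega> n. \<omega> (n - 1)"]) (auto simp: \<sigma>_def fun_eq_iff)
  have sys: "measure_preserving_system N \<sigma>"
    unfolding measure_preserving_system_def using bij\<sigma> inv \<sigma>m N measurable_sets[OF \<sigma>m] by (simp add: spN)
  define Z where "Z e = {\<omega> :: int \<Rightarrow> bool. \<omega> 0 \<and> \<omega> \<bar>e\<bar>}" for e
  have Z: "Z e \<in> null_sets N" if e: "e \<in> R" for e
  proof -
    define k where "k = nat \<bar>e\<bar>"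
    have "Z e = {\<omega>. \<omega> (int 0) \<and> \<omega> (int k)}" by (simp add: Z_def k_def)
    also have "\<dots> = (\<Union>w\<in>{w. length w = Suc k \<and> cylinder w \<subseteq> {\<omega>. \<omega> (int 0) \<and> \<omega> (int k)}}. cylinder w)"
      by (rule coordinates_eq_cylinders) (metis lessI zero_less_Suc)
    also have "\<dots> \<in> null_sets N"
    proof (rule null_sets_UN')
      show "countable {w. length w = Suc k \<and> cylinder w \<subseteq> {\<omega>. \<omega> (int 0) \<and> \<omega> (int k)}}"
        by (rule countable_finite[OF finite_bool_lists])
      fix w assume w: "w \<in> {w. length w = Suc k \<and> cylinder w \<subseteq> {\<omega>. \<omega> (int 0) \<and> \<omega> (int k)}}"
      have "(\<lambda>n. w ! nat n) \<in> cylinder w" by (simp add: cylinder_def)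
      then have "w ! 0" "w ! k" using w by auto
      then have "p w = 0" using null[OF e k_def] w by simp
      then show "cylinder w \<in> null_sets N"
        using cylinder_sets by (simp add: null_sets_def setsN emeasure_eq_measure meas)
    qed
    finally show ?thesis .
  qed
  \<comment> \<open>Recurrence asks for nonempty rather than non-null intersections, so the
    countably many null events are removed from the set itself.\<close>
  define A where "A = cylinder [True] - (\<Union>e\<in>R. Z e)"
  have ZR: "(\<Union>e\<in>R. Z e) \<in> null_sets N" by (rule null_sets_UN') (use Z in auto)
  have cT: "cylinder [True] \<in> sets N" using cylinder_sets setsN by simp
  have AN: "A \<in> sets N" unfolding A_def using cT ZR by auto
  have "measure N A = p [True]" unfolding A_def using measure_Diff_null_set[OF cT ZR] meas by simp
  then have posA: "measure N A > 0" using pos \<kappa> by simp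
  have A_iff: "\<omega> 0 \<and> (\<forall>e\<in>R. \<not> \<omega> \<bar>e\<bar>)" if "\<omega> \<in> A" for \<omega>
    using that by (auto simp: A_def Z_def cylinder_def)
  have iter: "int_iterate UNIV \<sigma> j \<omega> i = \<omega> (i + j)" for j \<omega> i
  proof -
    have 1: "(\<sigma> ^^ l) \<omega> i = \<omega> (i + int l)" for l i
      by (induction l arbitrary: i) (auto simp: \<sigma>_def algebra_simps)
    have "inv \<sigma> = (\<lambda>\<omega> n. \<omega> (n - 1))" by (rule inv_equality) (auto simp: \<sigma>_def)
    then have 2: "(inv \<sigma> ^^ l) \<omega> i = \<omega> (i - int l)" for l i
      by (induction l arbitrary: i) (auto simp: algebra_simps)
    show ?thesis by (simp add: int_iterate_def 1 2)
  qed
  have "A \<inter> int_iterate UNIV \<sigma> n ` A = {}" if n: "n \<in> R" for n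
  proof (rule ccontr)
    assume "A \<inter> int_iterate UNIV \<sigma> n ` A \<noteq> {}"
    then obtain \<omega> where \<omega>: "\<omega> \<in> A" "int_iterate UNIV \<sigma> n \<omega> \<in> A" by auto
    show False
    \<comment> \<open>Membership in \<open>A\<close> controls nonnegative coordinates only. For
      negative \<open>n\<close> the coordinate \<open>- n\<close> of the shifted sequence is
      therefore used; it is the coordinate zero of \<omega>.\<close>
    proof (cases "n \<ge> 0")
      case True
      then show ?thesis using A_iff[OF \<omega>(1)] A_iff[OF \<omega>(2)] iter[of n \<omega> 0] n by auto
    next
      case False
      then show ?thesis using A_iff[OF \<omega>(1)] A_iff[OF \<omega>(2)] iter[of n \<omega> "- n"] n by auto
    qed
  qed
  then have "\<not> recurrent_for N \<sigma> R"
    unfolding recurrent_for_def spN using AN posA by blast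
  then show ?thesis unfolding measurable_recurrence_def using sys by blast
qed

section \<open>Extending the witnesses\<close>

text \<open>Signs are used instead of a set because a new difference is excluded by making the sign
  change along it; zero marks the positions given up.\<close>

definition flips :: "int \<Rightarrow> (int \<Rightarrow> int) \<Rightarrow> int set \<Rightarrow> bool" where
  "flips Q h E \<longleftrightarrow> Q > 0 \<and> (\<forall>n. h n \<in> {-1, 0, 1}) \<and> (\<forall>n. h (n + Q) = h n) \<and>
    (\<forall>e\<in>E. \<forall>n. h n * h (n + e) \<noteq> 1)"

definition support_count :: "int \<Rightarrow> (int \<Rightarrow> int) \<Rightarrow> nat" where
  "support_count Q h = card {n\<in>{0..<Q}. h n \<noteq> 0}"

text \<open>The step \<open>l\<close> will be \<open>m - c\<close>, congruent to every shift
  \<open>f - c\<close> modulo the period of \<open>h\<close>.\<close>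

definition blended :: "((real \<Rightarrow> int) \<Rightarrow> int \<Rightarrow> nat option) \<Rightarrow> (int \<Rightarrow> int) \<Rightarrow> int \<Rightarrow> (real \<Rightarrow> int) \<Rightarrow> int \<Rightarrow> int" where
  "blended y h l Y n = (case y Y n of None \<Rightarrow> 0 | Some j \<Rightarrow> (-1) ^ j * h (n - int j * l))"

text \<open>For \<open>e\<close> in \<open>E\<close> the counter stands still and the property of
  \<open>h\<close> is inherited. For \<open>f - c\<close> the counter advances by one; the
  additional translation by \<open>m - c\<close> matches the shift modulo \<open>Q\<close>, so the
  two values are opposite and their product is not positive.\<close>

lemma flips_blended:
  assumes h: "flips Q h E" and block: "flip_block \<Omega> q y p L F" and Y: "Y \<in> \<Omega>"
    and E: "\<And>e. e \<in> E \<Longrightarrow> \<bar>e\<bar> \<le> L" and F: "\<And>f. f \<in> F \<Longrightarrow> Q dvd f - m" and c: "\<bar>c\<bar> \<le> L"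
    and Q': "Q dvd Q'" "q dvd Q'" "Q' > 0"
  shows "flips Q' (blended y h (m - c) Y) (E \<union> (\<lambda>f. f - c) ` F)"
proof -
  define l where "l = m - c"
  have h_range: "h n \<in> {-1, 0, 1}" and h_per: "h (n + Q) = h n" for n
    using h by (auto simp: flips_def)
  have h_flip: "h n * h (n + e) \<noteq> 1" if "e \<in> E" for e n using h that by (auto simp: flips_def)
  have y_per: "y Y (n + q) = y Y n" for n using block by (auto simp: flip_block_def)
  have y_stay: "j' = j" if "\<bar>e\<bar> \<le> L" "y Y n = Some j" "y Y (n + e) = Some j'" for e n j j'
    using block that Y unfolding flip_block_def by blast
  have y_step: "j' = Suc j" if "f \<in> F" "y Y n = Some j" "y Y (n + (f - c)) = Some j'" for f n j j'
    using block that Y c unfolding flip_block_def by blast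
  have h_per': "h (n + s) = h n" if "Q dvd s" for n s
    using periodic_add_mult[of h Q, OF h_per] that by (metis dvd_def mult.commute)
  have y_per': "y Y (n + Q') = y Y n" for n
    using periodic_add_mult[of "y Y" q, OF y_per] Q'(2) by (metis dvd_def mult.commute)
  have sq: "x * x \<in> {0, 1}" if "x \<in> {-1, 0, 1}" for x :: int using that by auto
  show ?thesis
    unfolding flips_def l_def[symmetric]
  proof (intro conjI allI ballI)
    show "Q' > 0" by fact
    have pm: "(-1) ^ j * x \<in> {-1, 0, 1}" if "x \<in> {-1, 0, 1 :: int}" for j :: nat and x :: int
      using that by (cases "even j") auto
    show "blended y h l Y n \<in> {-1, 0, 1}" for n
      using pm[OF h_range] by (simp add: blended_def split: option.split)
    show "blended y h l Y (n + Q') = blended y h l Y n" for n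
    proof -
      have "h (n + Q' - int j * l) = h (n - int j * l)" for j
        using h_per'[OF Q'(1), of "n - int j * l"] by (simp add: algebra_simps)
      then show ?thesis by (simp add: blended_def y_per' split: option.split)
    qed
    fix e n assume e: "e \<in> E \<union> (\<lambda>f. f - c) ` F"
    show "blended y h l Y n * blended y h l Y (n + e) \<noteq> 1"
    proof (cases "y Y n = None \<or> y Y (n + e) = None")
      case True
      then show ?thesis by (auto simp: blended_def)
    next
      case False
      then obtain j j' where j: "y Y n = Some j" "y Y (n + e) = Some j'" by auto
      consider "e \<in> E" | f where "f \<in> F" "e = f - c" using e by blast
      then show ?thesis
      proof cases
        case 1
        then have "j' = j" using y_stay[OF E[OF 1] j] by simp
        then have "blended y h l Y n * blended y h l Y (n + e) = ((-1) ^ j * (-1) ^ j) * (h (n - int j * l) * h (n + e - int j * l))"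
          by (simp add: blended_def j)
        also have "(-1 :: int) ^ j * (-1) ^ j = 1" by (simp add: power_mult_distrib[symmetric])
        also have "n + e - int j * l = (n - int j * l) + e" by simp
        finally show ?thesis using h_flip[OF 1, of "n - int j * l"] by simp
      next
        case 2
        then have "j' = Suc j" using y_step[of f n j j'] j by simp
        then have "blended y h l Y n * blended y h l Y (n + e)
            = - ((-1) ^ j * (-1) ^ j) * (h (n - int j * l) * h (n + e - int (Suc j) * l))"
          by (simp add: blended_def j)
        also have "(-1 :: int) ^ j * (-1) ^ j = 1" by (simp add: power_mult_distrib[symmetric])
        also have "n + e - int (Suc j) * l = (n - int j * l) + (f - m)"
          by (simp add: 2 l_def algebra_simps)
        also have "h \<dots> = h (n - int j * l)" using h_per' F 2(1) by blast
        finally show ?thesis using sq[OF h_range[of "n - int j * l"]] by auto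
      qed
    qed
  qed
qed

text \<open>The distribution of the counter over \<Omega> is the same at every \<open>n\<close>, so
  it may be read off at zero.\<close>

lemma card_blended:
  assumes "flip_block \<Omega> q y p L F"
  shows "card {Y\<in>\<Omega>. blended y h l Y n \<noteq> 0}
    = (\<Sum>j\<in>(\<lambda>Y. the (y Y 0)) ` {Y\<in>\<Omega>. y Y 0 \<noteq> None}. if h (n - int j * l) \<noteq> 0 then card {Y\<in>\<Omega>. y Y 0 = Some j} else 0)"
proof -
  have fin: "finite \<Omega>" and shift: "card {Y\<in>\<Omega>. y Y n = Some j} = card {Y\<in>\<Omega>. y Y 0 = Some j}" for j
    using assms by (auto simp: flip_block_def)
  define J where "J = (\<lambda>Y. the (y Y 0)) ` {Y\<in>\<Omega>. y Y 0 \<noteq> None}"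
  have finJ: "finite J" using fin by (simp add: J_def)
  have J: "j \<in> J" if "Y \<in> \<Omega>" "y Y n = Some j" for Y j
  proof -
    have "{Y\<in>\<Omega>. y Y n = Some j} \<noteq> {}" using that by auto
    then have "card {Y\<in>\<Omega>. y Y 0 = Some j} \<noteq> 0" using fin shift[of j] by (metis (no_types, lifting) card_0_eq finite_Collect_conjI finite_Collect_subsets finite_subset mem_Collect_eq subsetI)
    then have "{Y\<in>\<Omega>. y Y 0 = Some j} \<noteq> {}" by (metis card.empty)
    then obtain Z where "Z \<in> \<Omega>" "y Z 0 = Some j" by auto
    then show ?thesis unfolding J_def by (intro image_eqI[of _ _ Z]) auto
  qed
  have "{Y\<in>\<Omega>. blended y h l Y n \<noteq> 0} = (\<Union>j\<in>{j\<in>J. h (n - int j * l) \<noteq> 0}. {Y\<in>\<Omega>. y Y n = Some j})"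
    using J by (auto simp: blended_def split: option.splits)
  then have "card {Y\<in>\<Omega>. blended y h l Y n \<noteq> 0} = (\<Sum>j\<in>{j\<in>J. h (n - int j * l) \<noteq> 0}. card {Y\<in>\<Omega>. y Y n = Some j})"
    using fin finJ by (simp only:) (rule card_UN_disjoint, auto)
  also have "\<dots> = (\<Sum>j\<in>J. if h (n - int j * l) \<noteq> 0 then card {Y\<in>\<Omega>. y Y n = Some j} else 0)"
    using finJ by (rule sum.inter_filter)
  finally show ?thesis by (simp only: shift J_def)
qed

text \<open>Double counting of pairs of a point of \<Omega> and a position: for each counter value,
  a translate of \<open>h\<close> has as many nonzero values per period as \<open>h\<close>, so the
  only loss comes from undefined counters.\<close>

lemma sum_card_blended:
  assumes block: "flip_block \<Omega> q y p L F" and h_per: "\<And>n. h (n + Q) = h n" and Q: "Q > 0" "Q' = int t * Q"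
  shows "(\<Sum>Y\<in>\<Omega>. support_count Q' (blended y h l Y)) = card {Y\<in>\<Omega>. y Y 0 \<noteq> None} * (t * support_count Q h)"
proof -
  have fin: "finite \<Omega>" using block by (auto simp: flip_block_def)
  define J where "J = (\<lambda>Y. the (y Y 0)) ` {Y\<in>\<Omega>. y Y 0 \<noteq> None}"
  have finJ: "finite J" using fin by (simp add: J_def)
  have sup: "support_count Q' g = (\<Sum>n\<in>{0..<Q'}. if g n \<noteq> 0 then 1 else 0)" for g :: "int \<Rightarrow> int"
    unfolding support_count_def by (simp add: sum.inter_filter[symmetric])
  have shift: "(\<Sum>n\<in>{0..<Q'}. if h (n - int j * l) \<noteq> 0 then x else 0) = x * (t * support_count Q h)" for j and x :: nat
  proof -
    have per: "(h (n + int t * Q) \<noteq> 0) = (h n \<noteq> 0)" for n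
      using periodic_add_mult[of h Q n "int t", OF h_per] by simp
    have "(\<Sum>n\<in>{0..<Q'}. if h (n - int j * l) \<noteq> 0 then x else 0) = x * card {n\<in>{0..<Q'}. h (n + (- (int j * l))) \<noteq> 0}"
      by (simp add: sum.inter_filter[symmetric])
    also have "card {n\<in>{0..<Q'}. h (n + (- (int j * l))) \<noteq> 0} = card {n\<in>{0..<Q'}. h n \<noteq> 0}"
    proof (cases "t = 0")
      case False
      then have "int t * Q > 0" using Q(1) by simp
      from card_periodic_shift[of "\<lambda>n. h n \<noteq> 0" "int t * Q", OF per this] show ?thesis by (simp only: Q(2))
    qed (simp add: Q(2))
    also have "\<dots> = t * support_count Q h"
      unfolding Q(2) support_count_def by (rule card_periodic_multiple) (simp_all add: h_per Q(1))
    finally show ?thesis .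
  qed
  have "(\<Sum>Y\<in>\<Omega>. support_count Q' (blended y h l Y)) = (\<Sum>n\<in>{0..<Q'}. \<Sum>Y\<in>\<Omega>. if blended y h l Y n \<noteq> 0 then 1 else 0)"
    unfolding sup by (rule sum.swap)
  also have "\<dots> = (\<Sum>n\<in>{0..<Q'}. card {Y\<in>\<Omega>. blended y h l Y n \<noteq> 0})"
    using fin by (simp add: sum.inter_filter[symmetric])
  also have "\<dots> = (\<Sum>j\<in>J. \<Sum>n\<in>{0..<Q'}. if h (n - int j * l) \<noteq> 0 then card {Y\<in>\<Omega>. y Y 0 = Some j} else 0)"
    unfolding card_blended[OF block] J_def by (rule sum.swap)
  also have "\<dots> = (\<Sum>j\<in>J. card {Y\<in>\<Omega>. y Y 0 = Some j}) * (t * support_count Q h)"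
    unfolding shift sum_distrib_right ..
  also have "(\<Sum>j\<in>J. card {Y\<in>\<Omega>. y Y 0 = Some j}) = card (\<Union>j\<in>J. {Y\<in>\<Omega>. y Y 0 = Some j})"
    using fin finJ by (intro card_UN_disjoint[symmetric]) auto
  also have "(\<Union>j\<in>J. {Y\<in>\<Omega>. y Y 0 = Some j}) = {Y\<in>\<Omega>. y Y 0 \<noteq> None}"
    by (force simp: J_def)
  finally show ?thesis .
qed

text \<open>Averaging over \<Omega>: some \<open>Y\<close> attains at least the average density of
  the functions \<open>blended y h (m - c) Y\<close>.\<close>

lemma flips_extend:
  assumes h: "flips Q h E" and block: "flip_block \<Omega> q y p L F"
    and E: "\<And>e. e \<in> E \<Longrightarrow> \<bar>e\<bar> \<le> L" and F: "\<And>f. f \<in> F \<Longrightarrow> Q dvd f - m" and c: "\<bar>c\<bar> \<le> L"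
    and Q': "Q dvd Q'" "q dvd Q'" "Q' > 0"
  shows "\<exists>h'. flips Q' h' (E \<union> (\<lambda>f. f - c) ` F) \<and>
    (1 - p) * real (support_count Q h) / of_int Q \<le> real (support_count Q' h') / of_int Q'"
proof -
  have Q: "Q > 0" and h_per: "\<And>n. h (n + Q) = h n" using h by (auto simp: flips_def)
  have fin: "finite \<Omega>" "\<Omega> \<noteq> {}" and none: "real (card {Y\<in>\<Omega>. y Y 0 = None}) \<le> p * real (card \<Omega>)"
    using block by (auto simp: flip_block_def)
  obtain z where z: "Q' = Q * z" using Q'(1) by (auto simp: dvd_def)
  have "z > 0" using z Q'(3) Q by (simp add: zero_less_mult_iff)
  then have t: "Q' = int (nat z) * Q" using z by simp
  have "card \<Omega> = card ({Y\<in>\<Omega>. y Y 0 = None} \<union> {Y\<in>\<Omega>. y Y 0 \<noteq> None})" by (rule arg_cong[where f = card]) auto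
  also have "\<dots> = card {Y\<in>\<Omega>. y Y 0 = None} + card {Y\<in>\<Omega>. y Y 0 \<noteq> None}" using fin by (intro card_Un_disjoint) auto
  finally have some: "(1 - p) * real (card \<Omega>) \<le> real (card {Y\<in>\<Omega>. y Y 0 \<noteq> None})"
    using none by (simp add: algebra_simps)
  define D where "D = (1 - p) * (real (nat z) * real (support_count Q h))"
  have "\<exists>Y\<in>\<Omega>. D \<le> real (support_count Q' (blended y h (m - c) Y))"
  proof (rule ccontr)
    assume "\<not> ?thesis"
    then have "(\<Sum>Y\<in>\<Omega>. real (support_count Q' (blended y h (m - c) Y))) < (\<Sum>Y\<in>\<Omega>. D)"
      using fin by (intro sum_strict_mono) auto
    also have "\<dots> = ((1 - p) * real (card \<Omega>)) * (real (nat z) * real (support_count Q h))" by (simp add: D_def)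
    also have "\<dots> \<le> real (card {Y\<in>\<Omega>. y Y 0 \<noteq> None}) * (real (nat z) * real (support_count Q h))"
      by (rule mult_right_mono[OF some]) simp
    also have "\<dots> = real (\<Sum>Y\<in>\<Omega>. support_count Q' (blended y h (m - c) Y))"
      using sum_card_blended[where h = h and Q = Q and l = "m - c", OF block h_per Q t] by simp
    finally show False by simp
  qed
  then obtain Y where Y: "Y \<in> \<Omega>" "D \<le> real (support_count Q' (blended y h (m - c) Y))" by blast
  have "(1 - p) * real (support_count Q h) / of_int Q = D / of_int Q'"
    using \<open>z > 0\<close> Q by (simp add: D_def z field_simps)
  also have "\<dots> \<le> real (support_count Q' (blended y h (m - c) Y)) / of_int Q'"
    using Y(2) Q'(3) by (intro divide_right_mono) auto
  finally show ?thesis using flips_blended[OF h block Y(1) E F c Q'] by blast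
qed

text \<open>The quantifiers are arranged so that one \<open>F\<close> serves all witnesses
  \<open>h\<close> and all translations \<open>c\<close> up to \<open>L\<close>; the set under
  construction must not depend on the translate.\<close>

lemma stage_exists:
  fixes S :: "int set" and Q m L :: int and d p :: real
  assumes "bohr_dense S" "Q > 0" "d > 0" "p > 0" "L \<ge> 0"
  shows "\<exists>F q. finite F \<and> F \<subseteq> S \<and> (\<forall>a. F \<inter> bohr_nbhd k a d m \<noteq> {}) \<and> q > 0 \<and>
    (\<forall>h E c Q'. flips Q h E \<longrightarrow> (\<forall>e\<in>E. \<bar>e\<bar> \<le> L) \<longrightarrow> \<bar>c\<bar> \<le> L \<longrightarrow> Q dvd Q' \<longrightarrow> q dvd Q' \<longrightarrow> Q' > 0 \<longrightarrow>
      (\<exists>h'. flips Q' h' (E \<union> (\<lambda>f. f - c) ` F) \<and>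
        (1 - p) * real (support_count Q h) / of_int Q \<le> real (support_count Q' h') / of_int Q'))"
proof -
  obtain F q \<Omega> y where F: "finite F" "F \<subseteq> S" "\<And>a. F \<inter> bohr_nbhd k a d m \<noteq> {}"
    "\<And>f. f \<in> F \<Longrightarrow> Q dvd f - m" and block: "flip_block \<Omega> q y p L F"
    apply (rule flip_block_exists[OF assms, of k m])
    subgoal premises prems by (rule prems(1)) (fact prems)+
    done
  have "q > 0" using block by (simp add: flip_block_def)
  then show ?thesis
    using F flips_extend[OF _ block _ F(4)] by (intro exI[of _ F] exI[of _ q] conjI allI impI) auto
qed

section \<open>The construction in infinitely many stages\<close>

lemma bohr_nbhd_mono: "k \<le> l \<Longrightarrow> e \<le> d \<Longrightarrow> bohr_nbhd l a e m \<subseteq> bohr_nbhd k a d m"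
  unfolding bohr_nbhd_def by (auto intro: near_int_mono[of e])

text \<open>One of the two signs occupies at least half of the support, and its level set is the
  periodic set sought.\<close>

lemma not_measurable_recurrence_if_flips:
  fixes \<kappa> :: real
  assumes "\<kappa> > 0" and ex: "\<And>R0. finite R0 \<Longrightarrow> R0 \<subseteq> R \<Longrightarrow> \<exists>Q h. flips Q h R0 \<and> \<kappa> \<le> real (support_count Q h) / of_int Q"
  shows "\<not> measurable_recurrence R"
proof (rule not_measurable_recurrence_if_periodic[where \<kappa> = "\<kappa> / 2"])
  fix R0 assume "finite R0" "R0 \<subseteq> R"
  then obtain Q h where h: "flips Q h R0" and \<kappa>: "\<kappa> \<le> real (support_count Q h) / of_int Q" using ex by metis
  have Q: "Q > 0" using h by (simp add: flips_def)
  have "support_count Q h \<le> card ({n\<in>{0..<Q}. h n = 1} \<union> {n\<in>{0..<Q}. h n = -1})"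
    unfolding support_count_def
    by (intro card_mono finite_UnI finite_int_filter) (use h in \<open>auto simp: flips_def\<close>)
  also have "\<dots> \<le> card {n\<in>{0..<Q}. h n = 1} + card {n\<in>{0..<Q}. h n = -1}" by (rule card_Un_le)
  finally have "real (support_count Q h) \<le> real (card {n\<in>{0..<Q}. h n = 1}) + real (card {n\<in>{0..<Q}. h n = -1})"
    by linarith
  moreover have "\<kappa> * of_int Q \<le> real (support_count Q h)" using \<kappa> Q by (simp add: field_simps)
  ultimately consider "\<kappa> / 2 * of_int Q \<le> real (card {n\<in>{0..<Q}. h n = 1})"
    | "\<kappa> / 2 * of_int Q \<le> real (card {n\<in>{0..<Q}. h n = -1})" by linarith
  then have "\<exists>s::int. \<kappa> / 2 * of_int Q \<le> real (card {n\<in>{0..<Q}. h n = s}) \<and> s * s = 1"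
  proof cases
    case 1
    then show ?thesis by (intro exI[of _ 1] conjI) simp_all
  next
    case 2
    then show ?thesis by (intro exI[of _ "-1"] conjI) simp_all
  qed
  then obtain s :: int where s: "\<kappa> / 2 * of_int Q \<le> real (card {n\<in>{0..<Q}. h n = s})" "s * s = 1"
    by blast
  show "\<exists>Q D. Q > 0 \<and> (\<forall>n. n + Q \<in> D \<longleftrightarrow> n \<in> D) \<and>
      \<kappa> / 2 * of_int Q \<le> real (card {n\<in>{0..<Q}. n \<in> D}) \<and> (\<forall>e\<in>R0. \<forall>n\<in>D. n + e \<notin> D)"
  proof (intro exI[of _ Q] exI[of _ "{n. h n = s}"] conjI Q allI ballI)
    show "n + Q \<in> {n. h n = s} \<longleftrightarrow> n \<in> {n. h n = s}" for n using h by (simp add: flips_def)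
    show "\<kappa> / 2 * of_int Q \<le> real (card {n\<in>{0..<Q}. n \<in> {n. h n = s}})" using s(1) by simp
    show "n + e \<notin> {n. h n = s}" if "e \<in> R0" "n \<in> {n. h n = s}" for e n
    proof
      assume "n + e \<in> {n. h n = s}"
      then have "h n * h (n + e) = 1" using that(2) s(2) by simp
      then show False using h that(1) by (auto simp: flips_def)
    qed
  qed
qed (use assms(1) in simp)

theorem corollary1p4:
  fixes S :: "int set"
  assumes "bohr_dense S"
  shows "\<exists>S'. S' \<subseteq> S \<and> bohr_dense S' \<and>
           (\<forall>m::int. \<not> measurable_recurrence ((\<lambda>s. s - m) ` S' - {0}))"
proof -
  \<comment> \<open>Through the pairing every integer is the target of infinitely many stages, with
    ever more characters and smaller radii.\<close>
  define target where "target j = int_decode (fst (prod_decode j))" for j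
  define good where "good j Q L F q \<longleftrightarrow> finite F \<and> F \<subseteq> S \<and>
    (\<forall>a. F \<inter> bohr_nbhd j a (1 / (real j + 1)) (target j) \<noteq> {}) \<and> q > 0 \<and>
    (\<forall>h E c Q'. flips Q h E \<longrightarrow> (\<forall>e\<in>E. \<bar>e\<bar> \<le> L) \<longrightarrow> \<bar>c\<bar> \<le> L \<longrightarrow> Q dvd Q' \<longrightarrow> q dvd Q' \<longrightarrow> Q' > 0 \<longrightarrow>
      (\<exists>h'. flips Q' h' (E \<union> (\<lambda>f. f - c) ` F) \<and>
        (1 - 1 / 2 ^ (j + 2)) * real (support_count Q h) / of_int Q \<le> real (support_count Q' h') / of_int Q'))"
    for j :: nat and Q L :: int and F and q :: int
  have ex: "\<exists>X. good j Q L (fst X) (snd X)" if "Q > 0" "L \<ge> 0" for j Q L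
  proof -
    have "\<exists>F q. good j Q L F q"
      unfolding good_def by (rule stage_exists[OF assms that(1) _ _ that(2)]) auto
    then show ?thesis by auto
  qed
  define next_F where "next_F j Q L = fst (SOME X. good j Q L (fst X) (snd X))" for j Q L
  define next_q where "next_q j Q L = snd (SOME X. good j Q L (fst X) (snd X))" for j Q L
  \<comment> \<open>\<open>L j\<close> comes to bound \<open>\<bar>f\<bar> + j\<close> for all
    \<open>f\<close> of earlier stages, hence the differences \<open>f - c\<close> as soon as
    \<open>\<bar>c\<bar> \<le> j\<close>.\<close>
  define next_L where "next_L j Q L = L + 2 + int j + (\<Sum>f\<in>next_F j Q L. \<bar>f\<bar>)" for j Q L
  \<comment> \<open>The factor \<open>next_q\<close> makes the new period an admissible multiple;
    the factor \<open>next_L + 1\<close> keeps the period above \<open>L\<close>, as the initial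
    witness for each translate requires.\<close>
  define state where "state = rec_nat (1, 0) (\<lambda>j (Q, L). (Q * next_q j Q L * (next_L j Q L + 1), next_L j Q L))"
  define Q where "Q j = fst (state j)" for j
  define L where "L j = snd (state j)" for j
  define F where "F j = next_F j (Q j) (L j)" for j
  define q where "q j = next_q j (Q j) (L j)" for j
  have Q_0: "Q 0 = 1" and L_0: "L 0 = 0" by (simp_all add: Q_def L_def state_def)
  have L_Suc: "L (Suc j) = L j + 2 + int j + (\<Sum>f\<in>F j. \<bar>f\<bar>)" and Q_Suc: "Q (Suc j) = Q j * q j * (L (Suc j) + 1)" for j
    by (simp_all add: Q_def L_def F_def q_def state_def next_L_def case_prod_beta)
  have good: "good j (Q j) (L j) (F j) (q j)" if "Q j > 0" "L j \<ge> 0" for j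
    unfolding F_def q_def next_F_def next_q_def by (rule someI_ex[OF ex[OF that]])
  have L_step: "L j + 2 + int j \<le> L (Suc j)" for j
    unfolding L_Suc using sum_nonneg[of "F j" "\<lambda>f. \<bar>f\<bar>"] by (metis abs_ge_zero le_add_same_cancel1)
  have L_ge: "int j \<le> L j" for j
  proof (induction j)
    case (Suc j)
    then show ?case using L_step[of j] by simp
  qed (simp add: L_0)
  have Q_gt: "L j < Q j" for j
  proof (induction j)
    case (Suc j)
    have "Q j > 0" "L j \<ge> 0" "L (Suc j) \<ge> 0" using Suc L_ge[of j] L_ge[of "Suc j"] by linarith+
    moreover from this have "q j > 0" using good[of j] by (simp add: good_def)
    ultimately have "1 * (L (Suc j) + 1) \<le> (Q j * q j) * (L (Suc j) + 1)"
      by (intro mult_right_mono) (simp_all add: int_one_le_iff_zero_less)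
    then show ?case by (simp add: Q_Suc)
  qed (simp add: Q_0 L_0)
  have Q_pos: "Q j > 0" and L_nonneg: "L j \<ge> 0" for j using Q_gt[of j] L_ge[of j] by linarith+
  note good = good[OF Q_pos L_nonneg]
  have finF: "finite (F j)" and FS: "F j \<subseteq> S" for j using good[of j] by (simp_all add: good_def)
  have F_bound: "\<bar>f\<bar> + int j \<le> L j" if "f \<in> F i" "i < j" for f i j
    using that(2)
  proof (induction j)
    case (Suc j)
    show ?case
    proof (cases "i = j")
      case True
      have "\<bar>f\<bar> \<le> (\<Sum>f\<in>F j. \<bar>f\<bar>)" using that(1) True finF[of j] by (intro member_le_sum) auto
      then show ?thesis unfolding L_Suc using L_nonneg[of j] by linarith
    next
      case False
      then show ?thesis using Suc L_step[of j] by simp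
    qed
  qed simp
  define S' where "S' = (\<Union>j. F j)"
  have "bohr_dense S'"
    unfolding bohr_dense_iff
  proof (intro allI impI)
    fix k a and d :: real and m assume d: "d > 0"
    define t where "t = max k (nat \<lceil>1 / d\<rceil>)"
    \<comment> \<open>The code of a pair is at least its second component \<open>t\<close>, which
      gives enough characters and a small enough radius.\<close>
    define j where "j = prod_encode (int_encode m, t)"
    have "t \<le> j" unfolding j_def by (rule le_prod_encode_2)
    moreover have "1 / d \<le> real t" unfolding t_def by linarith
    ultimately have "k \<le> j" "1 / d \<le> real j + 1" by (simp_all add: t_def)
    then have "1 / (real j + 1) \<le> d" using d by (simp add: field_simps)
    then have "bohr_nbhd j a (1 / (real j + 1)) m \<subseteq> bohr_nbhd k a d m"
      using \<open>k \<le> j\<close> by (rule bohr_nbhd_mono[rotated])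
    moreover have "target j = m" by (simp add: target_def j_def)
    moreover have "F j \<inter> bohr_nbhd j a (1 / (real j + 1)) (target j) \<noteq> {}" using good[of j] by (simp add: good_def)
    ultimately show "S' \<inter> bohr_nbhd k a d m \<noteq> {}" unfolding S'_def by blast
  qed
  moreover have "\<not> measurable_recurrence ((\<lambda>s. s - c) ` S' - {0})" for c
  proof -
    define j0 where "j0 = nat \<bar>c\<bar>"
    have half: "1 / 2 ^ Suc j \<le> (1 / 2 :: real)" for j
      using one_le_power[of "2 :: real" j] by (simp add: field_simps)
    have Q0: "0 \<le> 1 / real_of_int (Q j0)" using Q_pos[of j0] by simp
    define E where "E j = (\<Union>i<j. (\<lambda>f. f - c) ` F i) - {0}" for j
    have E_bound: "\<bar>e\<bar> \<le> L j" if e: "e \<in> E j" and j: "j0 \<le> j" for e j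
    proof -
      obtain i f where "i < j" "f \<in> F i" "e = f - c" using e by (auto simp: E_def)
      moreover have "\<bar>c\<bar> \<le> int j" using j by (simp add: j0_def)
      ultimately show ?thesis using F_bound[of f i j] by linarith
    qed
    \<comment> \<open>The losses \<open>1 / 2 ^ (j + 2)\<close> let at least half of the initial
      density \<open>1 / Q j0\<close> survive all stages; the surplus \<open>1 / 2 ^ Suc j\<close>
      makes the induction work.\<close>
    have chain: "\<exists>h. flips (Q j) h (E j) \<and>
        1 / of_int (Q j0) * (1 / 2 + 1 / 2 ^ Suc j) \<le> real (support_count (Q j) h) / of_int (Q j)" if "j0 \<le> j" for j
      using that
    proof (induction j rule: dec_induct)
      case base
      \<comment> \<open>The counters only tolerate perturbations by \<open>c\<close> from stage \<open>j0\<close> on; the finitely many earlier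
        differences are at most \<open>L j0 < Q j0\<close>, so the multiples of \<open>Q j0\<close> avoid them.\<close>
      define h where "h n = (if Q j0 dvd n then 1 else 0 :: int)" for n
      have "flips (Q j0) h (E j0)"
        unfolding flips_def
      proof (intro conjI allI ballI)
        show "Q j0 > 0" by (rule Q_pos)
        show "h n \<in> {-1, 0, 1}" "h (n + Q j0) = h n" for n by (simp_all add: h_def)
        fix e n assume e: "e \<in> E j0"
        show "h n * h (n + e) \<noteq> 1"
        proof
          assume "h n * h (n + e) = 1"
          then have "Q j0 dvd n" "Q j0 dvd n + e" by (auto simp: h_def split: if_splits)
          then have "Q j0 dvd e" using dvd_add_right_iff by blast
          moreover have "e \<noteq> 0" using e by (simp add: E_def)
          ultimately have "\<bar>Q j0\<bar> \<le> \<bar>e\<bar>" by (intro dvd_imp_le_int)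
          then show False using E_bound[OF e order_refl] Q_gt[of j0] by linarith
        qed
      qed
      moreover have "support_count (Q j0) h = 1"
      proof -
        have "{n\<in>{0..<Q j0}. h n \<noteq> 0} = {0}"
          using Q_pos[of j0] by (auto simp: h_def dest: zdvd_imp_le)
        then show ?thesis by (simp only: support_count_def) simp
      qed
      moreover have "1 / of_int (Q j0) * (1 / 2 + 1 / 2 ^ Suc j0) \<le> 1 / of_int (Q j0) * (1 :: real)"
        using half[of j0] by (intro mult_left_mono Q0) linarith
      ultimately show ?case by (intro exI[of _ h]) simp
    next
      case (step j)
      then obtain h where h: "flips (Q j) h (E j)"
        and dens: "1 / of_int (Q j0) * (1 / 2 + 1 / 2 ^ Suc j) \<le> real (support_count (Q j) h) / of_int (Q j)" by blast
      have "\<bar>c\<bar> \<le> L j" using step(1) L_ge[of j] by (simp add: j0_def)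
      moreover have "Q j dvd Q (Suc j)" "q j dvd Q (Suc j)" by (simp_all add: Q_Suc)
      ultimately obtain h' where h': "flips (Q (Suc j)) h' (E j \<union> (\<lambda>f. f - c) ` F j)"
        and dens': "(1 - 1 / 2 ^ (j + 2)) * real (support_count (Q j) h) / of_int (Q j) \<le> real (support_count (Q (Suc j)) h') / of_int (Q (Suc j))"
        using good[of j] h E_bound[OF _ step(1)] Q_pos[of "Suc j"] unfolding good_def by blast
      have "E (Suc j) \<subseteq> E j \<union> (\<lambda>f. f - c) ` F j" unfolding E_def lessThan_Suc by blast
      then have "flips (Q (Suc j)) h' (E (Suc j))" using h' unfolding flips_def by blast
      moreover have "1 / of_int (Q j0) * (1 / 2 + 1 / 2 ^ Suc (Suc j)) \<le> real (support_count (Q (Suc j)) h') / of_int (Q (Suc j))"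
      proof -
        define x where "x = (1 / 2 ^ Suc j :: real)"
        have x: "0 \<le> x" "x \<le> 1 / 2" and x2: "1 / 2 ^ Suc (Suc j) = x / 2" "1 / 2 ^ (j + 2) = x / 2"
          using half[of j] by (simp_all add: x_def)
        \<comment> \<open>The difference of the two sides is
          \<open>x * (1 - 2 * x) / 4\<close>.\<close>
        have "1 / 2 + x / 2 \<le> (1 - x / 2) * (1 / 2 + x)"
          using mult_left_mono[OF x(2) x(1)] by (simp add: algebra_simps)
        then have "1 / of_int (Q j0) * (1 / 2 + x / 2) \<le> 1 / of_int (Q j0) * ((1 - x / 2) * (1 / 2 + x))"
          by (intro mult_left_mono Q0)
        also have "\<dots> = (1 - x / 2) * (1 / of_int (Q j0) * (1 / 2 + x))" by (rule mult.left_commute)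
        also have "\<dots> \<le> (1 - x / 2) * (real (support_count (Q j) h) / of_int (Q j))"
          by (rule mult_left_mono[OF dens[folded x_def]]) (use x in linarith)
        also have "\<dots> \<le> real (support_count (Q (Suc j)) h') / of_int (Q (Suc j))"
          using dens' by (simp only: x2 times_divide_eq_right)
        finally show ?thesis by (simp only: x2)
      qed
      ultimately show ?case by blast
    qed
    show ?thesis
    proof (rule not_measurable_recurrence_if_flips[where \<kappa> = "1 / of_int (Q j0) * (1 / 2)"])
      show "0 < 1 / of_int (Q j0) * (1 / 2 :: real)" using Q_pos[of j0] by simp
      fix R0 assume R0: "finite R0" "R0 \<subseteq> (\<lambda>s. s - c) ` S' - {0}"
      have "\<exists>i. r \<in> (\<lambda>f. f - c) ` F i" if "r \<in> R0" for r
        using R0(2) that unfolding S'_def by blast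
      then obtain i where i: "\<And>r. r \<in> R0 \<Longrightarrow> r \<in> (\<lambda>f. f - c) ` F (i r)" by metis
      obtain J where J: "i ` R0 \<subseteq> {..<J}" using finite_nat_bounded[of "i ` R0"] R0(1) by auto
      define j where "j = max j0 J"
      have "i r < j" if "r \<in> R0" for r
      proof -
        have "i r \<in> {..<J}" using J that by blast
        then show ?thesis by (simp add: j_def)
      qed
      then have sub: "R0 \<subseteq> E j" using i R0(2) unfolding E_def by blast
      obtain h where h: "flips (Q j) h (E j)"
        and dens: "1 / of_int (Q j0) * (1 / 2 + 1 / 2 ^ Suc j) \<le> real (support_count (Q j) h) / of_int (Q j)"
        using chain[of j] by (auto simp: j_def)
      have "1 / of_int (Q j0) * (1 / 2) \<le> 1 / of_int (Q j0) * (1 / 2 + 1 / 2 ^ Suc j :: real)"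
        by (intro mult_left_mono Q0) simp
      moreover have "flips (Q j) h R0" using h sub unfolding flips_def by blast
      ultimately show "\<exists>Q' h. flips Q' h R0 \<and> 1 / of_int (Q j0) * (1 / 2) \<le> real (support_count Q' h) / of_int Q'"
        using dens by (meson order_trans)
    qed
  qed
  moreover have "S' \<subseteq> S" using FS by (auto simp: S'_def)
  ultimately show ?thesis by blast
qed

end
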